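(* Let $B$ be an infinite Blaschke product with uniformly separated zeros $\{a_n\}$. If $-1 < \alpha \le 0$ and $1 + \alpha \le p < 1 + \frac{1}{2}\alpha$, and if \[ \sum_n (1 - |a_n|)^{\frac{p}{2 - p}} < \infty, \] then $f' \in A^p_{\alpha}$ for all $f \in (BH^2)^{\perp}$.
   Context: $U$ denotes the open unit disc in $\mathbb{C}$. For $0<p<\infty$ and $\alpha>-1$, $A_\alpha^p$ is the set of all functions $f$ analytic in $U$ with $\|f\|_{A_\alpha^p} = \left\{\frac{1}{\pi}\iint_U |f(z)|^p (1-|z|)^\alpha\, dA(z)\right\}^{1/p} < \infty$, where $dA$ is Lebesgue area measure. If $\{a_n\}_{n\ge 1}$ is a sequence of complex numbers with $0<|a_n|<1$ for all $n$ and $\sum_n (1-|a_n|)<\infty$, the Blaschke product with zeros $\{a_n\}$ is the analytic function on $U$ given by $B(z) = \prod_{n=1}^\infty \frac{\bar a_n}{|a_n|}\frac{a_n - z}{1-\bar a_n z}$. A sequence $\{a_n\}$ in $U$ is uniformly separated if there is a constant $\delta>0$ such that $\inf_n\prod_{m\ne n}\rho(a_m,a_n)\ge\delta$, where $\rho(z,w) = \left|\frac{z-w}{1-\bar w z}\right|$ is the pseudohyperbolic metric on $U$. $H^2$ is the Hardy space of analytic functions $f$ on $U$ with $\sup_{0<r<1}\left\{\frac{1}{2\pi}\int_0^{2\pi}|f(re^{it})|^2\,dt\right\}^{1/2}<\infty$, with its usual Hilbert space structure. $(BH^2)^\perp = H^2\ominus BH^2$ is the orthogonal complement in $H^2$ of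 the subspace $BH^2$ (the model space for $B$). *)

theory Defs
  imports "HOL-Complex_Analysis.Complex_Analysis"
begin

abbreviation unit_disc :: "complex set" where
  "unit_disc \<equiv> ball 0 1"

text \<open>Functions on the disc are total functions on the complex plane; every notion below depends
  only on their values inside the disc.\<close>

subsection \<open>Weighted Bergman spaces\<close>

text \<open>The quantity required to be finite is the \<open>p\<close>-th power of the norm, so the outer
  exponent \<open>1/p\<close> is left out. Meant for \<open>0 < p\<close> and \<open>-1 < \<alpha>\<close>.\<close>

definition weighted_bergman :: "real \<Rightarrow> real \<Rightarrow> (complex \<Rightarrow> complex) set" where
  "weighted_bergman p \<alpha> = {f. f holomorphic_on unit_disc \<and>
     ennreal (1 / pi) *
       (\<integral>\<^sup>+z\<in>unit_disc. ennreal (norm (f z) powr p * (1 - norm z) powr \<alpha>) \<partial>lborel) < \<infinity>}"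

subsection \<open>Blaschke products\<close>

definition blaschke_sequence :: "(nat \<Rightarrow> complex) \<Rightarrow> bool" where
  "blaschke_sequence a \<longleftrightarrow>
     (\<forall>n. 0 < norm (a n) \<and> norm (a n) < 1) \<and> summable (\<lambda>n. 1 - norm (a n))"

text \<open>The library's \<open>has_prod\<close> allows finitely many vanishing factors, so for a Blaschke sequence
  the product below is the correct value \<open>0\<close> at the points \<open>a n\<close>.\<close>

definition blaschke_product :: "(nat \<Rightarrow> complex) \<Rightarrow> complex \<Rightarrow> complex" where
  "blaschke_product a z =
     (\<Prod>n. cnj (a n) / of_real (norm (a n)) * ((a n - z) / (1 - cnj (a n) * z)))"

definition pseudohyperbolic :: "complex \<Rightarrow> complex \<Rightarrow> real" where
  "pseudohyperbolic z w = norm ((z - w) / (1 - cnj w * z))"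

text \<open>The factors lie in \<open>[0,1]\<close>, so the partial products decrease to a limit. If infinitely many
  factors vanish, or none do and the limit is \<open>0\<close>, the product is not convergent in the library's
  sense and \<open>prodinf\<close> is unspecified; the conjunct \<open>convergent_prod\<close> only excludes such products,
  whose value \<open>0\<close> is below \<open>\<delta>\<close> anyway.\<close>

definition uniformly_separated :: "(nat \<Rightarrow> complex) \<Rightarrow> bool" where
  "uniformly_separated a \<longleftrightarrow> range a \<subseteq> unit_disc \<and>
     (\<exists>\<delta>>0. \<forall>n.
        convergent_prod (\<lambda>m. if m = n then 1 else pseudohyperbolic (a m) (a n)) \<and>
        (\<Prod>m. if m = n then 1 else pseudohyperbolic (a m) (a n)) \<ge> \<delta>)"

subsection \<open>The Hardy space and model spaces\<close>

definition hardy2_mean :: "(complex \<Rightarrow> complex) \<Rightarrow> real \<Rightarrow> real" where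
  "hardy2_mean f r =
     sqrt (1 / (2 * pi) * integral {0..2 * pi} (\<lambda>t. (norm (f (of_real r * cis t)))\<^sup>2))"

definition hardy2 :: "(complex \<Rightarrow> complex) set" where
  "hardy2 = {f. f holomorphic_on unit_disc \<and> bdd_above (hardy2_mean f ` {0<..<1})}"

text \<open>The means \<open>hardy2_mean f r\<close> increase with \<open>r\<close>, so the norm is their limit as \<open>r\<close> tends to
  \<open>1\<close>; by polarization the inner product is the limit below, which exists for all \<open>f\<close>, \<open>g\<close> in the
  Hardy space. It agrees with the inner product of the boundary functions on the circle and with
  that of the sequences of Taylor coefficients.\<close>

definition hardy2_inner :: "(complex \<Rightarrow> complex) \<Rightarrow> (complex \<Rightarrow> complex) \<Rightarrow> complex" where
  "hardy2_inner f g = Lim (at_left 1) (\<lambda>r::real.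
     of_real (1 / (2 * pi)) *
       integral {0..2 * pi} (\<lambda>t. f (of_real r * cis t) * cnj (g (of_real r * cis t))))"

definition model_space :: "(complex \<Rightarrow> complex) \<Rightarrow> (complex \<Rightarrow> complex) set" where
  "model_space B =
     {f \<in> hardy2. \<forall>h \<in> (\<lambda>g z. B z * g z) ` hardy2. hardy2_inner f h = 0}"

end

theory Submission
  imports Defs
begin

text \<open>
  Write \<open>k\<^sub>n(z) = 1 / (1 - cnj (a n) * z)\<close> and \<open>D\<^sub>n = 1 - |a n|\<^sup>2\<close>. Uniform separation makes the
  normalised kernels \<open>D\<^sub>n\<^sup>1\<^sup>/\<^sup>2 k\<^sub>n\<close> a Riesz basis of the model space, so an element \<open>f\<close> of it is
  \<open>\<Sum> b\<^sub>n k\<^sub>n\<close> with \<open>\<Sum> |b\<^sub>n|\<^sup>2 / D\<^sub>n\<close> finite. In the finite form used here, \<open>f\<close> is the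
  locally uniform limit of combinations \<open>f\<^sub>N = \<Sum>\<^sub>n\<^sub><\<^sub>N b\<^sub>n k\<^sub>n\<close> (with \<open>b\<^sub>n\<close> depending on \<open>N\<close>) for which
  \<open>\<Sum> |b\<^sub>n|\<^sup>2 / D\<^sub>n\<close> stays bounded. Since \<open>p \<le> 1\<close>,
  \<open>|f\<^sub>N'|\<^sup>p \<le> \<Sum> |b\<^sub>n|\<^sup>p |k\<^sub>n|\<^sup>2\<^sup>p\<close>. The condition \<open>2 p < 2 + \<alpha>\<close> says exactly that the integral of
  \<open>|k\<^sub>n|\<^sup>2\<^sup>p (1 - |z|)\<^sup>\<alpha>\<close> over the disc is bounded independently of \<open>n\<close>
  (\<open>bergman_kernel_integral_bound\<close>). What is left is \<open>\<Sum> |b\<^sub>n|\<^sup>p\<close>, and Young's inequality bounds it by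
  \<open>\<Sum> |b\<^sub>n|\<^sup>2 / D\<^sub>n\<close> and the sum of \<open>D\<^sub>n\<close> to the power \<open>p / (2 - p)\<close>, which the summability hypothesis
  controls. Fatou's lemma passes to the limit \<open>f\<close>.

  The approximation (\<open>model_space_approximation\<close>) is explicit. Split \<open>B = P R\<close> with \<open>P\<close> the product
  of the first \<open>N\<close> factors. As \<open>f\<close> is orthogonal to \<open>B\<close> times the Szego kernel, \<open>f(z)\<close> may be computed
  by pairing \<open>f\<close> with the reproducing kernel of the model space of \<open>B\<close>; replacing that kernel by the one
  of \<open>P\<close> costs at most a multiple of \<open>(1 - |R(z)|\<^sup>2)\<^sup>1\<^sup>/\<^sup>2\<close>, which tends to \<open>0\<close> locally uniformly because
  \<open>R\<close> tends to \<open>1\<close>. The kernel of \<open>P\<close> is a partial fraction (\<open>finite_blaschke_kernel\<close>): a combination of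
  functions \<open>G\<^sub>n\<close> with coefficients \<open>cnj (k\<^sub>n(z))\<close>. Hence \<open>f\<^sub>N = \<Sum> \<langle>f, G\<^sub>n\<rangle> k\<^sub>n\<close>.

  The bound on \<open>b\<^sub>n = \<langle>f, G\<^sub>n\<rangle>\<close> (\<open>dual_system_bessel\<close>) is a Bessel inequality for the \<open>G\<^sub>n\<close>. On the
  circle \<open>|P| = 1\<close> and \<open>G\<^sub>n\<close> is \<open>P\<close> times a multiple of \<open>1 / (w - a n)\<close> of size at most
  \<open>D\<^sub>n / \<delta>\<close>, so the inequality reduces to the boundedness of the Cauchy matrix
  \<open>1 / (1 - a i * cnj (a j))\<close> (\<open>cauchy_form_bound\<close>). This is Carleson's embedding theorem for the
  points \<open>a n\<close>; it is obtained here from the bound on the sums of \<open>D\<^sub>i D\<^sub>j / |1 - cnj (a i) * a j|\<^sup>2\<close>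
  by the inequality \<open>T T\<^sup>* \<le> C (T + T\<^sup>*)\<close> for a matrix \<open>T\<close> with nonnegative entries.
\<close>

section \<open>Pseudohyperbolic geometry of the disc\<close>

lemma norm_diff_le_norm_one_minus_cnj:
  fixes a b :: complex
  assumes "norm a \<le> 1" "norm b \<le> 1"
  shows "norm (a - b) \<le> norm (1 - cnj b * a)"
proof -
  have "(norm (1 - cnj b * a))\<^sup>2 - (norm (a - b))\<^sup>2 = (1 - (norm a)\<^sup>2) * (1 - (norm b)\<^sup>2)"
    unfolding cmod_power2 by (simp add: power2_eq_square algebra_simps)
  moreover have "(norm a)\<^sup>2 \<le> 1" "(norm b)\<^sup>2 \<le> 1" using assms by (auto simp: power_le_one)
  moreover from this have "0 \<le> (1 - (norm a)\<^sup>2) * (1 - (norm b)\<^sup>2)" by simp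
  ultimately have "(norm (a - b))\<^sup>2 \<le> (norm (1 - cnj b * a))\<^sup>2" by linarith
  thus ?thesis by (rule power2_le_imp_le) auto
qed

lemma norm_one_minus_cnj_commute: "norm (1 - cnj a * b) = norm (1 - cnj b * a)"
proof -
  have "1 - cnj b * a = cnj (1 - cnj a * b)" by (simp add: mult.commute)
  thus ?thesis by (simp only: complex_mod_cnj)
qed

lemma norm_one_minus_cnj_ge:
  assumes "norm a \<le> 1" "norm z \<le> 1"
  shows "1 - norm z \<le> norm (1 - cnj a * z)"
proof -
  have "norm (cnj a * z) \<le> norm z" using assms by (simp add: norm_mult mult_left_le_one_le)
  thus ?thesis using norm_triangle_ineq2[of 1 "cnj a * z"] by simp
qed

lemma one_minus_cnj_mult_ne_0:
  fixes a z :: complex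
  assumes "norm a < 1" "norm z \<le> 1"
  shows "1 - cnj a * z \<noteq> 0"
proof
  assume "1 - cnj a * z = 0"
  hence "norm (cnj a * z) = 1" by (simp flip: eq_iff_diff_eq_0)
  hence "norm a * norm z = 1" by (simp add: norm_mult)
  thus False using assms mult_left_le[of "norm z" "norm a"] by auto
qed

text \<open>Because \<open>|b - c| \<le> |1 - cnj c * b|\<close>, the quantity \<open>|1 - cnj a * b|\<close> obeys the triangle inequality
  although it is not a metric (it does not vanish for \<open>a = b\<close>).\<close>

lemma norm_one_minus_cnj_triangle:
  assumes "norm a \<le> 1" "norm b \<le> 1" "norm c \<le> 1"
  shows "norm (1 - cnj a * c) \<le> norm (1 - cnj a * b) + norm (1 - cnj b * c)"
proof -
  have "1 - cnj a * c = (1 - cnj a * b) + cnj a * (b - c)" by (simp add: algebra_simps)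
  hence "norm (1 - cnj a * c) \<le> norm (1 - cnj a * b) + norm (cnj a * (b - c))"
    by (simp only: norm_triangle_ineq)
  also have "norm (cnj a * (b - c)) \<le> 1 * norm (1 - cnj c * b)"
    unfolding norm_mult using assms norm_diff_le_norm_one_minus_cnj[of b c]
    by (intro mult_mono) auto
  finally show ?thesis by (simp add: norm_one_minus_cnj_commute[of c b])
qed

text \<open>This identity turns a lower bound on a product of pseudohyperbolic distances into an upper bound
  on a sum over the squared entries of the Cauchy matrix.\<close>

lemma one_minus_pseudohyperbolic_sq:
  assumes "norm z < 1" "norm w < 1"
  shows "1 - (pseudohyperbolic z w)\<^sup>2
       = (1 - (norm z)\<^sup>2) * (1 - (norm w)\<^sup>2) / (norm (1 - cnj w * z))\<^sup>2"
proof -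
  have "(norm (1 - cnj w * z))\<^sup>2 - (norm (z - w))\<^sup>2 = (1 - (norm z)\<^sup>2) * (1 - (norm w)\<^sup>2)"
    unfolding cmod_power2 by (simp add: power2_eq_square algebra_simps)
  moreover have "norm (1 - cnj w * z) \<noteq> 0" using one_minus_cnj_mult_ne_0[of w z] assms by simp
  ultimately show ?thesis
    by (simp add: pseudohyperbolic_def norm_divide power_divide field_simps)
qed

lemma pseudohyperbolic_bounds:
  assumes "norm z < 1" "norm w < 1"
  shows "0 \<le> pseudohyperbolic z w" "pseudohyperbolic z w \<le> 1"
proof -
  show "0 \<le> pseudohyperbolic z w" by (simp add: pseudohyperbolic_def)
  have "(norm z)\<^sup>2 \<le> 1" "(norm w)\<^sup>2 \<le> 1" using assms by (auto simp: power_le_one)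
  hence "0 \<le> 1 - (pseudohyperbolic z w)\<^sup>2"
    unfolding one_minus_pseudohyperbolic_sq[OF assms] by simp
  thus "pseudohyperbolic z w \<le> 1" by (simp add: abs_square_le_1 abs_le_iff)
qed

lemma pseudohyperbolic_commute: "pseudohyperbolic z w = pseudohyperbolic w z"
  unfolding pseudohyperbolic_def norm_divide norm_one_minus_cnj_commute[of w z]
  by (simp add: norm_minus_commute)

section \<open>Boundedness of the Cauchy matrix of a separated sequence\<close>

text \<open>One of \<open>x\<close>, \<open>y\<close> is at least \<open>z / 2\<close>, so the product of the inverse squares is controlled by the
  inverse square of \<open>z\<close> times the other factor.\<close>

lemma inverse_product_le_of_triangle:
  fixes x y z :: real
  assumes "x > 0" "y > 0" "z > 0" "z \<le> x + y"
  shows "1 / (x\<^sup>2 * y\<^sup>2) \<le> 4 / z\<^sup>2 * (1 / x\<^sup>2 + 1 / y\<^sup>2)"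
proof -
  have z: "z\<^sup>2 \<le> (x + y)\<^sup>2" using assms by (intro power_mono) auto
  have "(x + y)\<^sup>2 \<le> 2 * (x\<^sup>2 + y\<^sup>2)"
    using zero_le_power2[of "x - y"] by (simp add: power2_diff power2_sum)
  also have "\<dots> \<le> 4 * (x\<^sup>2 + y\<^sup>2)" by simp
  finally have z: "z\<^sup>2 \<le> 4 * (x\<^sup>2 + y\<^sup>2)" using z by (rule order.trans[rotated])
  have "1 / (x\<^sup>2 * y\<^sup>2) = z\<^sup>2 * (1 / (z\<^sup>2 * (x\<^sup>2 * y\<^sup>2)))"
    using assms by simp
  also have "\<dots> \<le> (4 * (x\<^sup>2 + y\<^sup>2)) * (1 / (z\<^sup>2 * (x\<^sup>2 * y\<^sup>2)))"
    using z by (intro mult_right_mono) auto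
  also have "\<dots> = 4 / z\<^sup>2 * (1 / x\<^sup>2 + 1 / y\<^sup>2)"
    using assms by (simp add: field_simps)
  finally show ?thesis .
qed

lemma sum_square_expand:
  fixes f :: "'i \<Rightarrow> real"
  shows "(\<Sum>n\<in>I. f n)\<^sup>2 = (\<Sum>n\<in>I. \<Sum>k\<in>I. f n * f k)"
  by (simp add: power2_eq_square sum_product)

text \<open>Let \<open>T\<close> have the kernel \<open>D i / (e i j)\<^sup>2\<close> on the \<open>\<ell>\<^sup>2\<close> space with weights \<open>D\<close>. The form is that of
  \<open>T + T\<^sup>*\<close>; write \<open>Q\<close> for its value at \<open>v\<close> and \<open>V\<close> for the squared norm of \<open>v\<close>. The triangle
  inequality and the test hypothesis give \<open>T T\<^sup>* \<le> 4 A (T + T\<^sup>*)\<close> entrywise, so the vector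
  \<open>S = T\<^sup>* v\<close> has squared norm at most \<open>4 A Q\<close>. Since \<open>Q = 2 \<langle>v, S\<rangle>\<close>, the Cauchy-Schwarz inequality
  yields \<open>Q\<^sup>2 \<le> 16 A V Q\<close>, and \<open>Q\<close> cancels.\<close>

lemma quasimetric_form_bound:
  fixes D v :: "'i \<Rightarrow> real" and e :: "'i \<Rightarrow> 'i \<Rightarrow> real"
  assumes "finite I"
    and D: "\<And>i. i \<in> I \<Longrightarrow> D i > 0"
    and e: "\<And>i j. i \<in> I \<Longrightarrow> j \<in> I \<Longrightarrow> e i j > 0"
    and sym: "\<And>i j. i \<in> I \<Longrightarrow> j \<in> I \<Longrightarrow> e i j = e j i"
    and tri: "\<And>i j k. i \<in> I \<Longrightarrow> j \<in> I \<Longrightarrow> k \<in> I \<Longrightarrow> e i k \<le> e i j + e j k"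
    and test: "\<And>i. i \<in> I \<Longrightarrow> (\<Sum>j\<in>I. D i * D j / (e i j)\<^sup>2) \<le> A"
    and v: "\<And>i. i \<in> I \<Longrightarrow> v i \<ge> 0"
  shows "(\<Sum>i\<in>I. \<Sum>j\<in>I. D i * v i * (D j * v j) * ((D i + D j) / (e i j)\<^sup>2))
          \<le> 16 * A * (\<Sum>i\<in>I. D i * (v i)\<^sup>2)"
proof -
  define q where "q = (\<lambda>i j. D i * v i * (D j * v j) * ((D i + D j) / (e i j)\<^sup>2))"
  define Q where "Q = (\<Sum>i\<in>I. \<Sum>j\<in>I. q i j)"
  define S where "S = (\<lambda>m. \<Sum>n\<in>I. D n ^ 2 * v n / (e n m)\<^sup>2)"
  define V where "V = (\<Sum>i\<in>I. D i * (v i)\<^sup>2)"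
  have Q0: "Q \<ge> 0" unfolding Q_def q_def
    using D e v by (intro sum_nonneg) (auto simp: less_imp_le add_nonneg_nonneg)
  have V0: "V \<ge> 0" unfolding V_def using D by (intro sum_nonneg) (auto simp: less_imp_le)
  have test': "(\<Sum>m\<in>I. D m / (e n m)\<^sup>2) \<le> A / D n" if "n \<in> I" for n
  proof -
    have "D n * (\<Sum>m\<in>I. D m / (e n m)\<^sup>2) \<le> A"
      using test[OF that] by (simp add: sum_distrib_left)
    thus ?thesis using D[OF that] by (simp add: field_simps)
  qed
  have triple: "(\<Sum>m\<in>I. D m * (D n ^ 2 * v n / (e n m)\<^sup>2 * (D k ^ 2 * v k / (e k m)\<^sup>2)))
      \<le> 4 * A * q n k" if nk: "n \<in> I" "k \<in> I" for n k
  proof -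
    define c where "c = D n ^ 2 * v n * (D k ^ 2 * v k)"
    have c: "c \<ge> 0" unfolding c_def using v nk by auto
    have "(\<Sum>m\<in>I. D m * (D n ^ 2 * v n / (e n m)\<^sup>2 * (D k ^ 2 * v k / (e k m)\<^sup>2)))
        = (\<Sum>m\<in>I. c * D m * (1 / ((e n m)\<^sup>2 * (e k m)\<^sup>2)))"
      by (simp add: c_def mult_ac)
    also have "\<dots> \<le> (\<Sum>m\<in>I. c * D m * (4 / (e n k)\<^sup>2 * (1 / (e n m)\<^sup>2 + 1 / (e k m)\<^sup>2)))"
    proof (intro sum_mono mult_left_mono)
      fix m assume m: "m \<in> I"
      show "1 / ((e n m)\<^sup>2 * (e k m)\<^sup>2) \<le> 4 / (e n k)\<^sup>2 * (1 / (e n m)\<^sup>2 + 1 / (e k m)\<^sup>2)"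
        using e[OF nk(1) m] e[OF nk(2) m] e[OF nk] tri[OF nk(1) m nk(2)] sym[OF nk(2) m]
        by (intro inverse_product_le_of_triangle) auto
      show "0 \<le> c * D m" using c D[OF m] by auto
    qed
    also have "\<dots> = 4 * c / (e n k)\<^sup>2 * ((\<Sum>m\<in>I. D m / (e n m)\<^sup>2) + (\<Sum>m\<in>I. D m / (e k m)\<^sup>2))"
      unfolding sum.distrib[symmetric] sum_distrib_left
      by (intro sum.cong refl) (simp add: algebra_simps add_divide_distrib)
    also have "\<dots> \<le> 4 * c / (e n k)\<^sup>2 * (A / D n + A / D k)"
      using c test' nk by (intro mult_left_mono add_mono) auto
    also have "\<dots> = 4 * A * q n k"
      using D[OF nk(1)] D[OF nk(2)] e[OF nk] unfolding c_def q_def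
      by (simp add: field_simps power2_eq_square)
    finally show ?thesis .
  qed
  have "(\<Sum>m\<in>I. D m * (S m)\<^sup>2) =
      (\<Sum>m\<in>I. \<Sum>n\<in>I. \<Sum>k\<in>I. D m * (D n ^ 2 * v n / (e n m)\<^sup>2 * (D k ^ 2 * v k / (e k m)\<^sup>2)))"
    unfolding S_def sum_square_expand by (simp add: sum_distrib_left)
  also have "\<dots> = (\<Sum>n\<in>I. \<Sum>k\<in>I. \<Sum>m\<in>I. D m * (D n ^ 2 * v n / (e n m)\<^sup>2 * (D k ^ 2 * v k / (e k m)\<^sup>2)))"
    by (subst sum.swap, rule sum.cong[OF refl], rule sum.swap)
  also have "\<dots> \<le> (\<Sum>n\<in>I. \<Sum>k\<in>I. 4 * A * q n k)"
    by (intro sum_mono triple)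
  also have "\<dots> = 4 * A * Q" unfolding Q_def by (simp add: sum_distrib_left)
  finally have S2: "(\<Sum>m\<in>I. D m * (S m)\<^sup>2) \<le> 4 * A * Q" .
  have DS: "(\<Sum>m\<in>I. D m * v m * S m) = (\<Sum>m\<in>I. \<Sum>n\<in>I. D n * v n * (D m * v m) * (D n / (e n m)\<^sup>2))"
    unfolding S_def by (simp add: sum_distrib_left power2_eq_square mult_ac)
  have DS': "(\<Sum>m\<in>I. D m * v m * S m) = (\<Sum>n\<in>I. \<Sum>m\<in>I. D n * v n * (D m * v m) * (D m / (e n m)\<^sup>2))"
    unfolding DS using sym by (intro sum.cong refl) (simp add: mult_ac)
  have "Q = 2 * (\<Sum>m\<in>I. D m * v m * S m)"
  proof -
    have "Q = (\<Sum>n\<in>I. \<Sum>m\<in>I. D n * v n * (D m * v m) * (D n / (e n m)\<^sup>2))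
        + (\<Sum>n\<in>I. \<Sum>m\<in>I. D n * v n * (D m * v m) * (D m / (e n m)\<^sup>2))"
      unfolding Q_def q_def sum.distrib[symmetric]
      by (intro sum.cong refl) (simp add: distrib_left add_divide_distrib)
    also have "(\<Sum>n\<in>I. \<Sum>m\<in>I. D n * v n * (D m * v m) * (D n / (e n m)\<^sup>2)) = (\<Sum>m\<in>I. D m * v m * S m)"
      unfolding DS by (rule sum.swap)
    finally show ?thesis using DS' by simp
  qed
  hence "Q\<^sup>2 = 4 * (\<Sum>m\<in>I. D m * v m * S m)\<^sup>2" by (simp add: power_mult_distrib)
  also have "(\<Sum>m\<in>I. D m * v m * S m)\<^sup>2 = (\<Sum>m\<in>I. (sqrt (D m) * v m) * (sqrt (D m) * S m))\<^sup>2"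
  proof -
    have "D m * v m * S m = (sqrt (D m) * v m) * (sqrt (D m) * S m)" if "m \<in> I" for m
    proof -
      have "(sqrt (D m) * v m) * (sqrt (D m) * S m) = (sqrt (D m) * sqrt (D m)) * v m * S m"
        by (simp only: mult_ac)
      thus ?thesis using D[OF that] by simp
    qed
    thus ?thesis by (intro arg_cong[where f = power2] sum.cong refl)
  qed
  also have "\<dots> \<le> (\<Sum>m\<in>I. (sqrt (D m) * v m)\<^sup>2) * (\<Sum>m\<in>I. (sqrt (D m) * S m)\<^sup>2)"
    by (rule Cauchy_Schwarz_ineq_sum)
  also have "\<dots> = V * (\<Sum>m\<in>I. D m * (S m)\<^sup>2)"
    unfolding V_def using D by (simp add: power_mult_distrib less_imp_le)
  also have "\<dots> \<le> V * (4 * A * Q)" using S2 V0 by (intro mult_left_mono)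
  finally have "Q * Q \<le> (16 * A * V) * Q" by (simp add: power2_eq_square algebra_simps)
  moreover have "0 \<le> 16 * A * V"
  proof (cases "I = {}")
    case True thus ?thesis by (simp add: V_def)
  next
    case False
    then obtain i where i: "i \<in> I" by auto
    have "0 \<le> (\<Sum>j\<in>I. D i * D j / (e i j)\<^sup>2)" using D i
      by (intro sum_nonneg) (auto simp: less_imp_le)
    with test[OF i] V0 show ?thesis by auto
  qed
  ultimately have "Q \<le> 16 * A * V"
    using Q0 by (cases "Q = 0") auto
  thus ?thesis unfolding Q_def q_def V_def .
qed

text \<open>Geometric series display the Cauchy form as a sum of squares.\<close>

lemma cauchy_form_sums:
  fixes x a :: "'i \<Rightarrow> complex"
  assumes "finite I" and a: "\<And>i. i \<in> I \<Longrightarrow> norm (a i) < 1"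
  shows "(\<lambda>k. complex_of_real ((norm (\<Sum>i\<in>I. x i * a i ^ k))\<^sup>2)) sums
           (\<Sum>i\<in>I. \<Sum>j\<in>I. x i * cnj (x j) / (1 - a i * cnj (a j)))"
proof -
  have "(\<lambda>k. \<Sum>i\<in>I. \<Sum>j\<in>I. x i * cnj (x j) * (a i * cnj (a j)) ^ k) sums
           (\<Sum>i\<in>I. \<Sum>j\<in>I. x i * cnj (x j) * (1 / (1 - a i * cnj (a j))))"
  proof (intro sums_sum sums_mult geometric_sums)
    fix i j assume "i \<in> I" "j \<in> I"
    hence "norm (a i) * norm (a j) < 1 * 1" using a by (intro mult_strict_mono') auto
    thus "norm (a i * cnj (a j)) < 1" by (simp add: norm_mult)
  qed
  moreover have "complex_of_real ((norm (\<Sum>i\<in>I. x i * a i ^ k))\<^sup>2) =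
      (\<Sum>i\<in>I. \<Sum>j\<in>I. x i * cnj (x j) * (a i * cnj (a j)) ^ k)" for k
    unfolding complex_norm_square cnj_sum sum_product
    by (intro sum.cong refl) (simp add: power_mult_distrib mult_ac)
  ultimately show ?thesis by simp
qed

lemma sum_inverse_one_minus:
  fixes u v :: complex
  assumes "1 - u \<noteq> 0" "1 - v \<noteq> 0"
  shows "1 / (1 - u) + 1 / (1 - v) - 1 = (1 - u * v) / ((1 - v) * (1 - u))"
proof -
  have "1 / (1 - u) = (1 - v) / ((1 - v) * (1 - u))" "1 / (1 - v) = (1 - u) / ((1 - v) * (1 - u))"
    "(1 - v) * (1 - u) / ((1 - v) * (1 - u)) = 1"
    using assms by simp_all
  hence "1 / (1 - u) + 1 / (1 - v) - 1
      = ((1 - v) + (1 - u) - (1 - v) * (1 - u)) / ((1 - v) * (1 - u))"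
    by (simp only: diff_divide_distrib add_divide_distrib)
  also have "(1 - v) + (1 - u) - (1 - v) * (1 - u) = 1 - u * v" by (simp add: algebra_simps)
  finally show ?thesis .
qed

text \<open>The absolute values of the entries \<open>1 / (1 - a i * cnj (a j))\<close> are too large for an entrywise
  estimate. The conjugate form is at least \<open>|\<Sum> x i|\<^sup>2\<close>; adding their difference only increases the
  value and replaces the Cauchy kernel by the Poisson kernel
  \<open>(1 - |a i|\<^sup>2 |a j|\<^sup>2) / |1 - cnj (a i) * a j|\<^sup>2\<close>; this one may be estimated entrywise.\<close>

lemma cauchy_form_bound:
  fixes x a :: "'i \<Rightarrow> complex"
  assumes fin: "finite I" and a: "\<And>i. i \<in> I \<Longrightarrow> norm (a i) < 1"
    and test: "\<And>i. i \<in> I \<Longrightarrow>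
      (\<Sum>j\<in>I. (1 - (norm (a i))\<^sup>2) * (1 - (norm (a j))\<^sup>2) / (norm (1 - cnj (a i) * a j))\<^sup>2) \<le> A"
  shows "norm (\<Sum>i\<in>I. \<Sum>j\<in>I. x i * cnj (x j) / (1 - a i * cnj (a j)))
          \<le> 16 * A * (\<Sum>i\<in>I. (norm (x i))\<^sup>2 / (1 - (norm (a i))\<^sup>2))"
proof -
  define D where "D = (\<lambda>i. 1 - (norm (a i))\<^sup>2)"
  define e where "e = (\<lambda>i j. norm (1 - cnj (a i) * a j))"
  define S where "S = (\<Sum>i\<in>I. \<Sum>j\<in>I. x i * cnj (x j) / (1 - a i * cnj (a j)))"
  define T where "T = (\<Sum>i\<in>I. \<Sum>j\<in>I. x i * cnj (x j) / (1 - cnj (a i) * a j))"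
  define P where "P = (\<lambda>i j. 1 / (1 - a i * cnj (a j)) + 1 / (1 - cnj (a i) * a j) - 1)"
  have D: "D i > 0" if "i \<in> I" for i
    using a[OF that] unfolding D_def by (simp add: power_less_one_iff abs_square_less_1)
  have ne: "1 - cnj (a i) * a j \<noteq> 0" "1 - a i * cnj (a j) \<noteq> 0" if "i \<in> I" "j \<in> I" for i j
    using one_minus_cnj_mult_ne_0[of "a i" "a j"] one_minus_cnj_mult_ne_0[of "a j" "a i"] a that
    by (auto simp: less_imp_le mult.commute)
  have e: "e i j > 0" if "i \<in> I" "j \<in> I" for i j
    using ne[OF that] unfolding e_def by simp
  have Ssums: "(\<lambda>k. complex_of_real ((norm (\<Sum>i\<in>I. x i * a i ^ k))\<^sup>2)) sums S"
    unfolding S_def by (rule cauchy_form_sums[OF fin a])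
  have "(\<lambda>k. complex_of_real ((norm (\<Sum>i\<in>I. x i * cnj (a i) ^ k))\<^sup>2)) sums
      (\<Sum>i\<in>I. \<Sum>j\<in>I. x i * cnj (x j) / (1 - cnj (a i) * cnj (cnj (a j))))"
    using a by (intro cauchy_form_sums[OF fin]) auto
  hence Tsums: "(\<lambda>k. complex_of_real ((norm (\<Sum>i\<in>I. x i * cnj (a i) ^ k))\<^sup>2)) sums T"
    unfolding T_def by simp
  from sums_Re[OF Ssums] have SRe: "(\<lambda>k. (norm (\<Sum>i\<in>I. x i * a i ^ k))\<^sup>2) sums Re S" by simp
  from sums_Im[OF Ssums] have "(\<lambda>k. 0::real) sums Im S" by simp
  hence ImS: "Im S = 0" using sums_unique2 sums_zero by blast
  have ReS: "Re S \<ge> 0" using sums_le[OF _ sums_zero SRe] by simp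
  have nS: "norm S = Re S" using ImS ReS by (simp add: cmod_def)
  from sums_Re[OF Tsums] have TRe: "(\<lambda>k. (norm (\<Sum>i\<in>I. x i * cnj (a i) ^ k))\<^sup>2) sums Re T" by simp
  \<comment> \<open>The first term of the series for \<open>T\<close>.\<close>
  have "(norm (\<Sum>i\<in>I. x i))\<^sup>2 \<le> Re T"
    using sum_le_suminf[OF sums_summable[OF TRe], of "{0}"] sums_unique[OF TRe] by simp
  hence "Re S \<le> Re (S + T - of_real ((norm (\<Sum>i\<in>I. x i))\<^sup>2))" by simp
  also have "S + T - of_real ((norm (\<Sum>i\<in>I. x i))\<^sup>2) = (\<Sum>i\<in>I. \<Sum>j\<in>I. x i * cnj (x j) * P i j)"
    unfolding S_def T_def complex_norm_square cnj_sum sum_product sum.distrib[symmetric]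
      sum_subtractf[symmetric] P_def
    by (intro sum.cong refl) (simp add: algebra_simps)
  also have "Re \<dots> \<le> norm (\<Sum>i\<in>I. \<Sum>j\<in>I. x i * cnj (x j) * P i j)" by (rule complex_Re_le_cmod)
  also have "\<dots> \<le> (\<Sum>i\<in>I. \<Sum>j\<in>I. norm (x i * cnj (x j) * P i j))"
    by (intro order.trans[OF norm_sum] sum_mono norm_sum)
  also have "\<dots> \<le> (\<Sum>i\<in>I. \<Sum>j\<in>I. norm (x i) * norm (x j) * ((D i + D j) / (e i j)\<^sup>2))"
  proof (intro sum_mono)
    fix i j assume ij: "i \<in> I" "j \<in> I"
    have "P i j = (1 - of_real ((norm (a i))\<^sup>2 * (norm (a j))\<^sup>2)) / of_real ((e i j)\<^sup>2)"
      unfolding P_def e_def of_real_mult complex_norm_square using ne[OF ij] ne[OF ij(2,1)]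
      using sum_inverse_one_minus[OF ne(2)[OF ij] ne(1)[OF ij]] by (simp add: mult_ac)
    also have "\<dots> = of_real ((1 - (norm (a i))\<^sup>2 * (norm (a j))\<^sup>2) / (e i j)\<^sup>2)" by simp
    finally have "norm (P i j) = \<bar>1 - (norm (a i))\<^sup>2 * (norm (a j))\<^sup>2\<bar> / (e i j)\<^sup>2"
      by (simp only: norm_of_real) simp
    also have "\<bar>1 - (norm (a i))\<^sup>2 * (norm (a j))\<^sup>2\<bar> \<le> D i + D j"
    proof -
      have "(norm (a i))\<^sup>2 \<le> 1" "(norm (a j))\<^sup>2 \<le> 1"
        using D[OF ij(1)] D[OF ij(2)] unfolding D_def by auto
      moreover have "0 \<le> (1 - (norm (a i))\<^sup>2) * (1 - (norm (a j))\<^sup>2)" using calculation by simp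
      moreover have "(norm (a i))\<^sup>2 * (norm (a j))\<^sup>2 \<le> 1"
        using calculation by (simp add: mult_le_one)
      ultimately show ?thesis unfolding D_def by (simp add: algebra_simps)
    qed
    finally have "norm (P i j) \<le> (D i + D j) / (e i j)\<^sup>2" by (simp add: divide_right_mono)
    thus "norm (x i * cnj (x j) * P i j) \<le> norm (x i) * norm (x j) * ((D i + D j) / (e i j)\<^sup>2)"
      unfolding norm_mult complex_mod_cnj by (intro mult_left_mono) auto
  qed
  also have "\<dots> = (\<Sum>i\<in>I. \<Sum>j\<in>I. D i * (norm (x i) / D i) * (D j * (norm (x j) / D j))
                        * ((D i + D j) / (e i j)\<^sup>2))"
    using D by (intro sum.cong refl) (auto simp: less_imp_neq[symmetric])
  also have "\<dots> \<le> 16 * A * (\<Sum>i\<in>I. D i * (norm (x i) / D i)\<^sup>2)"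
  proof (rule quasimetric_form_bound[OF fin D])
    show "e i j > 0" if "i \<in> I" "j \<in> I" for i j using e that .
    show "e i j = e j i" for i j unfolding e_def by (rule norm_one_minus_cnj_commute)
    show "e i k \<le> e i j + e j k" if "i \<in> I" "j \<in> I" "k \<in> I" for i j k
      unfolding e_def using a that by (intro norm_one_minus_cnj_triangle) (auto simp: less_imp_le)
    show "(\<Sum>j\<in>I. D i * D j / (e i j)\<^sup>2) \<le> A" if "i \<in> I" for i
      unfolding D_def e_def by (rule test[OF that])
    show "norm (x i) / D i \<ge> 0" if "i \<in> I" for i using D[OF that] by simp
  qed
  also have "(\<Sum>i\<in>I. D i * (norm (x i) / D i)\<^sup>2) = (\<Sum>i\<in>I. (norm (x i))\<^sup>2 / D i)"
    using D by (intro sum.cong refl) (auto simp: power2_eq_square less_imp_neq[symmetric])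
  finally show ?thesis using nS unfolding S_def D_def by simp
qed

text \<open>Uniform separation with constant \<open>\<delta>\<close>, in terms of finite products only.\<close>

definition finitely_separated :: "(nat \<Rightarrow> complex) \<Rightarrow> real \<Rightarrow> bool" where
  "finitely_separated a \<delta> \<longleftrightarrow> 0 < \<delta> \<and> (\<forall>n. norm (a n) < 1) \<and>
     (\<forall>N n. \<delta> \<le> (\<Prod>m\<in>{..<N} - {n}. pseudohyperbolic (a m) (a n)))"

lemma uniformly_separated_imp_finitely_separated:
  assumes "uniformly_separated a"
  obtains \<delta> where "finitely_separated a \<delta>"
proof -
  from assms obtain \<delta> where \<delta>: "\<delta> > 0" and a: "range a \<subseteq> unit_disc"
    and conv: "\<And>n. convergent_prod (\<lambda>m. if m = n then 1 else pseudohyperbolic (a m) (a n))"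
    and inf: "\<And>n. (\<Prod>m. if m = n then 1 else pseudohyperbolic (a m) (a n)) \<ge> \<delta>"
    unfolding uniformly_separated_def by blast
  have a1: "norm (a n) < 1" for n using subsetD[OF a rangeI[of a n]] by simp
  have "\<delta> \<le> (\<Prod>m\<in>{..<N} - {n}. pseudohyperbolic (a m) (a n))" for N n
  proof -
    define f where "f = (\<lambda>m. if m = n then 1 else pseudohyperbolic (a m) (a n))"
    have "\<delta> \<le> prodinf f" using inf[of n] unfolding f_def .
    also have "\<dots> \<le> prod f {..<N}"
    proof (rule prod_ge_prodinf)
      show "f has_prod prodinf f" using conv[of n] unfolding f_def by blast
    qed (auto simp: f_def pseudohyperbolic_bounds a1)
    also have "prod f {..<N} = (\<Prod>m\<in>{..<N} - {n}. f m)"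
      by (rule prod.mono_neutral_right) (auto simp: f_def)
    also have "\<dots> = (\<Prod>m\<in>{..<N} - {n}. pseudohyperbolic (a m) (a n))"
      by (intro prod.cong) (auto simp: f_def)
    finally show ?thesis .
  qed
  with \<delta> a1 show ?thesis using that unfolding finitely_separated_def by blast
qed

lemma finitely_separated_imp_inj:
  assumes "finitely_separated a \<delta>"
  shows "inj a"
proof (rule injI, rule ccontr)
  fix m n assume mn: "a m = a n" "m \<noteq> n"
  have "m \<in> {..<Suc m} - {n}" using mn by auto
  moreover have "pseudohyperbolic (a m) (a n) = 0" using mn by (simp add: pseudohyperbolic_def)
  ultimately have "(\<Prod>m\<in>{..<Suc m} - {n}. pseudohyperbolic (a m) (a n)) = 0"
    by (intro prod_zero) blast+
  moreover have "0 < \<delta>" "\<delta> \<le> (\<Prod>m\<in>{..<Suc m} - {n}. pseudohyperbolic (a m) (a n))"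
    using assms unfolding finitely_separated_def by auto
  ultimately show False by linarith
qed

text \<open>Apply \<open>x \<le> exp (x - 1)\<close> to each \<open>\<rho>\<^sup>2\<close>: a lower bound on the product bounds the sum of the
  \<open>1 - \<rho>\<^sup>2\<close>. The summand \<open>1\<close> in the bound is the diagonal term \<open>m = n\<close>.\<close>

lemma finitely_separated_imp_kernel_test:
  assumes sep: "finitely_separated a \<delta>" and n: "n < N"
  shows "(\<Sum>m<N. (1 - (norm (a n))\<^sup>2) * (1 - (norm (a m))\<^sup>2) / (norm (1 - cnj (a n) * a m))\<^sup>2)
           \<le> 1 + 2 * ln (1 / \<delta>)"
proof -
  have \<delta>: "\<delta> > 0" and a: "norm (a m) < 1" for m
    using sep unfolding finitely_separated_def by auto
  define \<rho> where "\<rho> = (\<lambda>m. pseudohyperbolic (a m) (a n))"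
  have \<rho>: "0 \<le> \<rho> m" "\<rho> m \<le> 1" for m using pseudohyperbolic_bounds a unfolding \<rho>_def by auto
  have "\<delta>\<^sup>2 \<le> (\<Prod>m\<in>{..<N} - {n}. \<rho> m)\<^sup>2"
    using sep \<delta> unfolding finitely_separated_def \<rho>_def by (intro power_mono) auto
  also have "\<dots> = (\<Prod>m\<in>{..<N} - {n}. (\<rho> m)\<^sup>2)" by (rule prod_power_distrib)
  also have "\<dots> \<le> (\<Prod>m\<in>{..<N} - {n}. exp (- (1 - (\<rho> m)\<^sup>2)))"
  proof (rule prod_mono)
    fix m show "0 \<le> (\<rho> m)\<^sup>2 \<and> (\<rho> m)\<^sup>2 \<le> exp (- (1 - (\<rho> m)\<^sup>2))"
      using exp_ge_add_one_self[of "- (1 - (\<rho> m)\<^sup>2)"] by simp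
  qed
  also have "\<dots> = exp (- (\<Sum>m\<in>{..<N} - {n}. 1 - (\<rho> m)\<^sup>2))"
    by (simp add: exp_sum[symmetric] sum_negf[symmetric])
  finally have "\<delta>\<^sup>2 \<le> exp (- (\<Sum>m\<in>{..<N} - {n}. 1 - (\<rho> m)\<^sup>2))" .
  hence "ln (\<delta>\<^sup>2) \<le> - (\<Sum>m\<in>{..<N} - {n}. 1 - (\<rho> m)\<^sup>2)"
    using \<delta> ln_mono[of "\<delta>\<^sup>2" "exp (- (\<Sum>m\<in>{..<N} - {n}. 1 - (\<rho> m)\<^sup>2))"] by simp
  hence "(\<Sum>m\<in>{..<N} - {n}. 1 - (\<rho> m)\<^sup>2) \<le> 2 * ln (1 / \<delta>)"
    using \<delta> by (simp add: ln_realpow ln_div)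
  moreover have "(\<Sum>m<N. 1 - (\<rho> m)\<^sup>2) = 1 + (\<Sum>m\<in>{..<N} - {n}. 1 - (\<rho> m)\<^sup>2)"
    using n by (subst sum.remove[of _ n]) (auto simp: \<rho>_def pseudohyperbolic_def)
  moreover have "(\<Sum>m<N. 1 - (\<rho> m)\<^sup>2) =
      (\<Sum>m<N. (1 - (norm (a n))\<^sup>2) * (1 - (norm (a m))\<^sup>2) / (norm (1 - cnj (a n) * a m))\<^sup>2)"
    unfolding \<rho>_def using a by (simp add: one_minus_pseudohyperbolic_sq mult.commute)
  ultimately show ?thesis by simp
qed

section \<open>Weighted area integrals of powers of the Cauchy kernel\<close>

lemma measurable_Complex_pair:
  "(\<lambda>(x, y). Complex x y) \<in> borel_measurable (lborel :: (real \<times> real) measure)"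
proof -
  have "(\<lambda>p :: real \<times> real. Complex (fst p) (snd p)) \<in> borel_measurable borel"
    by (intro borel_measurable_continuous_onI continuous_intros)
  thus ?thesis by (simp add: case_prod_beta')
qed

text \<open>With this identification area integrals can be computed in Cartesian coordinates, in either order;
  both orders are needed below.\<close>

lemma distr_Complex_lborel:
  "distr (lborel :: (real \<times> real) measure) borel (\<lambda>(x, y). Complex x y) = lborel"
proof (rule lborel_eqI[symmetric])
  fix l u :: complex
  assume le: "\<And>b. b \<in> Basis \<Longrightarrow> l \<bullet> b \<le> u \<bullet> b"
  note meas = measurable_Complex_pair
  have le': "Re l \<le> Re u" "Im l \<le> Im u" using le[of 1] le[of \<i>] by (auto simp: Basis_complex_def)
  have "(\<lambda>(x, y). Complex x y) -` box l u = {Re l<..<Re u} \<times> {Im l<..<Im u}"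
    by (auto simp: box_def Basis_complex_def)
  hence "emeasure (distr lborel borel (\<lambda>(x, y). Complex x y)) (box l u)
      = emeasure (lborel \<Otimes>\<^sub>M lborel) ({Re l<..<Re u} \<times> {Im l<..<Im u})"
    using meas by (subst emeasure_distr) (auto simp: lborel_prod)
  also have "\<dots> = ennreal (Re u - Re l) * ennreal (Im u - Im l)"
    using le' by (subst lborel.emeasure_pair_measure_Times) auto
  also have "\<dots> = (\<Prod>b\<in>Basis. (u - l) \<bullet> b)"
    using le' by (auto simp: Basis_complex_def ennreal_mult)
  finally show "emeasure (distr lborel borel (\<lambda>(x, y). Complex x y)) (box l u)
      = (\<Prod>b\<in>Basis. (u - l) \<bullet> b)" .
qed simp

lemma nn_integral_complex_iterated:
  assumes [measurable]: "f \<in> borel_measurable borel"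
  shows "(\<integral>\<^sup>+z. f z \<partial>lborel) = (\<integral>\<^sup>+x. \<integral>\<^sup>+y. f (Complex x y) \<partial>lborel \<partial>lborel)"
    and "(\<integral>\<^sup>+z. f z \<partial>lborel) = (\<integral>\<^sup>+y. \<integral>\<^sup>+x. f (Complex x y) \<partial>lborel \<partial>lborel)"
proof -
  note meas = measurable_Complex_pair
  have m2: "(\<lambda>(x, y). f (Complex x y)) \<in> borel_measurable (lborel \<Otimes>\<^sub>M lborel)"
    using measurable_compose[OF meas assms] by (simp add: lborel_prod case_prod_beta')
  have "(\<integral>\<^sup>+z. f z \<partial>lborel) = (\<integral>\<^sup>+z. (\<lambda>(x, y). f (Complex x y)) z \<partial>(lborel \<Otimes>\<^sub>M lborel))"
    unfolding distr_Complex_lborel[symmetric]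
    using meas by (subst nn_integral_distr) (auto simp: case_prod_beta' lborel_prod)
  note * = this
  show "(\<integral>\<^sup>+z. f z \<partial>lborel) = (\<integral>\<^sup>+x. \<integral>\<^sup>+y. f (Complex x y) \<partial>lborel \<partial>lborel)"
    unfolding * using lborel.nn_integral_fst[OF m2] by simp
  show "(\<integral>\<^sup>+z. f z \<partial>lborel) = (\<integral>\<^sup>+y. \<integral>\<^sup>+x. f (Complex x y) \<partial>lborel \<partial>lborel)"
    unfolding * using lborel_pair.nn_integral_snd[OF m2] by simp
qed

lemma nn_integral_powr_half_line:
  assumes "b > -1" "c \<ge> (0::real)"
  shows "(\<integral>\<^sup>+x. ennreal (x powr b) * indicator {0..c} x \<partial>lborel) = ennreal (c powr (b + 1) / (b + 1))"
proof -
  have "(\<integral>\<^sup>+x. ennreal (indicator {0..c} x * x powr b) \<partial>lborel) = ennreal (c powr (b + 1) / (b + 1))"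
    by (rule nn_integral_has_integral_lebesgue[OF _ has_integral_powr_from_0[OF assms]]) auto
  thus ?thesis by (simp add: ennreal_mult' mult.commute ennreal_indicator)
qed

lemma nn_integral_two_reflected_powr:
  assumes "b > -1" "c \<ge> (0::real)"
  shows "(\<integral>\<^sup>+x. (ennreal ((s + x) powr b) * indicator {0..c} (s + x)
            + ennreal ((t - x) powr b) * indicator {0..c} (t - x)) \<partial>lborel)
       = ennreal (2 * c powr (b + 1) / (b + 1))"
proof -
  define g where "g = (\<lambda>x. ennreal (x powr b) * indicator {0..c} x)"
  have [measurable]: "g \<in> borel_measurable borel" unfolding g_def by measurable
  have g: "(\<integral>\<^sup>+x. g x \<partial>lborel) = ennreal (c powr (b + 1) / (b + 1))"
    unfolding g_def by (rule nn_integral_powr_half_line[OF assms])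
  have "(\<integral>\<^sup>+x. (g (s + x) + g (t - x)) \<partial>lborel) = (\<integral>\<^sup>+x. g (s + x) \<partial>lborel) + (\<integral>\<^sup>+x. g (t - x) \<partial>lborel)"
    by (intro nn_integral_add) auto
  also have "(\<integral>\<^sup>+x. g (s + x) \<partial>lborel) = (\<integral>\<^sup>+x. g x \<partial>lborel)"
    using nn_integral_real_affine[of g 1 s] by simp
  also have "(\<integral>\<^sup>+x. g (t - x) \<partial>lborel) = (\<integral>\<^sup>+x. g x \<partial>lborel)"
    using nn_integral_real_affine[of g "-1" t] by simp
  also have "(\<integral>\<^sup>+x. g x \<partial>lborel) + (\<integral>\<^sup>+x. g x \<partial>lborel) = ennreal (2 * c powr (b + 1) / (b + 1))"
    unfolding g using assms by (subst ennreal_plus[symmetric]) auto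
  finally show ?thesis unfolding g_def .
qed

lemma nn_integral_abs_diff_powr_le:
  assumes "b > -1" "c \<ge> (0::real)"
  shows "(\<integral>\<^sup>+x. ennreal (\<bar>x - t\<bar> powr b) * indicator {t - c..t + c} x \<partial>lborel)
          \<le> ennreal (2 * c powr (b + 1) / (b + 1))"
proof -
  have "(\<integral>\<^sup>+x. ennreal (\<bar>x - t\<bar> powr b) * indicator {t - c..t + c} x \<partial>lborel)
      \<le> (\<integral>\<^sup>+x. (ennreal ((- t + x) powr b) * indicator {0..c} (- t + x)
            + ennreal ((t - x) powr b) * indicator {0..c} (t - x)) \<partial>lborel)"
    by (intro nn_integral_mono) (auto simp: indicator_def abs_if)
  also have "\<dots> = ennreal (2 * c powr (b + 1) / (b + 1))"
    by (rule nn_integral_two_reflected_powr[OF assms])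
  finally show ?thesis .
qed

lemma nn_integral_endpoint_powr_le:
  assumes "b > -1" "c \<ge> (0::real)"
  shows "(\<integral>\<^sup>+x. ennreal ((c - \<bar>x\<bar>) powr b) * indicator {-c<..<c} x \<partial>lborel)
          \<le> ennreal (2 * c powr (b + 1) / (b + 1))"
proof -
  have "(\<integral>\<^sup>+x. ennreal ((c - \<bar>x\<bar>) powr b) * indicator {-c<..<c} x \<partial>lborel)
      \<le> (\<integral>\<^sup>+x. (ennreal ((c + x) powr b) * indicator {0..c} (c + x)
            + ennreal ((c - x) powr b) * indicator {0..c} (c - x)) \<partial>lborel)"
    by (intro nn_integral_mono) (auto simp: indicator_def abs_if)
  also have "\<dots> = ennreal (2 * c powr (b + 1) / (b + 1))"
    by (rule nn_integral_two_reflected_powr[OF assms])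
  finally show ?thesis .
qed

text \<open>A majorant, in Cartesian coordinates (in either order), of \<open>(1 - |z|)\<^sup>\<alpha> |1 - cnj a * z|\<^sup>-\<^sup>q\<close> when \<open>t\<close> is
  the \<open>y\<close>-coordinate of the boundary point nearest to \<open>a\<close>. The two terms in the maximum are lower bounds for
  \<open>|1 - cnj a * z|\<close>.\<close>

definition slice_majorant :: "real \<Rightarrow> real \<Rightarrow> real \<Rightarrow> real \<Rightarrow> real \<Rightarrow> ennreal" where
  "slice_majorant \<alpha> q t x y =
     (let d = 1 - sqrt (x\<^sup>2 + y\<^sup>2) in ennreal (d powr \<alpha> * (max d (\<bar>y - t\<bar> / 2)) powr (- q)))
     * indicator {(x, y). x\<^sup>2 + y\<^sup>2 < 1} (x, y)"

text \<open>On the horizontal line at height \<open>y\<close> the disc is the interval \<open>|x| < X\<close>, and the distance to the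
  circle is comparable to the distance to the endpoints, up to the factor \<open>X\<close>. This replaces polar
  coordinates.\<close>

lemma distance_to_circle_ge:
  fixes x y :: real
  assumes "x\<^sup>2 + y\<^sup>2 < 1"
  defines "X \<equiv> sqrt (1 - y\<^sup>2)"
  shows "(X - \<bar>x\<bar>) * X / 2 \<le> 1 - sqrt (x\<^sup>2 + y\<^sup>2)" and "\<bar>x\<bar> < X"
proof -
  define r where "r = sqrt (x\<^sup>2 + y\<^sup>2)"
  have r: "0 \<le> r" "r < 1" "r\<^sup>2 = x\<^sup>2 + y\<^sup>2" using assms(1) unfolding r_def by auto
  have y: "y\<^sup>2 < 1" using assms(1) zero_le_power2[of x] by linarith
  have X: "X\<^sup>2 = 1 - y\<^sup>2" "X \<ge> 0" unfolding X_def using y by auto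
  have "x\<^sup>2 < X\<^sup>2" using X assms(1) by simp
  hence "\<bar>x\<bar>\<^sup>2 < X\<^sup>2" by simp
  thus xX: "\<bar>x\<bar> < X" using X(2) power_less_imp_less_base by blast
  have "(X - \<bar>x\<bar>) * X \<le> (X - \<bar>x\<bar>) * (X + \<bar>x\<bar>)" using xX by (intro mult_left_mono) auto
  also have "\<dots> = X\<^sup>2 - \<bar>x\<bar>\<^sup>2" by (simp add: power2_eq_square algebra_simps)
  also have "\<dots> = 1 - r\<^sup>2" using X r by simp
  also have "\<dots> = (1 - r) * (1 + r)" by (simp add: power2_eq_square algebra_simps)
  also have "\<dots> \<le> (1 - r) * 2" using r by (intro mult_left_mono) auto
  finally show "(X - \<bar>x\<bar>) * X / 2 \<le> 1 - sqrt (x\<^sup>2 + y\<^sup>2)" unfolding r_def by simp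
qed

lemma powr_minus_le_split:
  fixes A B :: real
  assumes "A > 0" "B > 0" "q1 \<ge> 0" "q2 \<ge> 0"
  shows "(max A B) powr (- (q1 + q2)) \<le> A powr (- q1) * B powr (- q2)"
proof -
  have "(max A B) powr (- (q1 + q2)) = (max A B) powr (- q1) * (max A B) powr (- q2)"
    by (simp add: powr_add[symmetric])
  also have "\<dots> \<le> A powr (- q1) * B powr (- q2)"
    using assms by (intro mult_mono powr_mono2') auto
  finally show ?thesis .
qed

text \<open>Split \<open>q = q1 + q2\<close> and use one lower bound for each part. The \<open>x\<close>-integral then sees the exponent
  \<open>\<beta> = \<alpha> - q1\<close>, integrable as \<open>\<beta> > -1\<close>, and the powers of \<open>X\<close> combine to \<open>X\<close> to the power
  \<open>2 \<beta> + 1\<close>, which is at most \<open>1 / X\<close>. The line \<open>y = t\<close> is excluded because \<open>0 powr (- q2)\<close> is \<open>0\<close>.\<close>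

lemma slice_majorant_inner:
  assumes q: "q1 \<ge> 0" "q2 \<ge> 0" "q2 < 1" and \<beta>: "\<alpha> - q1 > -1" "\<alpha> - q1 \<le> 0" and yt: "y \<noteq> t"
  shows "(\<integral>\<^sup>+x. slice_majorant \<alpha> (q1 + q2) t x y \<partial>lborel)
    \<le> ennreal (8 / (\<alpha> - q1 + 1) * (\<bar>y - t\<bar> powr (- q2) * (1 - \<bar>y\<bar>) powr (-1/2))) * indicator {-1<..<1} y"
proof (cases "y\<^sup>2 < 1")
  case False
  have "slice_majorant \<alpha> (q1 + q2) t x y = 0" for x
  proof -
    have "\<not> x\<^sup>2 + y\<^sup>2 < 1" using False zero_le_power2[of x] by linarith
    thus ?thesis by (simp add: slice_majorant_def)
  qed
  thus ?thesis by simp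
next
  case y: True
  define \<beta> where "\<beta> = \<alpha> - q1"
  define X where "X = sqrt (1 - y\<^sup>2)"
  define C where "C = 4 * \<bar>y - t\<bar> powr (- q2) * X powr \<beta>"
  have y1: "\<bar>y\<bar> < 1" using y by (simp add: abs_square_less_1)
  have X: "X > 0" "X \<le> 1" "X\<^sup>2 = 1 - y\<^sup>2" unfolding X_def using y by auto
  have bnd: "slice_majorant \<alpha> (q1 + q2) t x y
      \<le> ennreal C * (ennreal ((X - \<bar>x\<bar>) powr \<beta>) * indicator {-X<..<X} x)" for x
  proof (cases "x\<^sup>2 + y\<^sup>2 < 1")
    case False thus ?thesis by (simp add: slice_majorant_def)
  next
    case True
    define d where "d = 1 - sqrt (x\<^sup>2 + y\<^sup>2)"
    have d0: "d > 0" using True unfolding d_def by simp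
    have d: "(X - \<bar>x\<bar>) * X / 2 \<le> d" and xX: "\<bar>x\<bar> < X"
      using distance_to_circle_ge[OF True] unfolding X_def d_def by auto
    have "d powr \<alpha> * (max d (\<bar>y - t\<bar> / 2)) powr (- (q1 + q2))
        \<le> d powr \<alpha> * (d powr (- q1) * (\<bar>y - t\<bar> / 2) powr (- q2))"
      using d0 yt q by (intro mult_left_mono powr_minus_le_split) auto
    also have "\<dots> = d powr \<beta> * (\<bar>y - t\<bar> / 2) powr (- q2)"
      by (simp add: \<beta>_def powr_diff powr_minus field_simps)
    also have "\<dots> \<le> ((X - \<bar>x\<bar>) * X / 2) powr \<beta> * (2 * \<bar>y - t\<bar> powr (- q2))"
    proof (intro mult_mono)
      show "d powr \<beta> \<le> ((X - \<bar>x\<bar>) * X / 2) powr \<beta>"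
        using d xX X \<beta>(2) unfolding \<beta>_def by (intro powr_mono2') auto
      have "(\<bar>y - t\<bar> / 2) powr (- q2) = 2 powr q2 * \<bar>y - t\<bar> powr (- q2)"
        by (simp add: powr_divide powr_minus field_simps)
      also have "2 powr q2 \<le> 2 powr 1" using q by (intro powr_mono) auto
      finally show "(\<bar>y - t\<bar> / 2) powr (- q2) \<le> 2 * \<bar>y - t\<bar> powr (- q2)"
        by (simp add: mult_right_mono)
    qed auto
    also have "((X - \<bar>x\<bar>) * X / 2) powr \<beta> = (X - \<bar>x\<bar>) powr \<beta> * X powr \<beta> * 2 powr (- \<beta>)"
      using X xX by (subst powr_divide) (auto simp: powr_mult powr_minus divide_inverse)
    also have "\<dots> \<le> (X - \<bar>x\<bar>) powr \<beta> * X powr \<beta> * 2 powr 1"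
      using \<beta>(1) unfolding \<beta>_def by (intro mult_left_mono powr_mono) auto
    finally have *: "d powr \<alpha> * (max d (\<bar>y - t\<bar> / 2)) powr (- (q1 + q2)) \<le> C * (X - \<bar>x\<bar>) powr \<beta>"
      by (simp add: C_def mult_ac mult_right_mono)
    have C0: "C \<ge> 0" unfolding C_def by simp
    have xin: "x \<in> {-X<..<X}" using xX by auto
    have "slice_majorant \<alpha> (q1 + q2) t x y = ennreal (d powr \<alpha> * (max d (\<bar>y - t\<bar> / 2)) powr (- (q1 + q2)))"
      using True by (simp add: slice_majorant_def d_def Let_def)
    also have "\<dots> \<le> ennreal (C * (X - \<bar>x\<bar>) powr \<beta>)" using * by (rule ennreal_leI)
    also have "\<dots> = ennreal C * (ennreal ((X - \<bar>x\<bar>) powr \<beta>) * indicator {-X<..<X} x)"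
      using C0 xin by (simp add: ennreal_mult)
    finally show ?thesis .
  qed
  have "(\<integral>\<^sup>+x. slice_majorant \<alpha> (q1 + q2) t x y \<partial>lborel)
      \<le> (\<integral>\<^sup>+x. ennreal C * (ennreal ((X - \<bar>x\<bar>) powr \<beta>) * indicator {-X<..<X} x) \<partial>lborel)"
    by (intro nn_integral_mono bnd)
  also have "\<dots> = ennreal C * (\<integral>\<^sup>+x. ennreal ((X - \<bar>x\<bar>) powr \<beta>) * indicator {-X<..<X} x \<partial>lborel)"
    by (intro nn_integral_cmult) measurable
  also have "\<dots> \<le> ennreal C * ennreal (2 * X powr (\<beta> + 1) / (\<beta> + 1))"
    using \<beta> X unfolding \<beta>_def by (intro mult_left_mono nn_integral_endpoint_powr_le) auto
  also have "\<dots> = ennreal (C * (2 * X powr (\<beta> + 1) / (\<beta> + 1)))"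
    using \<beta> by (intro ennreal_mult[symmetric]) (auto simp: C_def \<beta>_def)
  also have "\<dots> \<le> ennreal (8 / (\<beta> + 1) * (\<bar>y - t\<bar> powr (- q2) * (1 - \<bar>y\<bar>) powr (-1/2)))"
  proof (rule ennreal_leI)
    have "X powr \<beta> * X powr (\<beta> + 1) = X powr (2 * \<beta> + 1)"
      by (simp add: powr_add[symmetric])
    \<comment> \<open>\<open>2 \<beta> + 1 > -1\<close> and \<open>X \<le> 1\<close>.\<close>
    also have "\<dots> \<le> X powr (-1)" using X \<beta>(1) unfolding \<beta>_def by (intro powr_mono') auto
    also have "\<dots> = (X powr 2) powr (-1/2)" unfolding powr_powr by simp
    also have "\<dots> = (1 - y\<^sup>2) powr (-1/2)" using X by simp
    also have "\<dots> \<le> (1 - \<bar>y\<bar>) powr (-1/2)"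
    proof (rule powr_mono2')
      have "\<bar>y\<bar>\<^sup>2 \<le> \<bar>y\<bar>" using y1 power_decreasing[of 1 2 "\<bar>y\<bar>"] by simp
      thus "1 - \<bar>y\<bar> \<le> 1 - y\<^sup>2" by simp
    qed (use y1 in auto)
    finally have "8 / (\<beta> + 1) * \<bar>y - t\<bar> powr (- q2) * (X powr \<beta> * X powr (\<beta> + 1))
        \<le> 8 / (\<beta> + 1) * \<bar>y - t\<bar> powr (- q2) * (1 - \<bar>y\<bar>) powr (-1/2)"
      using \<beta>(1) unfolding \<beta>_def by (intro mult_left_mono) auto
    thus "C * (2 * X powr (\<beta> + 1) / (\<beta> + 1))
        \<le> 8 / (\<beta> + 1) * (\<bar>y - t\<bar> powr (- q2) * (1 - \<bar>y\<bar>) powr (-1/2))"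
      unfolding C_def by (simp add: mult_ac)
  qed
  finally show ?thesis using y1 unfolding \<beta>_def by (simp add: indicator_def abs_less_iff)
qed

text \<open>The singularities of \<open>|y - t| powr (- q2)\<close> and \<open>(1 - |y|) powr (-1/2)\<close> are at least \<open>1/4\<close> apart,
  so near each of them the other factor is bounded and the product is dominated by the sum.\<close>

lemma slice_majorant_bound:
  assumes q: "q1 \<ge> 0" "q2 \<ge> 0" "q2 < 1" and \<beta>: "\<alpha> - q1 > -1" "\<alpha> - q1 \<le> 0"
    and t: "\<bar>t\<bar> \<le> 3/4"
  shows "(\<integral>\<^sup>+y. \<integral>\<^sup>+x. slice_majorant \<alpha> (q1 + q2) t x y \<partial>lborel \<partial>lborel)
    \<le> ennreal (64 / (\<alpha> - q1 + 1)) * (ennreal (2 * 2 powr (- q2 + 1) / (- q2 + 1)) + ennreal 4)"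
proof -
  define c where "c = 8 / (\<alpha> - q1 + 1)"
  have c0: "c \<ge> 0" using \<beta> unfolding c_def by simp
  define f where "f = (\<lambda>y. ennreal (\<bar>y - t\<bar> powr (- q2)) * indicator {t - 2..t + 2} y)"
  define g where "g = (\<lambda>y::real. ennreal ((1 - \<bar>y\<bar>) powr (-1/2)) * indicator {-1<..<1} y)"
  have [measurable]: "f \<in> borel_measurable borel" "g \<in> borel_measurable borel"
    unfolding f_def g_def by measurable
  have "(\<integral>\<^sup>+y. \<integral>\<^sup>+x. slice_majorant \<alpha> (q1 + q2) t x y \<partial>lborel \<partial>lborel)
      \<le> (\<integral>\<^sup>+y. ennreal (8 * c) * (f y + g y) \<partial>lborel)"
  proof (rule nn_integral_mono_AE)
    show "AE y in lborel. (\<integral>\<^sup>+x. slice_majorant \<alpha> (q1 + q2) t x y \<partial>lborel) \<le> ennreal (8 * c) * (f y + g y)"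
      using AE_lborel_singleton[of t]
    proof eventually_elim
      case (elim y)
      show ?case
      proof (cases "y \<in> {-1<..<1}")
        case False
        thus ?thesis using slice_majorant_inner[OF q \<beta> elim] by simp
      next
        case True
        have "\<bar>y - t\<bar> powr (- q2) * (1 - \<bar>y\<bar>) powr (-1/2)
            \<le> 8 * (\<bar>y - t\<bar> powr (- q2) + (1 - \<bar>y\<bar>) powr (-1/2))"
        proof (cases "\<bar>y - t\<bar> < 1/8")
          case near: True
          have "(1 - \<bar>y\<bar>) powr (-1/2) \<le> (1/8) powr (-1/2)"
            using near t by (intro powr_mono2') linarith+
          also have "\<dots> = 8 powr (1/2)" by (simp add: powr_divide powr_minus field_simps)
          also have "\<dots> \<le> 8 powr 1" by (intro powr_mono) auto
          finally have "(1 - \<bar>y\<bar>) powr (-1/2) \<le> 8" by simp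
          hence "\<bar>y - t\<bar> powr (- q2) * (1 - \<bar>y\<bar>) powr (-1/2) \<le> \<bar>y - t\<bar> powr (- q2) * 8"
            by (intro mult_left_mono) auto
          thus ?thesis by (simp add: distrib_left add_increasing2)
        next
          case far: False
          have "\<bar>y - t\<bar> powr (- q2) \<le> (1/8) powr (- q2)"
            using far q by (intro powr_mono2') auto
          also have "\<dots> = 8 powr q2" by (simp add: powr_divide powr_minus field_simps)
          also have "\<dots> \<le> 8 powr 1" using q by (intro powr_mono) auto
          finally have "\<bar>y - t\<bar> powr (- q2) \<le> 8" by simp
          hence "\<bar>y - t\<bar> powr (- q2) * (1 - \<bar>y\<bar>) powr (-1/2) \<le> 8 * (1 - \<bar>y\<bar>) powr (-1/2)"
            by (intro mult_right_mono) auto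
          thus ?thesis by (simp add: distrib_left add_increasing)
        qed
        hence "c * (\<bar>y - t\<bar> powr (- q2) * (1 - \<bar>y\<bar>) powr (-1/2))
            \<le> 8 * c * (\<bar>y - t\<bar> powr (- q2) + (1 - \<bar>y\<bar>) powr (-1/2))"
          using mult_left_mono[of _ _ c, OF _ c0] by (simp add: mult.left_commute mult.assoc)
        hence "ennreal (c * (\<bar>y - t\<bar> powr (- q2) * (1 - \<bar>y\<bar>) powr (-1/2)))
            \<le> ennreal (8 * c * (\<bar>y - t\<bar> powr (- q2) + (1 - \<bar>y\<bar>) powr (-1/2)))"
          by (rule ennreal_leI)
        also have "\<dots> = ennreal (8 * c) * (ennreal (\<bar>y - t\<bar> powr (- q2)) + ennreal ((1 - \<bar>y\<bar>) powr (-1/2)))"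
          using c0 by (subst ennreal_plus[symmetric]) (auto simp: ennreal_mult)
        also have "\<dots> = ennreal (8 * c) * (f y + g y)"
          using True t unfolding f_def g_def by (auto simp: indicator_def abs_le_iff)
        finally have "ennreal (c * (\<bar>y - t\<bar> powr (- q2) * (1 - \<bar>y\<bar>) powr (-1/2)))
            \<le> ennreal (8 * c) * (f y + g y)" .
        moreover have "(\<integral>\<^sup>+x. slice_majorant \<alpha> (q1 + q2) t x y \<partial>lborel)
            \<le> ennreal (c * (\<bar>y - t\<bar> powr (- q2) * (1 - \<bar>y\<bar>) powr (-1/2)))"
          using slice_majorant_inner[OF q \<beta> elim] True unfolding c_def by simp
        ultimately show ?thesis by (rule order.trans[rotated])
      qed
    qed
  qed
  also have "\<dots> = ennreal (8 * c) * ((\<integral>\<^sup>+y. f y \<partial>lborel) + (\<integral>\<^sup>+y. g y \<partial>lborel))"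
    by (simp add: nn_integral_cmult nn_integral_add)
  also have "\<dots> \<le> ennreal (8 * c) * (ennreal (2 * 2 powr (- q2 + 1) / (- q2 + 1)) + ennreal 4)"
  proof (intro mult_left_mono add_mono)
    show "(\<integral>\<^sup>+y. f y \<partial>lborel) \<le> ennreal (2 * 2 powr (- q2 + 1) / (- q2 + 1))"
      unfolding f_def using q by (intro nn_integral_abs_diff_powr_le) auto
    show "(\<integral>\<^sup>+y. g y \<partial>lborel) \<le> ennreal 4"
      unfolding g_def using nn_integral_endpoint_powr_le[of "-1/2" 1] by simp
  qed auto
  finally show ?thesis unfolding c_def by simp
qed

text \<open>Here \<open>\<omega>\<close> is the boundary point in the direction of \<open>a\<close>.\<close>

lemma one_minus_cnj_lower_bounds:
  fixes a \<omega> z :: complex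
  assumes "norm a < 1" "norm \<omega> = 1" "a = of_real (norm a) * \<omega>" "norm z < 1"
  shows "1 - norm z \<le> norm (1 - cnj a * z)" "norm (z - \<omega>) / 2 \<le> norm (1 - cnj a * z)"
proof -
  show "1 - norm z \<le> norm (1 - cnj a * z)" using norm_one_minus_cnj_ge[of a z] assms by simp
  have "norm (z - \<omega>) = norm (cnj \<omega> * (z - \<omega>))" using assms by (simp add: norm_mult)
  also have "cnj \<omega> * (z - \<omega>) = - ((1 - cnj a * z) + (cnj a - cnj \<omega>) * z)"
    using assms(2) complex_norm_square[of \<omega>] by (simp add: algebra_simps)
  also have "norm \<dots> \<le> norm (1 - cnj a * z) + norm (cnj a - cnj \<omega>) * norm z"
    using norm_triangle_ineq[of "1 - cnj a * z" "(cnj a - cnj \<omega>) * z"]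
    by (simp only: norm_minus_cancel norm_mult)
  also have "norm (cnj a - cnj \<omega>) = 1 - norm a"
  proof -
    have "a - \<omega> = of_real (norm a - 1) * \<omega>" using assms(3) by (simp add: algebra_simps)
    hence "norm (a - \<omega>) = \<bar>norm a - 1\<bar> * 1" using assms(2) by (simp only: norm_mult norm_of_real)
    thus ?thesis using assms(1) complex_mod_cnj[of "a - \<omega>"] by simp
  qed
  also have "(1 - norm a) * norm z \<le> 1 - norm a" using assms by (intro mult_left_le) auto
  also have "1 - norm a \<le> norm (1 - cnj a * z)"
    using norm_one_minus_cnj_ge[of z a] assms by (simp add: norm_one_minus_cnj_commute[of a z])
  finally show "norm (z - \<omega>) / 2 \<le> norm (1 - cnj a * z)" by simp
qed

lemma measurable_slice_majorant [measurable]: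
  "(\<lambda>z. slice_majorant \<alpha> q t (Re z) (Im z)) \<in> borel_measurable borel"
  "(\<lambda>z. slice_majorant \<alpha> q t (Im z) (Re z)) \<in> borel_measurable borel"
proof -
  have eq: "indicator {(x, y). x\<^sup>2 + y\<^sup>2 < 1} (x, y) = (if x\<^sup>2 + y\<^sup>2 < 1 then 1 else 0 :: ennreal)"
    for x y :: real by (simp add: indicator_def)
  show "(\<lambda>z. slice_majorant \<alpha> q t (Re z) (Im z)) \<in> borel_measurable borel"
    "(\<lambda>z. slice_majorant \<alpha> q t (Im z) (Re z)) \<in> borel_measurable borel"
    unfolding slice_majorant_def Let_def eq by measurable
qed

text \<open>The exponent \<open>2 p\<close> is divided between \<open>1 - |z|\<close> and \<open>|y - t|\<close> in the ratio \<open>1 + \<alpha>\<close> to \<open>1\<close>; both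
  parts are subcritical exactly because \<open>2 p < 2 + \<alpha>\<close>. One coordinate of the unimodular \<open>\<omega>\<close> is at
  most \<open>3/4\<close> in absolute value, and the slices are taken perpendicular to that coordinate.\<close>

lemma bergman_kernel_integral_bound:
  assumes \<alpha>: "-1 < \<alpha>" "\<alpha> \<le> 0" and p: "0 < p" "2 * p < 2 + \<alpha>"
  obtains K :: real where "K \<ge> 0" and
    "\<And>a. norm a < 1 \<Longrightarrow>
      (\<integral>\<^sup>+z\<in>unit_disc. ennreal (norm (1 - cnj a * z) powr (- 2 * p) * (1 - norm z) powr \<alpha>) \<partial>lborel)
        \<le> ennreal K"
proof -
  define \<theta> where "\<theta> = 2 * p / (2 + \<alpha>)"
  define q1 where "q1 = (1 + \<alpha>) * \<theta>"
  have \<theta>: "0 < \<theta>" "\<theta> < 1" using \<alpha> p unfolding \<theta>_def by (auto simp: field_simps)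
  have q: "q1 \<ge> 0" "\<theta> \<ge> 0" "\<theta> < 1" using \<theta> \<alpha> unfolding q1_def by auto
  have "q1 < 1 + \<alpha>" using mult_strict_left_mono[of \<theta> 1 "1 + \<alpha>"] \<theta> \<alpha> unfolding q1_def by simp
  hence \<beta>: "\<alpha> - q1 > -1" "\<alpha> - q1 \<le> 0" using q \<alpha> by auto
  have "q1 + \<theta> = (2 + \<alpha>) * \<theta>" unfolding q1_def by (simp add: algebra_simps)
  hence qsum: "q1 + \<theta> = 2 * p" using \<alpha> unfolding \<theta>_def by simp
  define K where "K = 64 / (\<alpha> - q1 + 1) * (2 * 2 powr (- \<theta> + 1) / (- \<theta> + 1) + 4)"
  have K: "ennreal K = ennreal (64 / (\<alpha> - q1 + 1)) * (ennreal (2 * 2 powr (- \<theta> + 1) / (- \<theta> + 1)) + ennreal 4)"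
    unfolding K_def using \<beta> \<theta>
    by (subst ennreal_mult, simp, simp, subst ennreal_plus) auto
  have K0: "K \<ge> 0" unfolding K_def using \<beta> \<theta> by simp
  have "(\<integral>\<^sup>+z\<in>unit_disc. ennreal (norm (1 - cnj a * z) powr (- 2 * p) * (1 - norm z) powr \<alpha>) \<partial>lborel)
        \<le> ennreal K" if a: "norm a < 1" for a
  proof -
    \<comment> \<open>For \<open>a = 0\<close> any unimodular \<open>\<omega>\<close> serves.\<close>
    define \<omega> where "\<omega> = (if a = 0 then 1 else a / of_real (norm a))"
    have \<omega>: "norm \<omega> = 1" "a = of_real (norm a) * \<omega>" unfolding \<omega>_def by (auto simp: norm_divide)
    define L where "L = (\<lambda>z. ennreal (norm (1 - cnj a * z) powr (- 2 * p) * (1 - norm z) powr \<alpha>)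
                              * indicator unit_disc z)"
    have Lle: "L z \<le> slice_majorant \<alpha> (2 * p) s x y"
      if xy: "x\<^sup>2 + y\<^sup>2 = (norm z)\<^sup>2" "\<bar>y - s\<bar> \<le> norm (z - \<omega>)" for z s x y
    proof (cases "norm z < 1")
      case False thus ?thesis by (simp add: L_def)
    next
      case True
      have nz: "sqrt (x\<^sup>2 + y\<^sup>2) = norm z" using xy by simp
      have d1: "1 - norm z > 0" using True by simp
      have "max (1 - norm z) (\<bar>y - s\<bar> / 2) \<le> norm (1 - cnj a * z)"
        using one_minus_cnj_lower_bounds[OF a \<omega> True] xy(2) by simp
      hence "norm (1 - cnj a * z) powr (- (2 * p)) \<le> max (1 - norm z) (\<bar>y - s\<bar> / 2) powr (- (2 * p))"
        using d1 p by (intro powr_mono2') auto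
      hence "norm (1 - cnj a * z) powr (- (2 * p)) * (1 - norm z) powr \<alpha>
           \<le> (1 - norm z) powr \<alpha> * max (1 - norm z) (\<bar>y - s\<bar> / 2) powr (- (2 * p))"
        by (simp add: mult.commute mult_left_mono)
      moreover have "(norm z)\<^sup>2 < 1" using True by (simp add: power_less_one_iff)
      ultimately show ?thesis using True xy
        unfolding L_def slice_majorant_def Let_def nz
        by (auto simp: indicator_def intro!: ennreal_leI)
    qed
    have one: "(Re \<omega>)\<^sup>2 + (Im \<omega>)\<^sup>2 = 1" using cmod_power2[of \<omega>] \<omega>(1) by simp
    show ?thesis
    proof (cases "\<bar>Im \<omega>\<bar> \<le> 3/4")
      case True
      have "(\<integral>\<^sup>+z. L z \<partial>lborel) \<le> (\<integral>\<^sup>+z. slice_majorant \<alpha> (2 * p) (Im \<omega>) (Re z) (Im z) \<partial>lborel)"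
        using abs_Im_le_cmod[of "_ - \<omega>"] by (intro nn_integral_mono Lle) (auto simp: cmod_power2)
      also have "\<dots> = (\<integral>\<^sup>+y. \<integral>\<^sup>+x. slice_majorant \<alpha> (2 * p) (Im \<omega>) x y \<partial>lborel \<partial>lborel)"
        by (subst nn_integral_complex_iterated(2)) auto
      also have "\<dots> \<le> ennreal K"
        using slice_majorant_bound[OF q \<beta> True] unfolding K qsum .
      finally show ?thesis unfolding L_def .
    next
      case False
      have "(3/4)\<^sup>2 < \<bar>Im \<omega>\<bar>\<^sup>2" using False by (intro power_strict_mono) auto
      hence "\<bar>Re \<omega>\<bar>\<^sup>2 \<le> (3/4)\<^sup>2" using one by (simp add: power2_eq_square)
      hence Re: "\<bar>Re \<omega>\<bar> \<le> 3/4" by (rule power2_le_imp_le) auto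
      have "(\<integral>\<^sup>+z. L z \<partial>lborel) \<le> (\<integral>\<^sup>+z. slice_majorant \<alpha> (2 * p) (Re \<omega>) (Im z) (Re z) \<partial>lborel)"
        using abs_Re_le_cmod[of "_ - \<omega>"] by (intro nn_integral_mono Lle) (auto simp: cmod_power2)
      also have "\<dots> = (\<integral>\<^sup>+y. \<integral>\<^sup>+x. slice_majorant \<alpha> (2 * p) (Re \<omega>) x y \<partial>lborel \<partial>lborel)"
        by (subst nn_integral_complex_iterated(1)) auto
      also have "\<dots> \<le> ennreal K"
        using slice_majorant_bound[OF q \<beta> Re] unfolding K qsum .
      finally show ?thesis unfolding L_def .
    qed
  qed
  thus ?thesis using that K0 by blast
qed

section \<open>Circle means and the Hardy space\<close>

text \<open>The expression whose limit for \<open>r\<close> tending to \<open>1\<close> is \<open>hardy2_inner f g\<close>. Working with circles of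
  radius below \<open>1\<close> avoids boundary values.\<close>

definition circle_inner :: "(complex \<Rightarrow> complex) \<Rightarrow> (complex \<Rightarrow> complex) \<Rightarrow> real \<Rightarrow> complex" where
  "circle_inner f g r = of_real (1 / (2 * pi)) *
     integral {0..2 * pi} (\<lambda>t. f (of_real r * cis t) * cnj (g (of_real r * cis t)))"

lemma hardy2_inner_eq_Lim: "hardy2_inner f g = Lim (at_left 1) (circle_inner f g)"
  unfolding hardy2_inner_def circle_inner_def ..

lemma norm_circle_point [simp]: "r \<ge> 0 \<Longrightarrow> norm (of_real r * cis t) = r"
  by (simp add: norm_mult)

lemma continuous_on_circle_param:
  assumes "continuous_on (sphere 0 r) f" "r \<ge> 0"
  shows "continuous_on A (\<lambda>t. f (of_real r * cis t))"
  by (rule continuous_on_compose2[OF assms(1)]) (use assms(2) in \<open>auto intro!: continuous_intros\<close>)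

lemma holomorphic_continuous_on_circle:
  assumes "f holomorphic_on unit_disc" "0 < r" "r < 1"
  shows "continuous_on (sphere 0 r) f"
  using assms by (intro holomorphic_on_imp_continuous_on holomorphic_on_subset[OF assms(1)]) auto

lemma circle_inner_integrable:
  assumes "continuous_on (sphere 0 r) f" "continuous_on (sphere 0 r) g" "r \<ge> 0"
  shows "(\<lambda>t. f (of_real r * cis t) * cnj (g (of_real r * cis t))) integrable_on {0..2 * pi}"
  by (intro integrable_continuous_interval continuous_intros continuous_on_circle_param assms)

lemma circle_inner_add_right:
  assumes "continuous_on (sphere 0 r) f" "continuous_on (sphere 0 r) g" "continuous_on (sphere 0 r) h"
    "r \<ge> 0"
  shows "circle_inner f (\<lambda>w. g w + h w) r = circle_inner f g r + circle_inner f h r"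
  unfolding circle_inner_def distrib_left[symmetric] complex_cnj_add
  using circle_inner_integrable[OF assms(1,2,4)] circle_inner_integrable[OF assms(1,3,4)]
  by (simp add: integral_add[symmetric] distrib_left)

lemma circle_inner_scale_right:
  assumes "continuous_on (sphere 0 r) f" "continuous_on (sphere 0 r) g" "r \<ge> 0"
  shows "circle_inner f (\<lambda>w. c * g w) r = cnj c * circle_inner f g r"
proof -
  have "integral {0..2 * pi} (\<lambda>t. f (of_real r * cis t) * cnj (c * g (of_real r * cis t)))
      = integral {0..2 * pi} (\<lambda>t. cnj c * (f (of_real r * cis t) * cnj (g (of_real r * cis t))))"
    by (simp add: mult_ac)
  thus ?thesis unfolding circle_inner_def by simp
qed

lemma circle_inner_sum_right:
  assumes "finite I" "continuous_on (sphere 0 r) f" "\<And>i. i \<in> I \<Longrightarrow> continuous_on (sphere 0 r) (g i)"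
    "r \<ge> 0"
  shows "circle_inner f (\<lambda>w. \<Sum>i\<in>I. c i * g i w) r = (\<Sum>i\<in>I. cnj (c i) * circle_inner f (g i) r)"
  using assms(1,3)
proof (induction I)
  case empty thus ?case by (simp add: circle_inner_def)
next
  case (insert j I)
  have "circle_inner f (\<lambda>w. c j * g j w + (\<Sum>i\<in>I. c i * g i w)) r
      = circle_inner f (\<lambda>w. c j * g j w) r + circle_inner f (\<lambda>w. \<Sum>i\<in>I. c i * g i w) r"
    using insert assms by (intro circle_inner_add_right continuous_intros) auto
  thus ?case using insert assms by (simp add: circle_inner_scale_right)
qed

lemma circle_inner_cnj: "cnj (circle_inner f g r) = circle_inner g f r"
  unfolding circle_inner_def complex_cnj_mult integral_cnj by (simp add: mult.commute)

lemma circle_inner_sum_left: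
  assumes "finite I" "\<And>i. i \<in> I \<Longrightarrow> continuous_on (sphere 0 r) (f i)" "continuous_on (sphere 0 r) g"
    "r \<ge> 0"
  shows "circle_inner (\<lambda>w. \<Sum>i\<in>I. c i * f i w) g r = (\<Sum>i\<in>I. c i * circle_inner (f i) g r)"
proof -
  have "circle_inner g (\<lambda>w. \<Sum>i\<in>I. c i * f i w) r = (\<Sum>i\<in>I. cnj (c i) * circle_inner g (f i) r)"
    using assms by (intro circle_inner_sum_right) auto
  hence "cnj (circle_inner g (\<lambda>w. \<Sum>i\<in>I. c i * f i w) r)
      = cnj (\<Sum>i\<in>I. cnj (c i) * circle_inner g (f i) r)" by simp
  thus ?thesis by (simp add: circle_inner_cnj)
qed

lemma circle_inner_cong:
  assumes "\<And>w. norm w = r \<Longrightarrow> f w = f' w" "\<And>w. norm w = r \<Longrightarrow> g w = g' w" "r \<ge> 0"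
  shows "circle_inner f g r = circle_inner f' g' r"
  unfolding circle_inner_def using assms by simp

lemma integral_nonneg_always:
  fixes f :: "real \<Rightarrow> real"
  assumes "\<And>x. 0 \<le> f x"
  shows "0 \<le> integral S f"
proof (cases "f integrable_on S")
  case True thus ?thesis using assms by (intro integral_nonneg) auto
next
  case False thus ?thesis by (simp add: not_integrable_integral)
qed

lemma circle_inner_self:
  assumes "continuous_on (sphere 0 r) f" "r \<ge> 0"
  shows "circle_inner f f r = of_real ((hardy2_mean f r)\<^sup>2)"
proof -
  define G where "G = (\<lambda>t. (norm (f (of_real r * cis t)))\<^sup>2)"
  have "G integrable_on {0..2 * pi}" unfolding G_def
    by (intro integrable_continuous_interval continuous_intros continuous_on_circle_param assms)
  hence "((\<lambda>t. complex_of_real (G t)) has_integral of_real (integral {0..2 * pi} G)) {0..2 * pi}"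
    by (intro has_integral_of_real integrable_integral)
  hence "integral {0..2 * pi} (\<lambda>t. f (of_real r * cis t) * cnj (f (of_real r * cis t)))
     = of_real (integral {0..2 * pi} G)"
    unfolding G_def complex_norm_square by (rule integral_unique)
  hence "circle_inner f f r = of_real (1 / (2 * pi) * integral {0..2 * pi} G)"
    unfolding circle_inner_def by simp
  moreover have "1 / (2 * pi) * integral {0..2 * pi} G \<ge> 0"
    unfolding G_def by (intro mult_nonneg_nonneg integral_nonneg_always) auto
  ultimately show ?thesis unfolding hardy2_mean_def G_def by (simp only: real_sqrt_pow2)
qed

lemma hardy2_mean_nonneg: "hardy2_mean f r \<ge> 0"
  unfolding hardy2_mean_def
  by (intro real_sqrt_ge_zero mult_nonneg_nonneg integral_nonneg_always) auto

text \<open>Optimising over \<open>l\<close> turns a family of arithmetic-mean bounds into a geometric-mean bound.\<close>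

lemma le_sqrt_mult_sqrt_of_weighted:
  fixes N F G :: real
  assumes "F \<ge> 0" "G \<ge> 0" and le: "\<And>l. l > 0 \<Longrightarrow> N \<le> (l * F + G / l) / 2"
  shows "N \<le> sqrt F * sqrt G"
proof (cases "F > 0 \<and> G > 0")
  case True
  have "sqrt G / sqrt F * F = sqrt G * sqrt F" "G / (sqrt G / sqrt F) = sqrt G * sqrt F"
    using True by (simp_all add: real_div_sqrt field_simps)
  with le[of "sqrt G / sqrt F"] True show ?thesis by (simp add: mult.commute)
next
  case False
  have "N \<le> 0"
  proof (rule field_le_epsilon)
    fix e :: real assume e: "e > 0"
    show "N \<le> 0 + e"
    proof (cases "F > 0")
      case True
      with False assms have "G = 0" by auto
      thus ?thesis using le[of "2 * e / F"] True e by simp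
    next
      case F: False
      hence F0: "F = 0" using assms by auto
      define l where "l = (G + 1) / e"
      have "l > 0" "G / l \<le> e" unfolding l_def using assms e by (simp_all add: field_simps)
      with le[of l] F0 e show ?thesis by simp
    qed
  qed
  also have "0 \<le> sqrt F * sqrt G" using assms by simp
  finally show ?thesis .
qed

lemma circle_inner_Cauchy_Schwarz:
  assumes f: "continuous_on (sphere 0 r) f" and g: "continuous_on (sphere 0 r) g" and r: "r \<ge> 0"
  shows "norm (circle_inner f g r) \<le> hardy2_mean f r * hardy2_mean g r"
proof -
  define F where "F = (\<lambda>t. (norm (f (of_real r * cis t)))\<^sup>2)"
  define G where "G = (\<lambda>t. (norm (g (of_real r * cis t)))\<^sup>2)"
  have Fi: "F integrable_on {0..2 * pi}" and Gi: "G integrable_on {0..2 * pi}"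
    unfolding F_def G_def
    by (intro integrable_continuous_interval continuous_intros continuous_on_circle_param f g r)+
  have nn: "1 / (2 * pi) * integral {0..2 * pi} F \<ge> 0" "1 / (2 * pi) * integral {0..2 * pi} G \<ge> 0"
    unfolding F_def G_def by (intro mult_nonneg_nonneg integral_nonneg_always; simp)+
  have "norm (circle_inner f g r)
      \<le> sqrt (1 / (2 * pi) * integral {0..2 * pi} F) * sqrt (1 / (2 * pi) * integral {0..2 * pi} G)"
  proof (rule le_sqrt_mult_sqrt_of_weighted[OF nn])
    fix l :: real assume l: "l > 0"
    have "norm (integral {0..2 * pi} (\<lambda>t. f (of_real r * cis t) * cnj (g (of_real r * cis t))))
        \<le> integral {0..2 * pi} (\<lambda>t. (l * F t + G t / l) / 2)"
    proof (rule integral_norm_bound_integral)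
      show "(\<lambda>t. f (of_real r * cis t) * cnj (g (of_real r * cis t))) integrable_on {0..2 * pi}"
        by (rule circle_inner_integrable[OF f g r])
      show "(\<lambda>t. (l * F t + G t / l) / 2) integrable_on {0..2 * pi}"
        using Fi Gi by (intro integrable_on_divide integrable_add integrable_on_mult_right)
      fix t
      define x y where "x = norm (f (of_real r * cis t))" and "y = norm (g (of_real r * cis t))"
      have "0 \<le> (l * x - y)\<^sup>2" by simp
      hence "2 * l * (x * y) \<le> l * (l * x\<^sup>2) + y\<^sup>2"
        by (simp add: power2_diff power_mult_distrib) (simp add: power2_eq_square mult_ac)
      hence "x * y \<le> (l * x\<^sup>2 + y\<^sup>2 / l) / 2" using l by (simp add: field_simps)
      thus "norm (f (of_real r * cis t) * cnj (g (of_real r * cis t))) \<le> (l * F t + G t / l) / 2"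
        unfolding F_def G_def x_def y_def by (simp add: norm_mult)
    qed
    also have "\<dots> = (l * integral {0..2 * pi} F + integral {0..2 * pi} G / l) / 2"
      using Fi Gi l by (simp add: integral_add integrable_on_divide integrable_on_mult_right)
    finally have "1 / (2 * pi) *
        norm (integral {0..2 * pi} (\<lambda>t. f (of_real r * cis t) * cnj (g (of_real r * cis t))))
      \<le> 1 / (2 * pi) * ((l * integral {0..2 * pi} F + integral {0..2 * pi} G / l) / 2)"
      by (intro mult_left_mono) auto
    note le = this
    have eq1: "norm (circle_inner f g r) = 1 / (2 * pi) *
        norm (integral {0..2 * pi} (\<lambda>t. f (of_real r * cis t) * cnj (g (of_real r * cis t))))"
      unfolding circle_inner_def norm_mult norm_of_real by simp
    have eq2: "1 / (2 * pi) * ((l * integral {0..2 * pi} F + integral {0..2 * pi} G / l) / 2)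
      = (l * (1 / (2 * pi) * integral {0..2 * pi} F) + (1 / (2 * pi) * integral {0..2 * pi} G) / l) / 2"
      by (simp add: add_divide_distrib mult_ac)
    show "norm (circle_inner f g r)
      \<le> (l * (1 / (2 * pi) * integral {0..2 * pi} F) + (1 / (2 * pi) * integral {0..2 * pi} G) / l) / 2"
      using le unfolding eq1 eq2 .
  qed
  thus ?thesis unfolding hardy2_mean_def F_def G_def .
qed

lemma hardy2_mean_mono:
  assumes "continuous_on (sphere 0 r) f" "continuous_on (sphere 0 r) g" "r \<ge> 0"
    and "\<And>w. norm w = r \<Longrightarrow> norm (f w) \<le> norm (g w)"
  shows "hardy2_mean f r \<le> hardy2_mean g r"
  unfolding hardy2_mean_def using assms
  by (intro real_sqrt_le_mono mult_left_mono integral_le power_mono integrable_continuous_interval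
      continuous_intros continuous_on_circle_param) auto

text \<open>Cauchy's formula on \<open>|w| = r\<close> with \<open>dw = i w dt\<close>.\<close>

lemma circle_mean_Cauchy:
  assumes cont: "continuous_on (cball 0 r) F" and hol: "F holomorphic_on ball 0 r" and \<zeta>: "norm \<zeta> < r"
  shows "((\<lambda>t. F (of_real r * cis t) * (of_real r * cis t) / (of_real r * cis t - \<zeta>))
           has_integral of_real (2 * pi) * F \<zeta>) {0..2 * pi}"
proof -
  have "((\<lambda>u. F u / (u - \<zeta>)) has_contour_integral 2 * of_real pi * \<i> * F \<zeta>) (part_circlepath 0 r 0 (2 * pi))"
    using Cauchy_integral_circlepath[OF cont hol, of \<zeta>] \<zeta> by (simp add: circlepath_def)
  hence "((\<lambda>t. F (0 + of_real r * cis t) / (0 + of_real r * cis t - \<zeta>) * of_real r * \<i> * cis t)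
      has_integral 2 * of_real pi * \<i> * F \<zeta>) {0..2 * pi}"
    by (subst (asm) has_contour_integral_part_circlepath_iff) auto
  from has_integral_mult_right[OF this, of "1 / \<i>"] show ?thesis
    by (simp add: mult_ac divide_inverse)
qed

text \<open>On \<open>|w| = r\<close> the conjugate of \<open>1 / (w - b)\<close> is \<open>w / (r\<^sup>2 - w * cnj b)\<close>, holomorphic inside; Cauchy's
  formula at \<open>a\<close> applies.\<close>

lemma circle_inner_cauchy:
  assumes r: "0 < r" and a: "norm a < r" and b: "norm b < r"
  shows "circle_inner (\<lambda>w. 1 / (w - a)) (\<lambda>w. 1 / (w - b)) r = 1 / (of_real (r\<^sup>2) - a * cnj b)"
proof -
  define F where "F = (\<lambda>w. 1 / (of_real (r\<^sup>2) - w * cnj b))"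
  have ne: "of_real (r\<^sup>2) - w * cnj b \<noteq> 0" if "norm w \<le> r" for w
  proof
    assume "of_real (r\<^sup>2) - w * cnj b = 0"
    hence "norm (w * cnj b) = norm (complex_of_real (r\<^sup>2))" by simp
    hence "norm w * norm b = r * r" using r by (simp add: norm_mult power2_eq_square)
    moreover have "norm w * norm b \<le> r * norm b" using that by (intro mult_right_mono) auto
    moreover have "r * norm b < r * r" using b r by (intro mult_strict_left_mono) auto
    ultimately show False by simp
  qed
  have "((\<lambda>t. F (of_real r * cis t) * (of_real r * cis t) / (of_real r * cis t - a))
           has_integral of_real (2 * pi) * F a) {0..2 * pi}"
  proof (rule circle_mean_Cauchy[OF _ _ a])
    show "continuous_on (cball 0 r) F" unfolding F_def using ne by (intro continuous_intros) auto
    show "F holomorphic_on ball 0 r" unfolding F_def using ne by (intro holomorphic_intros) auto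
  qed
  moreover have "F w * w / (w - a) = 1 / (w - a) * cnj (1 / (w - b))" if w: "norm w = r" for w
  proof -
    have w0: "w \<noteq> 0" using w r by auto
    have ww: "of_real (r\<^sup>2) = w * cnj w" using complex_norm_square[of w] w by simp
    have "F w * w = w / (w * (cnj w - cnj b))" unfolding F_def ww by (simp add: algebra_simps)
    also have "\<dots> = cnj (1 / (w - b))" using w0 by simp
    finally show ?thesis by simp
  qed
  ultimately have "((\<lambda>t. 1 / (of_real r * cis t - a) * cnj (1 / (of_real r * cis t - b)))
           has_integral of_real (2 * pi) * F a) {0..2 * pi}"
    using r by simp
  from integral_unique[OF this] show ?thesis unfolding circle_inner_def F_def by simp
qed

definition taylor_coeff :: "(complex \<Rightarrow> complex) \<Rightarrow> nat \<Rightarrow> complex" where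
  "taylor_coeff f k = (deriv ^^ k) f 0 / fact k"

lemma circle_mean_taylor_coeff:
  assumes hol: "F holomorphic_on unit_disc" and r: "0 < r" "r < 1"
  shows "((\<lambda>t. F (of_real r * cis t) * cnj (of_real r * cis t) ^ k)
           has_integral of_real (2 * pi) * (taylor_coeff F k * of_real (r ^ (2 * k)))) {0..2 * pi}"
proof -
  have "((\<lambda>u. F u / (u - 0) ^ Suc k) has_contour_integral (2 * pi * \<i>) / fact k * (deriv ^^ k) F 0)
      (circlepath 0 r)"
    using r by (intro Cauchy_has_contour_integral_higher_derivative_circlepath
        holomorphic_on_imp_continuous_on holomorphic_on_subset[OF hol]) auto
  hence "((\<lambda>u. F u / u ^ Suc k) has_contour_integral 2 * pi * \<i> * taylor_coeff F k)
      (part_circlepath 0 r 0 (2 * pi))"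
    by (simp add: circlepath_def taylor_coeff_def)
  hence "((\<lambda>t. F (0 + of_real r * cis t) / (0 + of_real r * cis t) ^ Suc k * of_real r * \<i> * cis t)
      has_integral 2 * of_real pi * \<i> * taylor_coeff F k) {0..2 * pi}"
    by (subst (asm) has_contour_integral_part_circlepath_iff) auto
  from has_integral_mult_right[OF this, of "of_real (r ^ (2 * k)) / \<i>"]
  have "((\<lambda>t. of_real (r ^ (2 * k)) / \<i> * (F (of_real r * cis t) / (of_real r * cis t) ^ Suc k * of_real r * \<i> * cis t))
      has_integral of_real (2 * pi) * (taylor_coeff F k * of_real (r ^ (2 * k)))) {0..2 * pi}"
    by (simp add: mult_ac divide_inverse)
  moreover have "of_real (r ^ (2 * k)) / \<i> * (F (of_real r * cis t) / (of_real r * cis t) ^ Suc k * of_real r * \<i> * cis t)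
      = F (of_real r * cis t) * cnj (of_real r * cis t) ^ k" for t
  proof -
    define w where "w = of_real r * cis t"
    have cancel: "q / e * (A * R * e * s) = q * (A * (R * s))" if "e \<noteq> 0" for q e A R s :: complex
      using that by simp
    have "w \<noteq> 0" "norm w = r" unfolding w_def using r by (simp_all add: norm_mult)
    moreover from this have "of_real (r ^ (2 * k)) = (w * cnj w) ^ k"
      using complex_norm_square[of w] by (simp add: power_mult)
    ultimately have "of_real (r ^ (2 * k)) * (F w / w ^ Suc k * w) = F w * cnj w ^ k"
      by (simp add: power_mult_distrib)
    moreover have "of_real (r ^ (2 * k)) / \<i> * (F w / w ^ Suc k * of_real r * \<i> * cis t)
        = of_real (r ^ (2 * k)) * (F w / w ^ Suc k * (of_real r * cis t))"
      by (rule cancel) simp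
    ultimately show ?thesis unfolding w_def by simp
  qed
  ultimately show ?thesis by simp
qed

lemma taylor_series_sums:
  assumes "f holomorphic_on unit_disc" "norm w < 1"
  shows "(\<lambda>k. taylor_coeff f k * w ^ k) sums f w"
  using holomorphic_power_series[OF assms(1), of w] assms(2) unfolding taylor_coeff_def by simp

lemma taylor_series_abs_summable:
  assumes "f holomorphic_on unit_disc" "0 \<le> r" "r < 1"
  shows "summable (\<lambda>k. norm (taylor_coeff f k) * r ^ k)"
proof -
  have "summable (\<lambda>k. taylor_coeff f k * of_real ((r + 1) / 2) ^ k)"
    using assms by (intro sums_summable[OF taylor_series_sums] assms(1), subst norm_of_real) auto
  hence "summable (\<lambda>k. norm (taylor_coeff f k * of_real r ^ k))"
    by (rule powser_insidea, unfold norm_of_real) (use assms in auto)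
  thus ?thesis using assms by (simp add: norm_mult norm_power)
qed

text \<open>Parseval's identity. Only \<open>g\<close> is expanded: the series of \<open>g\<close> converges uniformly on the circle and
  each term picks out one Taylor coefficient of \<open>f\<close>.\<close>

lemma circle_inner_sums:
  assumes f: "f holomorphic_on unit_disc" and g: "g holomorphic_on unit_disc" and r: "0 < r" "r < 1"
  shows "(\<lambda>k. taylor_coeff f k * cnj (taylor_coeff g k) * of_real (r ^ (2 * k))) sums circle_inner f g r"
proof -
  define T where "T = (\<lambda>k t. f (of_real r * cis t) * cnj (taylor_coeff g k) * cnj (of_real r * cis t) ^ k)"
  have fc: "continuous_on (sphere 0 r) f" by (rule holomorphic_continuous_on_circle[OF f r])
  obtain M where M: "\<forall>w\<in>sphere 0 r. norm (f w) \<le> M"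
    using compact_imp_bounded[OF compact_continuous_image[OF fc compact_sphere]]
    unfolding bounded_iff by auto
  have Tsum: "(\<lambda>k. T k t) sums (f (of_real r * cis t) * cnj (g (of_real r * cis t)))" for t
  proof -
    have "(\<lambda>k. taylor_coeff g k * (of_real r * cis t) ^ k) sums g (of_real r * cis t)"
      using r by (intro taylor_series_sums[OF g]) (auto simp: norm_mult)
    hence "(\<lambda>k. cnj (taylor_coeff g k * (of_real r * cis t) ^ k)) sums cnj (g (of_real r * cis t))"
      by (subst sums_cnj)
    from sums_mult[OF this, of "f (of_real r * cis t)"] show ?thesis
      unfolding T_def by (simp add: mult_ac)
  qed
  have "uniform_limit {0..2 * pi} (\<lambda>n t. \<Sum>k<n. T k t) (\<lambda>t. \<Sum>k. T k t) sequentially"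
  proof (rule Weierstrass_m_test)
    fix k t
    have "norm (T k t) = norm (f (of_real r * cis t)) * norm (taylor_coeff g k) * r ^ k"
      unfolding T_def using r by (simp add: norm_mult norm_power)
    also have "\<dots> \<le> M * norm (taylor_coeff g k) * r ^ k"
      using r by (intro mult_right_mono M[rule_format]) auto
    finally show "norm (T k t) \<le> M * (norm (taylor_coeff g k) * r ^ k)" by simp
  next
    show "summable (\<lambda>k. M * (norm (taylor_coeff g k) * r ^ k))"
      using r by (intro summable_mult taylor_series_abs_summable[OF g]) auto
  qed
  moreover have "continuous_on {0..2 * pi} (\<lambda>t. \<Sum>k<n. T k t)" for n
    unfolding T_def using r fc by (intro continuous_intros continuous_on_circle_param) auto
  ultimately obtain I J where I: "\<And>n. ((\<lambda>t. \<Sum>k<n. T k t) has_integral I n) {0..2 * pi}"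
    and J: "((\<lambda>t. \<Sum>k. T k t) has_integral J) {0..2 * pi}" and lim: "I \<longlonglongrightarrow> J"
    by (rule uniform_limit_integral) auto
  have "((\<lambda>t. \<Sum>k<n. T k t) has_integral (\<Sum>k<n. cnj (taylor_coeff g k) *
          (of_real (2 * pi) * (taylor_coeff f k * of_real (r ^ (2 * k)))))) {0..2 * pi}" for n
  proof (rule has_integral_sum)
    fix k
    show "(T k has_integral cnj (taylor_coeff g k) *
        (of_real (2 * pi) * (taylor_coeff f k * of_real (r ^ (2 * k))))) {0..2 * pi}"
      using has_integral_mult_right[OF circle_mean_taylor_coeff[OF f r], of "cnj (taylor_coeff g k)" k]
      unfolding T_def by (simp add: mult_ac)
  qed auto
  note partial = this
  have "I n = (\<Sum>k<n. of_real (2 * pi) *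
      (taylor_coeff f k * cnj (taylor_coeff g k) * of_real (r ^ (2 * k))))" for n
  proof -
    note has_integral_unique[OF I[of n] partial[of n]]
    also have "(\<Sum>k<n. cnj (taylor_coeff g k) *
          (of_real (2 * pi) * (taylor_coeff f k * of_real (r ^ (2 * k)))))
        = (\<Sum>k<n. of_real (2 * pi) *
          (taylor_coeff f k * cnj (taylor_coeff g k) * of_real (r ^ (2 * k))))"
      by (intro sum.cong refl) (simp only: mult_ac)
    finally show ?thesis .
  qed
  hence "(\<lambda>k. of_real (2 * pi) * (taylor_coeff f k * cnj (taylor_coeff g k) * of_real (r ^ (2 * k)))) sums J"
    using lim unfolding sums_def by presburger
  hence "(\<lambda>k. of_real (1 / (2 * pi)) * (of_real (2 * pi) * (taylor_coeff f k * cnj (taylor_coeff g k) * of_real (r ^ (2 * k)))))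
      sums (of_real (1 / (2 * pi)) * J)"
    by (rule sums_mult)
  moreover have "J = integral {0..2 * pi} (\<lambda>t. f (of_real r * cis t) * cnj (g (of_real r * cis t)))"
    using J sums_unique[OF Tsum] by (simp add: integral_unique)
  ultimately show ?thesis unfolding circle_inner_def by simp
qed

lemma hardy2_taylor_square_summable:
  assumes "f \<in> hardy2"
  shows "summable (\<lambda>k. (norm (taylor_coeff f k))\<^sup>2)"
proof -
  from assms have hol: "f holomorphic_on unit_disc" by (simp add: hardy2_def)
  from assms obtain M where M: "\<forall>r\<in>{0<..<1}. hardy2_mean f r \<le> M"
    unfolding hardy2_def bdd_above_def by auto
  \<comment> \<open>Finite sums are used so that \<open>r\<close> can tend to \<open>1\<close> before \<open>n\<close> tends to infinity.\<close>
  have "(\<Sum>k<n. (norm (taylor_coeff f k))\<^sup>2) \<le> M\<^sup>2" for n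
  proof (rule tendsto_upperbound)
    show "((\<lambda>r. \<Sum>k<n. (norm (taylor_coeff f k))\<^sup>2 * r ^ (2 * k)) \<longlongrightarrow> (\<Sum>k<n. (norm (taylor_coeff f k))\<^sup>2)) (at_left 1)"
      by (auto intro!: tendsto_eq_intros)
    show "\<forall>\<^sub>F r in at_left (1::real). (\<Sum>k<n. (norm (taylor_coeff f k))\<^sup>2 * r ^ (2 * k)) \<le> M\<^sup>2"
      using eventually_at_left_field[of _ "1::real"]
    proof -
      have "(\<Sum>k<n. (norm (taylor_coeff f k))\<^sup>2 * r ^ (2 * k)) \<le> M\<^sup>2" if r: "0 < r" "r < 1" for r
      proof -
        have "(\<lambda>k. complex_of_real ((norm (taylor_coeff f k))\<^sup>2 * r ^ (2 * k))) sums of_real ((hardy2_mean f r)\<^sup>2)"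
        proof -
          from circle_inner_self[OF holomorphic_continuous_on_circle[OF hol r]] circle_inner_sums[OF hol hol r] r show ?thesis
            by (simp only: of_real_mult complex_norm_square less_imp_le)
        qed
        hence s: "(\<lambda>k. (norm (taylor_coeff f k))\<^sup>2 * r ^ (2 * k)) sums ((hardy2_mean f r)\<^sup>2)"
          by (simp only: sums_of_real_iff)
        have "(\<Sum>k<n. (norm (taylor_coeff f k))\<^sup>2 * r ^ (2 * k)) \<le> (hardy2_mean f r)\<^sup>2"
          unfolding sums_unique[OF s] using r by (intro sum_le_suminf sums_summable[OF s]) auto
        also have "\<dots> \<le> M\<^sup>2" using M r by (intro power_mono hardy2_mean_nonneg) auto
        finally show ?thesis .
      qed
      thus ?thesis by (intro eventually_at_leftI[of 0]) auto
    qed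
  qed auto
  thus ?thesis by (intro summableI_nonneg_bounded) auto
qed

text \<open>The definition of \<open>hardy2_inner\<close> by \<open>Lim\<close> is meaningful only when the limit exists. The Taylor
  coefficients of \<open>f\<close> and \<open>g\<close> are square summable, so the Parseval series converges uniformly for \<open>r\<close>
  in the closed interval from \<open>0\<close> to \<open>1\<close> and is continuous there.\<close>

lemma hardy2_inner_limit:
  assumes f: "f \<in> hardy2" and g: "g \<in> hardy2"
  shows "(circle_inner f g \<longlongrightarrow> hardy2_inner f g) (at_left 1)"
proof -
  have hol: "f holomorphic_on unit_disc" "g holomorphic_on unit_disc"
    using f g by (auto simp: hardy2_def)
  define c where "c = (\<lambda>k. taylor_coeff f k * cnj (taylor_coeff g k))"
  have c: "summable (\<lambda>k. norm (c k))"
  proof (rule summable_comparison_test)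
    show "summable (\<lambda>k. (norm (taylor_coeff f k))\<^sup>2 + (norm (taylor_coeff g k))\<^sup>2)"
      by (intro summable_add hardy2_taylor_square_summable f g)
    have "norm (norm (c k)) \<le> (norm (taylor_coeff f k))\<^sup>2 + (norm (taylor_coeff g k))\<^sup>2" for k
    proof -
      have "norm (taylor_coeff f k) * norm (taylor_coeff g k) \<ge> 0" by simp
      with sum_squares_bound[of "norm (taylor_coeff f k)" "norm (taylor_coeff g k)"]
      have "norm (taylor_coeff f k) * norm (taylor_coeff g k)
          \<le> (norm (taylor_coeff f k))\<^sup>2 + (norm (taylor_coeff g k))\<^sup>2" by linarith
      thus ?thesis unfolding c_def by (simp add: norm_mult)
    qed
    thus "\<exists>N. \<forall>k\<ge>N. norm (norm (c k)) \<le> (norm (taylor_coeff f k))\<^sup>2 + (norm (taylor_coeff g k))\<^sup>2"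
      by blast
  qed
  define F where "F = (\<lambda>r::real. \<Sum>k. c k * of_real (r ^ (2 * k)))"
  have "uniform_limit {0..1::real} (\<lambda>n r. \<Sum>k<n. c k * of_real (r ^ (2 * k))) F sequentially"
    unfolding F_def
  proof (rule Weierstrass_m_test[OF _ c])
    fix k and r :: real assume "r \<in> {0..1}"
    hence "\<bar>r ^ (2 * k)\<bar> \<le> 1" by (simp add: power_le_one)
    thus "norm (c k * of_real (r ^ (2 * k))) \<le> norm (c k)"
      unfolding norm_mult norm_of_real by (intro mult_left_le) auto
  qed
  hence "continuous_on {0..1} F"
    by (rule uniform_limit_theorem[rotated]) (auto intro!: always_eventually continuous_intros)
  hence "(F \<longlongrightarrow> F 1) (at 1 within {0..1})" unfolding continuous_on_def by auto
  hence "(F \<longlongrightarrow> F 1) (at_left 1)" by (simp add: at_within_Icc_at_left)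
  moreover have "\<forall>\<^sub>F r in at_left 1. F r = circle_inner f g r"
    using circle_inner_sums[OF hol] unfolding F_def c_def
    by (intro eventually_at_leftI[of 0]) (auto simp: sums_iff)
  ultimately have lim: "(circle_inner f g \<longlongrightarrow> F 1) (at_left 1)"
    by (rule Lim_transform_eventually)
  hence "hardy2_inner f g = F 1" unfolding hardy2_inner_eq_Lim by (intro tendsto_Lim) auto
  with lim show ?thesis by simp
qed

lemma bounded_holomorphic_in_hardy2:
  assumes hol: "f holomorphic_on unit_disc" and bd: "\<And>w. norm w < 1 \<Longrightarrow> norm (f w) \<le> M"
  shows "f \<in> hardy2"
proof -
  have "hardy2_mean f r \<le> hardy2_mean (\<lambda>_. of_real M) r" if r: "0 < r" "r < 1" for r
    using r bd norm_ge_zero order.trans abs_ge_self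
    by (intro hardy2_mean_mono holomorphic_on_imp_continuous_on holomorphic_on_subset[OF hol])
       (auto intro: order.trans[OF _ abs_ge_self])
  moreover have "hardy2_mean (\<lambda>_. of_real M) r = \<bar>M\<bar>" for r
    by (simp add: hardy2_mean_def)
  ultimately show ?thesis using hol by (auto simp: hardy2_def intro!: bdd_aboveI2[of _ _ "\<bar>M\<bar>"])
qed

section \<open>The Szego kernel and truncation of reproducing kernels\<close>

definition szego_kernel :: "complex \<Rightarrow> complex \<Rightarrow> complex" where
  "szego_kernel z w = 1 / (1 - cnj z * w)"

lemma szego_kernel_holomorphic:
  assumes "norm z < 1" shows "szego_kernel z holomorphic_on unit_disc"
  unfolding szego_kernel_def[abs_def]
  using one_minus_cnj_mult_ne_0[OF assms] by (intro holomorphic_intros) (auto simp: less_imp_le)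

lemma szego_kernel_bound:
  assumes "norm z < 1" "norm w \<le> 1"
  shows "norm (szego_kernel z w) \<le> 1 / (1 - norm z)"
proof -
  have "1 - norm z \<le> norm (1 - cnj z * w)"
    using norm_one_minus_cnj_ge[of w z] assms by (simp add: norm_one_minus_cnj_commute[of z w])
  thus ?thesis using assms unfolding szego_kernel_def by (simp add: norm_divide frac_le)
qed

text \<open>The reproducing property on the circle of radius \<open>r\<close>; the point is dilated by \<open>r\<^sup>2\<close> since
  \<open>cnj w = r\<^sup>2 / w\<close> there.\<close>

lemma circle_inner_szego:
  assumes F: "F holomorphic_on unit_disc" and r: "0 < r" "r < 1" and z: "norm z < 1"
  shows "circle_inner F (szego_kernel z) r = F (of_real (r\<^sup>2) * z)"
proof -
  have \<zeta>: "norm (of_real (r\<^sup>2) * z) < r"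
  proof -
    have "r * norm z < 1" using r z mult_left_le_one_le[of "norm z" r] by simp
    hence "r * (r * norm z) < r * 1" using r by (intro mult_strict_left_mono)
    thus ?thesis using r by (simp add: norm_mult power2_eq_square)
  qed
  have "((\<lambda>t. F (of_real r * cis t) * (of_real r * cis t) / (of_real r * cis t - of_real (r\<^sup>2) * z))
           has_integral of_real (2 * pi) * F (of_real (r\<^sup>2) * z)) {0..2 * pi}"
    using r \<zeta> by (intro circle_mean_Cauchy holomorphic_on_imp_continuous_on holomorphic_on_subset[OF F]) auto
  moreover have "F w * w / (w - of_real (r\<^sup>2) * z) = F w * cnj (szego_kernel z w)" if w: "norm w = r" for w
  proof -
    have w0: "w \<noteq> 0" and ww: "of_real (r\<^sup>2) = w * cnj w" using w r complex_norm_square[of w] by auto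
    have "w / (w - w * cnj w * z) = w / (w * (1 - z * cnj w))" by (simp add: algebra_simps)
    also have "\<dots> = 1 / (1 - z * cnj w)" using w0 by simp
    finally show ?thesis unfolding ww szego_kernel_def by (simp add: times_divide_eq_right[symmetric] del: times_divide_eq_right)
  qed
  ultimately have "((\<lambda>t. F (of_real r * cis t) * cnj (szego_kernel z (of_real r * cis t)))
           has_integral of_real (2 * pi) * F (of_real (r\<^sup>2) * z)) {0..2 * pi}"
    using r by simp
  thus ?thesis unfolding circle_inner_def by (simp add: integral_unique)
qed

lemma tendsto_at_dilation:
  assumes "F holomorphic_on unit_disc" "norm z < 1"
  shows "((\<lambda>r. F (of_real (r\<^sup>2) * z)) \<longlongrightarrow> F z) (at_left 1)"
proof -
  have "isCont F z"
    using assms holomorphic_on_imp_continuous_on[OF assms(1)] continuous_on_eq_continuous_at[of unit_disc F]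
    by auto
  moreover have "((\<lambda>r. complex_of_real (r\<^sup>2) * z) \<longlongrightarrow> z) (at_left 1)"
    by (auto intro!: tendsto_eq_intros)
  ultimately show ?thesis by (rule isCont_tendsto_compose)
qed

text \<open>Expand \<open>|1 - cnj (R z) R|\<^sup>2\<close>, use \<open>|R| \<le> 1\<close> in the quadratic term and the reproducing property in the
  others. For \<open>r\<close> tending to \<open>1\<close> the bound becomes \<open>(1 - |R z|\<^sup>2) / (1 - |z|\<^sup>2)\<close>.\<close>

lemma hardy2_mean_defect_le:
  assumes R: "R holomorphic_on unit_disc" and R1: "\<And>w. norm w < 1 \<Longrightarrow> norm (R w) \<le> 1"
    and z: "norm z < 1" and r: "0 < r" "r < 1"
  shows "(hardy2_mean (\<lambda>w. (1 - cnj (R z) * R w) * szego_kernel z w) r)\<^sup>2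
    \<le> Re (of_real (1 + (norm (R z))\<^sup>2) * szego_kernel z (of_real (r\<^sup>2) * z)
        - 2 * cnj (R z) * (R (of_real (r\<^sup>2) * z) * szego_kernel z (of_real (r\<^sup>2) * z)))"
proof -
  define C where "C = szego_kernel z"
  define v where "v = R z"
  have C: "C holomorphic_on unit_disc" unfolding C_def by (rule szego_kernel_holomorphic[OF z])
  have RC: "(\<lambda>w. R w * C w) holomorphic_on unit_disc" by (intro holomorphic_intros R C)
  have sub: "sphere 0 r \<subseteq> unit_disc" using r by auto
  have cont: "continuous_on (sphere 0 r) C" "continuous_on (sphere 0 r) R"
    using holomorphic_on_imp_continuous_on[OF holomorphic_on_subset[OF _ sub]] C R by auto
  define u where "u = (\<lambda>w. (1 - cnj v * R w) * C w)"
  define A B where "A = (\<lambda>t. C (of_real r * cis t) * cnj (C (of_real r * cis t)))"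
    and "B = (\<lambda>t. (R (of_real r * cis t) * C (of_real r * cis t)) * cnj (C (of_real r * cis t)))"
  have int: "A integrable_on {0..2 * pi}" "B integrable_on {0..2 * pi}"
    unfolding A_def B_def using cont r
    by (intro circle_inner_integrable continuous_intros integrable_continuous_interval
        continuous_on_circle_param; auto)+
  define H where "H = (\<lambda>t. of_real (1 + (norm v)\<^sup>2) * A t - 2 * cnj v * B t)"
  have Hint: "(H has_integral of_real (1 + (norm v)\<^sup>2) * integral {0..2 * pi} A
      - 2 * cnj v * integral {0..2 * pi} B) {0..2 * pi}"
    unfolding H_def using int
    by (intro has_integral_diff has_integral_mult_right) (auto simp: has_integral_integral)
  have "integral {0..2 * pi} (\<lambda>t. (norm (u (of_real r * cis t)))\<^sup>2) \<le> integral {0..2 * pi} (\<lambda>t. Re (H t))"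
  proof (rule integral_le)
    show "(\<lambda>t. (norm (u (of_real r * cis t)))\<^sup>2) integrable_on {0..2 * pi}"
      unfolding u_def using cont r
      by (intro integrable_continuous_interval continuous_intros continuous_on_circle_param) auto
    show "(\<lambda>t. Re (H t)) integrable_on {0..2 * pi}"
      using has_integral_Re[OF Hint] by (auto simp: integrable_on_def)
    fix t
    define w where "w = of_real r * cis t"
    have w: "norm w < 1" unfolding w_def using r by simp
    define X where "X = cnj v * (R w * C w * cnj (C w))"
    have "complex_of_real ((norm (u w))\<^sup>2)
        = of_real ((norm (C w))\<^sup>2 + (norm v)\<^sup>2 * (norm (R w))\<^sup>2 * (norm (C w))\<^sup>2) - X - cnj X"
      unfolding of_real_add of_real_mult complex_norm_square u_def X_def by (simp add: algebra_simps)
    from arg_cong[OF this, of Re]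
    have "(norm (u w))\<^sup>2 = (norm (C w))\<^sup>2 + (norm v)\<^sup>2 * (norm (R w))\<^sup>2 * (norm (C w))\<^sup>2 - 2 * Re X"
      by simp
    also have "(norm v)\<^sup>2 * (norm (R w))\<^sup>2 * (norm (C w))\<^sup>2 \<le> (norm v)\<^sup>2 * 1 * (norm (C w))\<^sup>2"
      using R1[OF w] by (intro mult_right_mono mult_left_mono) (auto simp: power_le_one)
    also have "(norm (C w))\<^sup>2 + (norm v)\<^sup>2 * 1 * (norm (C w))\<^sup>2 - 2 * Re X = Re (H t)"
    proof -
      have "H t = of_real ((1 + (norm v)\<^sup>2) * (norm (C w))\<^sup>2) - 2 * X"
        unfolding H_def A_def B_def w_def[symmetric] X_def of_real_mult complex_norm_square by simp
      hence "Re (H t) = Re (of_real ((1 + (norm v)\<^sup>2) * (norm (C w))\<^sup>2) - 2 * X)" by (rule arg_cong)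
      also have "\<dots> = (1 + (norm v)\<^sup>2) * (norm (C w))\<^sup>2 - 2 * Re X"
        unfolding minus_complex.simps Re_complex_of_real by simp
      finally show ?thesis by (simp add: algebra_simps)
    qed
    finally show "(norm (u (of_real r * cis t)))\<^sup>2 \<le> Re (H t)" unfolding w_def by simp
  qed
  hence "1 / (2 * pi) * integral {0..2 * pi} (\<lambda>t. (norm (u (of_real r * cis t)))\<^sup>2)
      \<le> 1 / (2 * pi) * integral {0..2 * pi} (\<lambda>t. Re (H t))" by (intro mult_left_mono) auto
  also have "integral {0..2 * pi} (\<lambda>t. Re (H t)) = Re (of_real (1 + (norm v)\<^sup>2) * integral {0..2 * pi} A
      - 2 * cnj v * integral {0..2 * pi} B)"
    by (intro integral_unique has_integral_Re[OF Hint])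
  also have "1 / (2 * pi) * \<dots> = Re (of_real (1 + (norm v)\<^sup>2) * circle_inner C C r
      - 2 * cnj v * circle_inner (\<lambda>w. R w * C w) C r)"
    unfolding circle_inner_def A_def[symmetric] B_def[symmetric] by (simp add: field_simps)
  also have "circle_inner C C r = C (of_real (r\<^sup>2) * z)"
    unfolding C_def using circle_inner_szego[OF C[unfolded C_def] r z] .
  also have "circle_inner (\<lambda>w. R w * C w) C r = R (of_real (r\<^sup>2) * z) * C (of_real (r\<^sup>2) * z)"
    unfolding C_def using circle_inner_szego[OF RC[unfolded C_def] r z] .
  finally have *: "1 / (2 * pi) * integral {0..2 * pi} (\<lambda>t. (norm (u (of_real r * cis t)))\<^sup>2)
    \<le> Re (of_real (1 + (norm v)\<^sup>2) * C (of_real (r\<^sup>2) * z)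
        - 2 * cnj v * (R (of_real (r\<^sup>2) * z) * C (of_real (r\<^sup>2) * z)))" .
  have "(hardy2_mean u r)\<^sup>2 = 1 / (2 * pi) * integral {0..2 * pi} (\<lambda>t. (norm (u (of_real r * cis t)))\<^sup>2)"
    unfolding hardy2_mean_def
    by (intro real_sqrt_pow2 mult_nonneg_nonneg integral_nonneg_always) auto
  with * show ?thesis unfolding u_def v_def C_def by simp
qed

text \<open>Let \<open>C\<close> be the Szego kernel at \<open>z\<close>. The kernel \<open>(1 - cnj (P z R z) P R) C\<close> reproduces \<open>f(z)\<close>,
  because \<open>f\<close> is orthogonal to \<open>P R C\<close>. It differs from the kernel \<open>(1 - cnj (P z) P) C\<close> by
  \<open>cnj (P z) P (1 - cnj (R z) R) C\<close>, whose norm is at most that of the defect function bounded above.\<close>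

lemma truncated_kernel_error:
  assumes f: "f \<in> hardy2" and M: "\<And>r. 0 < r \<Longrightarrow> r < 1 \<Longrightarrow> hardy2_mean f r \<le> M"
    and P: "P holomorphic_on unit_disc" "\<And>w. norm w < 1 \<Longrightarrow> norm (P w) \<le> 1"
    and R: "R holomorphic_on unit_disc" "\<And>w. norm w < 1 \<Longrightarrow> norm (R w) \<le> 1"
    and z: "norm z < 1"
    and orth: "(circle_inner f (\<lambda>w. P w * R w * szego_kernel z w) \<longlongrightarrow> 0) (at_left 1)"
    and lim: "(circle_inner f (\<lambda>w. (1 - cnj (P z) * P w) * szego_kernel z w) \<longlongrightarrow> L) (at_left 1)"
  shows "norm (f z - L) \<le> M * sqrt ((1 - (norm (R z))\<^sup>2) / (1 - (norm z)\<^sup>2))"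
proof -
  have fhol: "f holomorphic_on unit_disc" using f by (simp add: hardy2_def)
  define C where "C = szego_kernel z"
  have C: "C holomorphic_on unit_disc" unfolding C_def by (rule szego_kernel_holomorphic[OF z])
  define u where "u = (\<lambda>w. (1 - cnj (R z) * R w) * C w)"
  define e where "e = (\<lambda>w. cnj (P z) * (P w * u w))"
  note cont = holomorphic_continuous_on_circle
  have u: "u holomorphic_on unit_disc" unfolding u_def by (intro holomorphic_intros R C)
  have e: "e holomorphic_on unit_disc" unfolding e_def by (intro holomorphic_intros P u)
  have split: "circle_inner f e r = f (of_real (r\<^sup>2) * z)
      - P z * R z * circle_inner f (\<lambda>w. P w * R w * C w) r
      - circle_inner f (\<lambda>w. (1 - cnj (P z) * P w) * C w) r" if r: "0 < r" "r < 1" for r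
  proof -
    have K: "(\<lambda>w. (1 - cnj (P z) * P w) * C w) holomorphic_on unit_disc"
      "(\<lambda>w. P w * R w * C w) holomorphic_on unit_disc"
      "(\<lambda>w. e w + (1 - cnj (P z) * P w) * C w) holomorphic_on unit_disc"
      "(\<lambda>w. cnj (P z * R z) * (P w * R w * C w)) holomorphic_on unit_disc"
      by (intro holomorphic_intros P C R e)+
    have "circle_inner f C r = circle_inner f (\<lambda>w. (e w + (1 - cnj (P z) * P w) * C w)
        + cnj (P z * R z) * (P w * R w * C w)) r"
      using r by (intro circle_inner_cong) (auto simp: e_def u_def algebra_simps)
    also have "\<dots> = circle_inner f (\<lambda>w. e w + (1 - cnj (P z) * P w) * C w) r
        + circle_inner f (\<lambda>w. cnj (P z * R z) * (P w * R w * C w)) r"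
      using r fhol e K by (intro circle_inner_add_right cont) auto
    also have "circle_inner f (\<lambda>w. e w + (1 - cnj (P z) * P w) * C w) r
        = circle_inner f e r + circle_inner f (\<lambda>w. (1 - cnj (P z) * P w) * C w) r"
      using r fhol e K by (intro circle_inner_add_right cont) auto
    also have "circle_inner f (\<lambda>w. cnj (P z * R z) * (P w * R w * C w)) r
        = P z * R z * circle_inner f (\<lambda>w. P w * R w * C w) r"
      using r fhol K by (subst circle_inner_scale_right) (auto intro!: cont)
    finally show ?thesis using circle_inner_szego[OF fhol r z] unfolding C_def by simp
  qed
  have "((\<lambda>r. f (of_real (r\<^sup>2) * z)
      - P z * R z * circle_inner f (\<lambda>w. P w * R w * C w) r
      - circle_inner f (\<lambda>w. (1 - cnj (P z) * P w) * C w) r) \<longlongrightarrow> f z - P z * R z * 0 - L) (at_left 1)"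
    unfolding C_def by (intro tendsto_intros orth lim tendsto_at_dilation fhol z)
  hence elim: "(circle_inner f e \<longlongrightarrow> f z - L) (at_left 1)"
    using split by (subst (asm) tendsto_cong[of _ "circle_inner f e"])
      (auto intro!: eventually_at_leftI[of 0])
  define E where "E = (\<lambda>r. Re (of_real (1 + (norm (R z))\<^sup>2) * C (of_real (r\<^sup>2) * z)
        - 2 * cnj (R z) * (R (of_real (r\<^sup>2) * z) * C (of_real (r\<^sup>2) * z))))"
  have bound: "norm (circle_inner f e r) \<le> M * sqrt (E r)" if r: "0 < r" "r < 1" for r
  proof -
    have "norm (circle_inner f e r) \<le> hardy2_mean f r * hardy2_mean e r"
      using r fhol e by (intro circle_inner_Cauchy_Schwarz cont) auto
    also have "\<dots> \<le> M * sqrt (E r)"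
    proof (intro mult_mono M r)
      have "hardy2_mean e r \<le> hardy2_mean u r"
      proof (rule hardy2_mean_mono)
        fix w :: complex assume w: "norm w = r"
        have "norm (P z) * norm (P w) \<le> 1 * 1" using P(2)[of z] P(2)[of w] z w r
          by (intro mult_mono) auto
        hence "norm (P z) * norm (P w) * norm (u w) \<le> 1 * norm (u w)"
          by (intro mult_right_mono) auto
        thus "norm (e w) \<le> norm (u w)" unfolding e_def by (simp add: norm_mult mult_ac)
      qed (use r e u cont in auto)
      also have "\<dots> \<le> sqrt (E r)"
        using hardy2_mean_defect_le[OF R z r] unfolding E_def u_def C_def by (rule real_le_rsqrt)
      finally show "hardy2_mean e r \<le> sqrt (E r)" .
      show "0 \<le> M" using M[OF r] hardy2_mean_nonneg[of f r] by linarith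
    qed (rule hardy2_mean_nonneg)
    finally show ?thesis .
  qed
  have "(E \<longlongrightarrow> Re (of_real (1 + (norm (R z))\<^sup>2) * C z - 2 * cnj (R z) * (R z * C z))) (at_left 1)"
    unfolding E_def by (intro tendsto_intros tendsto_at_dilation C R z)
  also have "of_real (1 + (norm (R z))\<^sup>2) * C z - 2 * cnj (R z) * (R z * C z)
      = of_real ((1 - (norm (R z))\<^sup>2) / (1 - (norm z)\<^sup>2))"
  proof -
    have "C z = of_real (1 / (1 - (norm z)\<^sup>2))"
      unfolding C_def szego_kernel_def by (simp add: complex_norm_square mult.commute del: of_real_power)
    moreover have "2 * cnj (R z) * (R z * C z) = of_real (2 * (norm (R z))\<^sup>2) * C z"
      unfolding of_real_mult complex_norm_square by simp
    ultimately have "of_real (1 + (norm (R z))\<^sup>2) * C z - 2 * cnj (R z) * (R z * C z)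
        = of_real ((1 + (norm (R z))\<^sup>2) * (1 / (1 - (norm z)\<^sup>2)) - 2 * (norm (R z))\<^sup>2 * (1 / (1 - (norm z)\<^sup>2)))"
      by (simp only: of_real_mult of_real_diff)
    also have "(1 + (norm (R z))\<^sup>2) * (1 / (1 - (norm z)\<^sup>2)) - 2 * (norm (R z))\<^sup>2 * (1 / (1 - (norm z)\<^sup>2))
        = (1 - (norm (R z))\<^sup>2) / (1 - (norm z)\<^sup>2)"
      by (simp add: add_divide_distrib diff_divide_distrib algebra_simps)
    finally show ?thesis .
  qed
  finally have "(E \<longlongrightarrow> (1 - (norm (R z))\<^sup>2) / (1 - (norm z)\<^sup>2)) (at_left 1)" by simp
  hence "((\<lambda>r. M * sqrt (E r)) \<longlongrightarrow> M * sqrt ((1 - (norm (R z))\<^sup>2) / (1 - (norm z)\<^sup>2))) (at_left 1)"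
    by (intro tendsto_intros)
  note E_lim = this
  show ?thesis
  proof (rule tendsto_le[OF _ E_lim tendsto_norm[OF elim]])
    show "\<forall>\<^sub>F r in at_left 1. norm (circle_inner f e r) \<le> M * sqrt (E r)"
      using bound by (intro eventually_at_leftI[of 0]) auto
  qed simp
qed

section \<open>Blaschke products\<close>

definition blaschke_factor :: "complex \<Rightarrow> complex \<Rightarrow> complex" where
  "blaschke_factor a z = cnj a / of_real (norm a) * ((a - z) / (1 - cnj a * z))"

lemma blaschke_factor_holomorphic:
  assumes "norm a < 1" shows "blaschke_factor a holomorphic_on unit_disc"
  unfolding blaschke_factor_def[abs_def]
  using one_minus_cnj_mult_ne_0[OF assms]
  by (intro holomorphic_intros) (auto simp: less_imp_le)

lemma norm_blaschke_factor:
  assumes "a \<noteq> 0"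
  shows "norm (blaschke_factor a z) = pseudohyperbolic z a"
  using assms by (simp add: blaschke_factor_def pseudohyperbolic_def norm_mult norm_divide norm_minus_commute)

lemma one_minus_norm_blaschke_factor_sq_le:
  assumes "a \<noteq> 0" "norm a < 1" "norm z < 1"
  shows "1 - (norm (blaschke_factor a z))\<^sup>2 \<le> (1 - (norm a)\<^sup>2) * ((1 + norm z) / (1 - norm z))"
proof -
  have d: "1 - norm z > 0" using assms by simp
  have a: "1 - (norm a)\<^sup>2 \<ge> 0" using assms by (simp add: power_le_one)
  have "1 - (norm (blaschke_factor a z))\<^sup>2 = (1 - (norm z)\<^sup>2) * (1 - (norm a)\<^sup>2) / (norm (1 - cnj a * z))\<^sup>2"
    unfolding norm_blaschke_factor[OF assms(1)] one_minus_pseudohyperbolic_sq[OF assms(3,2)] ..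
  also have "\<dots> \<le> (1 - (norm z)\<^sup>2) * (1 - (norm a)\<^sup>2) / (1 - norm z)\<^sup>2"
  proof (rule divide_left_mono)
    show "(1 - norm z)\<^sup>2 \<le> (norm (1 - cnj a * z))\<^sup>2"
      using norm_one_minus_cnj_ge[of a z] assms by (intro power_mono) auto
    show "0 \<le> (1 - (norm z)\<^sup>2) * (1 - (norm a)\<^sup>2)"
      using a assms by (intro mult_nonneg_nonneg) (auto simp: power_le_one)
    show "0 < (norm (1 - cnj a * z))\<^sup>2 * (1 - norm z)\<^sup>2"
      using norm_one_minus_cnj_ge[of a z] assms d by (intro mult_pos_pos zero_less_power) auto
  qed
  also have "1 - (norm z)\<^sup>2 = (1 + norm z) * (1 - norm z)" by (simp add: power2_eq_square algebra_simps)
  also have "(1 + norm z) * (1 - norm z) * (1 - (norm a)\<^sup>2) / (1 - norm z)\<^sup>2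
      = (1 - (norm a)\<^sup>2) * ((1 + norm z) / (1 - norm z))"
    using d by (simp add: power2_eq_square)
  finally show ?thesis .
qed

text \<open>The numerator of \<open>1 - blaschke_factor a z\<close> contains the factor \<open>1 - |a|\<close>; this is where the
  normalisation by \<open>cnj a / |a|\<close> matters.\<close>

lemma norm_one_minus_blaschke_factor_le:
  assumes "a \<noteq> 0" "norm a < 1" "norm z < 1"
  shows "norm (blaschke_factor a z - 1) \<le> (1 - norm a) * (2 / (1 - norm z))"
proof -
  define A where "A = complex_of_real (norm a)"
  have A0: "A \<noteq> 0" and AA: "A * A = a * cnj a"
    using assms complex_norm_square[of a] by (auto simp: A_def power2_eq_square)
  have ne: "1 - cnj a * z \<noteq> 0" using one_minus_cnj_mult_ne_0[of a z] assms by simp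
  have "blaschke_factor a z - 1 = (cnj a * (a - z) - A * (1 - cnj a * z)) / (A * (1 - cnj a * z))"
  proof -
    have "x / A * (y / d) - 1 = (x * y - A * d) / (A * d)" if "d \<noteq> 0" for x y d
      using that A0 by (simp add: diff_divide_distrib)
    from this[OF ne] show ?thesis unfolding blaschke_factor_def A_def[symmetric] .
  qed
  also have "cnj a * (a - z) - A * (1 - cnj a * z) = - ((1 - A) * (A + cnj a * z))"
    using AA by (simp add: algebra_simps)
  finally have "norm (blaschke_factor a z - 1)
      = norm (1 - A) * norm (A + cnj a * z) / (norm a * norm (1 - cnj a * z))"
    by (simp add: norm_mult norm_divide A_def)
  also have "norm (1 - A) = 1 - norm a"
    using assms norm_of_real[of "1 - norm a", where ?'a = complex] unfolding A_def by simp
  also have "norm (A + cnj a * z) \<le> norm a * 2"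
  proof -
    have "norm (A + cnj a * z) \<le> norm a + norm a * norm z"
      using norm_triangle_ineq[of A "cnj a * z"] by (simp add: A_def norm_mult)
    also have "norm a * norm z \<le> norm a" using assms by (intro mult_left_le) auto
    finally show ?thesis by simp
  qed
  hence "(1 - norm a) * norm (A + cnj a * z) / (norm a * norm (1 - cnj a * z))
      \<le> (1 - norm a) * (norm a * 2) / (norm a * norm (1 - cnj a * z))"
    using assms by (intro divide_right_mono mult_left_mono) auto
  also have "\<dots> = (1 - norm a) * (2 / norm (1 - cnj a * z))" using assms by simp
  also have "\<dots> \<le> (1 - norm a) * (2 / (1 - norm z))"
    using assms norm_one_minus_cnj_ge[of a z] by (intro mult_left_mono divide_left_mono mult_pos_pos) auto
  finally show ?thesis by simp
qed

lemma one_minus_prod_le_sum: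
  fixes x :: "'i \<Rightarrow> real"
  assumes "finite I" "\<And>i. i \<in> I \<Longrightarrow> 0 \<le> x i \<and> x i \<le> 1"
  shows "1 - (\<Prod>i\<in>I. x i) \<le> (\<Sum>i\<in>I. 1 - x i)"
  using assms
proof (induction I)
  case (insert j I)
  have p: "0 \<le> (\<Prod>i\<in>I. x i)" "(\<Prod>i\<in>I. x i) \<le> 1"
    using insert by (auto intro!: prod_nonneg prod_le_1)
  have "1 - x j * (\<Prod>i\<in>I. x i) = (1 - x j) + x j * (1 - (\<Prod>i\<in>I. x i))" by (simp add: algebra_simps)
  also have "x j * (1 - (\<Prod>i\<in>I. x i)) \<le> 1 - (\<Prod>i\<in>I. x i)"
    using p insert.prems[of j] by (intro mult_left_le_one_le) auto
  also have "1 - (\<Prod>i\<in>I. x i) \<le> (\<Sum>i\<in>I. 1 - x i)" using insert by auto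
  finally show ?case using insert by simp
qed simp

lemma blaschke_sequence_square_summable:
  assumes "blaschke_sequence a"
  shows "summable (\<lambda>n. 1 - (norm (a n))\<^sup>2)"
proof (rule summable_comparison_test[OF _ summable_mult[of "\<lambda>n. 1 - norm (a n)" 2]])
  show "summable (\<lambda>n. 1 - norm (a n))" using assms by (simp add: blaschke_sequence_def)
  have "norm (1 - (norm (a n))\<^sup>2) \<le> 2 * (1 - norm (a n))" for n
  proof -
    have "0 < norm (a n)" "norm (a n) < 1" using assms by (auto simp: blaschke_sequence_def)
    moreover have "1 - (norm (a n))\<^sup>2 = (1 + norm (a n)) * (1 - norm (a n))"
      by (simp add: power2_eq_square algebra_simps)
    moreover have "(1 + norm (a n)) * (1 - norm (a n)) \<le> 2 * (1 - norm (a n))"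
      using calculation by (intro mult_right_mono) auto
    moreover have "0 \<le> (1 + norm (a n)) * (1 - norm (a n))" using calculation by simp
    ultimately show ?thesis by simp
  qed
  thus "\<exists>N. \<forall>n\<ge>N. norm (1 - (norm (a n))\<^sup>2) \<le> 2 * (1 - norm (a n))" by blast
qed

lemma blaschke_product_limit:
  assumes a: "blaschke_sequence a" and z: "norm z < 1"
  shows "(\<lambda>n. \<Prod>i<n. blaschke_factor (a i) z) \<longlonglongrightarrow> blaschke_product a z"
proof -
  have a': "a n \<noteq> 0" "norm (a n) < 1" for n using a by (auto simp: blaschke_sequence_def)
  have "summable (\<lambda>n. norm (blaschke_factor (a n) z - 1))"
  proof (rule summable_comparison_test)
    show "summable (\<lambda>n. (1 - norm (a n)) * (2 / (1 - norm z)))"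
      using a by (intro summable_mult2) (auto simp: blaschke_sequence_def)
    show "\<exists>N. \<forall>n\<ge>N. norm (norm (blaschke_factor (a n) z - 1)) \<le> (1 - norm (a n)) * (2 / (1 - norm z))"
      using norm_one_minus_blaschke_factor_le[OF a' z] by auto
  qed
  hence "convergent_prod (\<lambda>n. blaschke_factor (a n) z)"
    by (intro abs_convergent_prod_imp_convergent_prod summable_imp_abs_convergent_prod)
  from convergent_prod_LIMSEQ[OF this]
  have "(\<lambda>n. \<Prod>i<Suc n. blaschke_factor (a i) z) \<longlonglongrightarrow> blaschke_product a z"
    by (simp only: lessThan_Suc_atMost blaschke_product_def blaschke_factor_def)
  thus ?thesis by (rule LIMSEQ_imp_Suc)
qed

lemma blaschke_product_holomorphic:
  assumes a: "blaschke_sequence a"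
  shows "blaschke_product a holomorphic_on unit_disc"
proof (rule holomorphic_uniform_sequence[where f = "\<lambda>n z. \<Prod>i<n. blaschke_factor (a i) z"])
  have a': "a n \<noteq> 0" "norm (a n) < 1" for n using a by (auto simp: blaschke_sequence_def)
  show "(\<lambda>z. \<Prod>i<n. blaschke_factor (a i) z) holomorphic_on unit_disc" for n
    using a' by (intro holomorphic_intros blaschke_factor_holomorphic) auto
  fix x :: complex assume x: "x \<in> unit_disc"
  define d where "d = (1 - norm x) / 2"
  have d: "d > 0" using x unfolding d_def by simp
  have r: "norm z \<le> (1 + norm x) / 2" if "z \<in> cball x d" for z
  proof -
    have "norm z \<le> norm x + norm (z - x)" using norm_triangle_ineq[of x "z - x"] by simp
    thus ?thesis using that unfolding d_def by (simp add: dist_norm norm_minus_commute field_simps)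
  qed
  have r1: "(1 + norm x) / 2 < 1" using x by simp
  have sub: "cball x d \<subseteq> unit_disc" using r r1 by force
  have "uniformly_convergent_on (cball x d) (\<lambda>n z. \<Prod>i<n. blaschke_factor (a i) z)"
  proof (rule uniformly_convergent_on_prod'[OF _ compact_cball])
    show "continuous_on (cball x d) (blaschke_factor (a n))" for n
      using sub a' by (intro holomorphic_on_imp_continuous_on
          holomorphic_on_subset[OF blaschke_factor_holomorphic]) auto
    show "uniformly_convergent_on (cball x d) (\<lambda>n z. \<Sum>i<n. norm (blaschke_factor (a i) z - 1))"
    proof (rule Weierstrass_m_test')
      fix n z assume z: "z \<in> cball x d"
      have z1: "norm z < 1" using r[OF z] r1 by simp
      have "norm (norm (blaschke_factor (a n) z - 1)) \<le> (1 - norm (a n)) * (2 / (1 - norm z))"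
        using norm_one_minus_blaschke_factor_le[OF a' z1] by simp
      also have "\<dots> \<le> (1 - norm (a n)) * (2 / (1 - (1 + norm x) / 2))"
        using r[OF z] r1 z1 a'(2)[of n] by (intro mult_left_mono divide_left_mono) auto
      finally show "norm (norm (blaschke_factor (a n) z - 1)) \<le> (1 - norm (a n)) * (2 / (1 - (1 + norm x) / 2))" .
    next
      show "summable (\<lambda>n. (1 - norm (a n)) * (2 / (1 - (1 + norm x) / 2)))"
        using a by (intro summable_mult2) (auto simp: blaschke_sequence_def)
    qed
  qed
  then obtain l where l: "uniform_limit (cball x d) (\<lambda>n z. \<Prod>i<n. blaschke_factor (a i) z) l sequentially"
    unfolding uniformly_convergent_on_def by blast
  have "l z = blaschke_product a z" if "z \<in> cball x d" for z
  proof (rule LIMSEQ_unique)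
    show "(\<lambda>n. \<Prod>i<n. blaschke_factor (a i) z) \<longlonglongrightarrow> l z" by (rule tendsto_uniform_limitI[OF l that])
    show "(\<lambda>n. \<Prod>i<n. blaschke_factor (a i) z) \<longlonglongrightarrow> blaschke_product a z"
      using that sub by (intro blaschke_product_limit[OF a]) auto
  qed
  hence "uniform_limit (cball x d) (\<lambda>n z. \<Prod>i<n. blaschke_factor (a i) z) (blaschke_product a) sequentially"
    using l uniform_limit_cong'[of "cball x d" "\<lambda>n z. \<Prod>i<n. blaschke_factor (a i) z"
        "\<lambda>n z. \<Prod>i<n. blaschke_factor (a i) z" l "blaschke_product a" sequentially] by auto
  with d sub show "\<exists>d>0. cball x d \<subseteq> unit_disc \<and>
      uniform_limit (cball x d) (\<lambda>n z. \<Prod>i<n. blaschke_factor (a i) z) (blaschke_product a) sequentially"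
    by blast
qed simp

lemma norm_blaschke_factor_le_1:
  assumes "a \<noteq> 0" "norm a < 1" "norm z < 1"
  shows "norm (blaschke_factor a z) \<le> 1"
  unfolding norm_blaschke_factor[OF assms(1)] by (rule pseudohyperbolic_bounds[OF assms(3,2)])

lemma norm_finite_blaschke_le_1:
  assumes "\<And>i. i \<in> I \<Longrightarrow> a i \<noteq> 0 \<and> norm (a i) < 1" "norm z < 1"
  shows "norm (\<Prod>i\<in>I. blaschke_factor (a i) z) \<le> 1"
  unfolding prod_norm[symmetric] using assms norm_blaschke_factor_le_1
  by (intro prod_le_1) auto

lemma norm_blaschke_product_le_1:
  assumes a: "blaschke_sequence a" and z: "norm z < 1"
  shows "norm (blaschke_product a z) \<le> 1"
proof (rule tendsto_upperbound[OF tendsto_norm[OF blaschke_product_limit[OF a z]]])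
  have "a n \<noteq> 0 \<and> norm (a n) < 1" for n using a by (auto simp: blaschke_sequence_def)
  thus "\<forall>\<^sub>F n in sequentially. norm (\<Prod>i<n. blaschke_factor (a i) z) \<le> 1"
    using norm_finite_blaschke_le_1[of _ a z] z by (intro always_eventually) auto
qed simp

text \<open>Applied to the tails of a Blaschke product, this is the rate at which they tend to modulus \<open>1\<close>.\<close>

lemma one_minus_norm_blaschke_product_sq_le:
  assumes a: "blaschke_sequence a" and z: "norm z < 1"
  shows "1 - (norm (blaschke_product a z))\<^sup>2
    \<le> (\<Sum>n. 1 - (norm (a n))\<^sup>2) * ((1 + norm z) / (1 - norm z))"
proof (rule tendsto_upperbound)
  have a': "a n \<noteq> 0" "norm (a n) < 1" for n using a by (auto simp: blaschke_sequence_def)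
  show "(\<lambda>n. 1 - (norm (\<Prod>i<n. blaschke_factor (a i) z))\<^sup>2) \<longlonglongrightarrow> 1 - (norm (blaschke_product a z))\<^sup>2"
    by (intro tendsto_intros blaschke_product_limit a z)
  have "1 - (norm (\<Prod>i<n. blaschke_factor (a i) z))\<^sup>2
      \<le> (\<Sum>n. 1 - (norm (a n))\<^sup>2) * ((1 + norm z) / (1 - norm z))" for n
  proof -
    have "1 - (norm (\<Prod>i<n. blaschke_factor (a i) z))\<^sup>2 = 1 - (\<Prod>i<n. (norm (blaschke_factor (a i) z))\<^sup>2)"
      by (simp add: prod_norm[symmetric] prod_power_distrib)
    also have "\<dots> \<le> (\<Sum>i<n. 1 - (norm (blaschke_factor (a i) z))\<^sup>2)"
      using norm_blaschke_factor_le_1[OF a' z] by (intro one_minus_prod_le_sum) (auto simp: power_le_one)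
    also have "\<dots> \<le> (\<Sum>i<n. (1 - (norm (a i))\<^sup>2) * ((1 + norm z) / (1 - norm z)))"
      by (intro sum_mono one_minus_norm_blaschke_factor_sq_le a' z)
    also have "\<dots> = (\<Sum>i<n. 1 - (norm (a i))\<^sup>2) * ((1 + norm z) / (1 - norm z))"
      by (simp only: sum_distrib_right)
    also have "\<dots> \<le> (\<Sum>n. 1 - (norm (a n))\<^sup>2) * ((1 + norm z) / (1 - norm z))"
      using z a'(2) by (intro mult_right_mono sum_le_suminf blaschke_sequence_square_summable[OF a])
        (auto simp: power_le_one less_imp_le)
    finally show ?thesis .
  qed
  thus "\<forall>\<^sub>F n in sequentially. 1 - (norm (\<Prod>i<n. blaschke_factor (a i) z))\<^sup>2
      \<le> (\<Sum>n. 1 - (norm (a n))\<^sup>2) * ((1 + norm z) / (1 - norm z))"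
    by (intro always_eventually) auto
qed simp

lemma blaschke_sequence_shift:
  "blaschke_sequence a \<Longrightarrow> blaschke_sequence (\<lambda>n. a (n + N))"
  unfolding blaschke_sequence_def using summable_ignore_initial_segment[of "\<lambda>n. 1 - norm (a n)" N] by auto

lemma blaschke_product_split:
  assumes a: "blaschke_sequence a" and z: "norm z < 1"
  shows "blaschke_product a z
    = (\<Prod>i<N. blaschke_factor (a i) z) * blaschke_product (\<lambda>n. a (n + N)) z"
proof (rule LIMSEQ_unique)
  show "(\<lambda>n. \<Prod>i<n + N. blaschke_factor (a i) z) \<longlonglongrightarrow> blaschke_product a z"
    by (rule LIMSEQ_ignore_initial_segment[OF blaschke_product_limit[OF a z]])
  have "(\<Prod>i<n + N. blaschke_factor (a i) z)
      = (\<Prod>i<N. blaschke_factor (a i) z) * (\<Prod>i<n. blaschke_factor (a (i + N)) z)" for n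
    by (induction n) (auto simp: mult_ac add.commute)
  thus "(\<lambda>n. \<Prod>i<n + N. blaschke_factor (a i) z)
      \<longlonglongrightarrow> (\<Prod>i<N. blaschke_factor (a i) z) * blaschke_product (\<lambda>n. a (n + N)) z"
    using tendsto_mult[OF tendsto_const blaschke_product_limit[OF blaschke_sequence_shift[OF a] z]]
    by simp
qed

section \<open>Partial fractions for the kernel of a finite Blaschke product\<close>

text \<open>Chosen so that \<open>dual_function a N n\<close> below takes the value \<open>1\<close> at \<open>a n\<close>.\<close>

definition dual_coeff :: "(nat \<Rightarrow> complex) \<Rightarrow> nat \<Rightarrow> nat \<Rightarrow> complex" where
  "dual_coeff a N n = of_real (1 - (norm (a n))\<^sup>2) / (\<Prod>m\<in>{..<N} - {n}. blaschke_factor (a m) (a n))"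

text \<open>The element of the model space of the first \<open>N\<close> factors that is \<open>1\<close> at \<open>a n\<close> and \<open>0\<close> at the other
  \<open>a m\<close> with \<open>m < N\<close>: the Lagrange basis, biorthogonal to the kernels of the points \<open>a m\<close>.\<close>

definition dual_function :: "(nat \<Rightarrow> complex) \<Rightarrow> nat \<Rightarrow> nat \<Rightarrow> complex \<Rightarrow> complex" where
  "dual_function a N n w
     = dual_coeff a N n * (\<Prod>m\<in>{..<N} - {n}. blaschke_factor (a m) w) / (1 - cnj (a n) * w)"

lemma dual_function_holomorphic:
  assumes "\<And>m. norm (a m) < 1"
  shows "dual_function a N n holomorphic_on unit_disc"
  unfolding dual_function_def[abs_def]
  using assms one_minus_cnj_mult_ne_0[of "a n"]
  by (intro holomorphic_intros blaschke_factor_holomorphic) (auto simp: less_imp_le)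

lemma dual_function_bound:
  assumes a: "\<And>m. a m \<noteq> 0 \<and> norm (a m) < 1" and w: "norm w < 1"
  shows "norm (dual_function a N n w) \<le> norm (dual_coeff a N n) * (1 / (1 - norm (a n)))"
proof -
  have "1 - norm (a n) \<le> norm (1 - cnj (a n) * w)"
    using norm_one_minus_cnj_ge[of w "a n"] a[of n] w
    by (simp add: norm_one_minus_cnj_commute[of "a n" w])
  moreover have "norm (\<Prod>m\<in>{..<N} - {n}. blaschke_factor (a m) w) \<le> 1"
    using a w by (intro norm_finite_blaschke_le_1) auto
  ultimately have "norm (dual_coeff a N n) * (norm (\<Prod>m\<in>{..<N} - {n}. blaschke_factor (a m) w)
        / norm (1 - cnj (a n) * w)) \<le> norm (dual_coeff a N n) * (1 / (1 - norm (a n)))"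
    using a by (intro mult_left_mono frac_le) auto
  thus ?thesis unfolding dual_function_def by (simp add: norm_mult norm_divide)
qed

lemma norm_dual_coeff_le:
  assumes sep: "finitely_separated a \<delta>" and a: "\<And>m. a m \<noteq> 0 \<and> norm (a m) < 1"
  shows "norm (dual_coeff a N n) \<le> (1 - (norm (a n))\<^sup>2) / \<delta>"
proof -
  have \<delta>: "\<delta> > 0" "\<delta> \<le> (\<Prod>m\<in>{..<N} - {n}. pseudohyperbolic (a m) (a n))"
    using sep unfolding finitely_separated_def by auto
  have D: "1 - (norm (a n))\<^sup>2 \<ge> 0" using a[of n] by (simp add: power_le_one)
  have "norm (\<Prod>m\<in>{..<N} - {n}. blaschke_factor (a m) (a n))
      = (\<Prod>m\<in>{..<N} - {n}. pseudohyperbolic (a m) (a n))"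
    unfolding prod_norm[symmetric] using a
    by (intro prod.cong refl) (simp add: norm_blaschke_factor pseudohyperbolic_commute)
  hence "norm (dual_coeff a N n)
      = (1 - (norm (a n))\<^sup>2) / (\<Prod>m\<in>{..<N} - {n}. pseudohyperbolic (a m) (a n))"
    using D unfolding dual_coeff_def norm_divide norm_of_real by simp
  also have "\<dots> \<le> (1 - (norm (a n))\<^sup>2) / \<delta>" using D \<delta> by (intro divide_left_mono mult_pos_pos) auto
  finally show ?thesis .
qed

text \<open>The full product divided by the \<open>n\<close>-th factor is, up to a constant, the full product over
  \<open>w - a n\<close>. On circles near the boundary the product drops out of norm estimates, and a
  combination of dual functions becomes a combination of Cauchy kernels.\<close>

lemma dual_function_eq_cauchy:
  assumes a: "\<And>m. a m \<noteq> 0 \<and> norm (a m) < 1" and n: "n < N" and w: "norm w < 1" "w \<noteq> a n"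
  shows "dual_function a N n w = (\<Prod>m<N. blaschke_factor (a m) w) *
    (- (dual_coeff a N n * of_real (norm (a n)) / cnj (a n)) / (w - a n))"
proof -
  have ne: "1 - cnj (a n) * w \<noteq> 0" using one_minus_cnj_mult_ne_0[of "a n" w] a w by auto
  define X where "X = - (dual_coeff a N n * of_real (norm (a n)) / cnj (a n)) / (w - a n)"
  have eq1: "(\<Prod>m<N. blaschke_factor (a m) w)
      = blaschke_factor (a n) w * (\<Prod>m\<in>{..<N} - {n}. blaschke_factor (a m) w)"
    using n by (intro prod.remove) auto
  have eq2: "blaschke_factor (a n) w * X = dual_coeff a N n / (1 - cnj (a n) * w)"
    unfolding blaschke_factor_def X_def using a[of n] w ne
    by (simp add: divide_simps) (simp add: algebra_simps)
  have "(\<Prod>m<N. blaschke_factor (a m) w) * X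
      = (\<Prod>m\<in>{..<N} - {n}. blaschke_factor (a m) w) * (blaschke_factor (a n) w * X)"
    by (simp only: eq1 mult_ac)
  also have "\<dots> = dual_function a N n w" unfolding eq2 dual_function_def by simp
  finally show ?thesis unfolding X_def ..
qed

text \<open>Multiplied by \<open>1 - cnj z * w\<close> and by the product of the \<open>1 - cnj (a m) * w\<close>, the difference of the
  two sides is a polynomial \<open>Q\<close> in \<open>w\<close> of degree at most \<open>N\<close>. It vanishes at the \<open>N\<close> points \<open>a n\<close>, where
  both sides equal \<open>1 / (1 - cnj z * a n)\<close>, and at \<open>1 / cnj z\<close>, because a finite Blaschke product takes
  reflected values at points reflected in the circle. So \<open>Q\<close> has too many zeros. For \<open>z = 0\<close> the
  last zero escapes to infinity; that case follows by continuity in \<open>z\<close>.\<close>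

lemma finite_blaschke_kernel_nonzero:
  fixes a :: "nat \<Rightarrow> complex"
  assumes a: "\<And>m. a m \<noteq> 0 \<and> norm (a m) < 1" and inj: "inj a"
    and z: "norm z < 1" "z \<noteq> 0" and w: "norm w < 1"
  shows "(1 - cnj (\<Prod>m<N. blaschke_factor (a m) z) * (\<Prod>m<N. blaschke_factor (a m) w)) / (1 - cnj z * w)
    = (\<Sum>n<N. 1 / (1 - a n * cnj z) * dual_function a N n w)"
proof -
  define u where "u = (\<lambda>m. cnj (a m) / of_real (norm (a m)))"
  define num where "num = (\<lambda>m. smult (u m) [:a m, -1:])"
  define den where "den = (\<lambda>m. [:1, - cnj (a m):])"
  define b where "b = cnj (\<Prod>m<N. blaschke_factor (a m) z)"
  define c where "c = (\<lambda>n. dual_coeff a N n * (1 / (1 - a n * cnj z)))"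
  define S where "S = (\<Sum>n<N. smult (c n) (\<Prod>m\<in>{..<N} - {n}. num m))"
  define Q where "Q = (\<Prod>m<N. den m) - smult b (\<Prod>m<N. num m) - [:1, - cnj z:] * S"
  have a1: "norm (a m) < 1" "a m \<noteq> 0" for m using a by auto
  have bf: "blaschke_factor (a m) x = poly (num m) x / poly (den m) x" for m x
  proof -
    have "poly (num m) x = u m * (a m - x)" "poly (den m) x = 1 - cnj (a m) * x"
      unfolding num_def den_def by (simp_all add: algebra_simps)
    thus ?thesis unfolding blaschke_factor_def u_def by simp
  qed
  have den0: "poly (den m) x \<noteq> 0" if "norm x < 1" for m x
    using one_minus_cnj_mult_ne_0[of "a m" x] a1 that unfolding den_def by (simp add: mult_ac)
  have uu: "u m * cnj (u m) = 1" for m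
  proof -
    have "u m * cnj (u m) = of_real ((norm (u m))\<^sup>2)" by (rule complex_norm_square[symmetric])
    also have "norm (u m) = 1" using a1(2)[of m] unfolding u_def by (simp add: norm_divide)
    finally show ?thesis by simp
  qed
  have zn: "1 - a n * cnj z \<noteq> 0" for n
    using one_minus_cnj_mult_ne_0[of z "a n"] z a1[of n] by (auto simp: less_imp_le mult.commute)
  have wz: "1 - cnj z * w \<noteq> 0" using one_minus_cnj_mult_ne_0[of z w] z w by auto
  have prodnz: "(\<Prod>m\<in>{..<N} - {n}. blaschke_factor (a m) (a n)) \<noteq> 0" for n
  proof -
    have "blaschke_factor (a m) (a n) \<noteq> 0" if "m \<noteq> n" for m
    proof -
      have "a m \<noteq> a n" using inj that by (auto dest: injD)
      moreover have "1 - cnj (a m) * a n \<noteq> 0" using one_minus_cnj_mult_ne_0[of "a m" "a n"] a1 by (auto simp: less_imp_le)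
      ultimately show ?thesis using a1[of m] unfolding blaschke_factor_def by simp
    qed
    thus ?thesis by (intro notI) (auto simp: prod_zero_iff)
  qed
  have degnum: "degree (num m) \<le> 1" for m unfolding num_def
    by (rule order.trans[OF degree_smult_le]) simp
  have degden: "degree (den m) \<le> 1" for m unfolding den_def by simp
  have degprod: "degree (\<Prod>m\<in>A. p m) \<le> card A" if "\<And>m. degree (p m) \<le> 1" "finite A"
    for A and p :: "nat \<Rightarrow> complex poly"
  proof -
    have "degree (\<Prod>m\<in>A. p m) \<le> sum (degree \<circ> p) A" by (rule degree_prod_sum_le[OF that(2)])
    also have "\<dots> \<le> (\<Sum>m\<in>A. 1)" using that(1) by (intro sum_mono) auto
    finally show ?thesis by simp
  qed
  have degS: "degree ([:1, - cnj z:] * S) \<le> N"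
  proof (cases "N = 0")
    case True thus ?thesis by (simp add: S_def)
  next
    case False
    have "degree S \<le> N - 1" unfolding S_def
    proof (rule degree_sum_le)
      fix n assume "n \<in> {..<N}"
      hence "card ({..<N} - {n}) = N - 1" by simp
      thus "degree (smult (c n) (\<Prod>m\<in>{..<N} - {n}. num m)) \<le> N - 1"
        using degprod[of num "{..<N} - {n}", OF degnum] order.trans[OF degree_smult_le] by auto
    qed auto
    hence "degree [:1, - cnj z:] + degree S \<le> 1 + (N - 1)" by (intro add_mono) auto
    with degree_mult_le[of "[:1, - cnj z:]" S] False show ?thesis by linarith
  qed
  have deg: "degree Q \<le> N" unfolding Q_def
  proof (intro degree_diff_le degS)
    show "degree (\<Prod>m<N. den m) \<le> N" using degprod[of den "{..<N}", OF degden] by simp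
    show "degree (smult b (\<Prod>m<N. num m)) \<le> N"
      using degprod[of num "{..<N}", OF degnum] order.trans[OF degree_smult_le] by simp
  qed
  have root_a: "poly Q (a k) = 0" if k: "k < N" for k
  proof -
    have num_k: "poly (num k) (a k) = 0" unfolding num_def by simp
    have "poly S (a k) = (\<Sum>n<N. c n * (\<Prod>m\<in>{..<N} - {n}. poly (num m) (a k)))"
      unfolding S_def by (simp add: poly_sum poly_prod)
    also have "\<dots> = c k * (\<Prod>m\<in>{..<N} - {k}. poly (num m) (a k))"
    proof -
      have zero: "(\<Prod>m\<in>{..<N} - {n}. poly (num m) (a k)) = 0" if "n \<in> {..<N} - {k}" for n
        using that k num_k by (intro prod_zero) auto
      have "(\<Sum>n<N. c n * (\<Prod>m\<in>{..<N} - {n}. poly (num m) (a k)))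
          = (\<Sum>n\<in>{k}. c n * (\<Prod>m\<in>{..<N} - {n}. poly (num m) (a k)))"
      proof (rule sum.mono_neutral_right)
        show "\<forall>n\<in>{..<N} - {k}. c n * (\<Prod>m\<in>{..<N} - {n}. poly (num m) (a k)) = 0"
          by (intro ballI) (simp only: zero mult_zero_right)
      qed (use k in auto)
      thus ?thesis by simp
    qed
    also have "(\<Prod>m\<in>{..<N} - {k}. poly (num m) (a k))
        = (\<Prod>m\<in>{..<N} - {k}. blaschke_factor (a m) (a k)) * (\<Prod>m\<in>{..<N} - {k}. poly (den m) (a k))"
      unfolding prod.distrib[symmetric] bf using den0[OF a1(1)] by (intro prod.cong) auto
    finally have "(1 - cnj z * a k) * poly S (a k)
        = of_real (1 - (norm (a k))\<^sup>2) * (\<Prod>m\<in>{..<N} - {k}. poly (den m) (a k))"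
      using prodnz[of k] zn[of k] unfolding c_def dual_coeff_def by (simp add: mult_ac)
    also have "of_real (1 - (norm (a k))\<^sup>2) = poly (den k) (a k)"
      unfolding den_def of_real_diff complex_norm_square by (simp add: mult_ac)
    also have "poly (den k) (a k) * (\<Prod>m\<in>{..<N} - {k}. poly (den m) (a k)) = (\<Prod>m<N. poly (den m) (a k))"
      using k by (intro prod.remove[symmetric]) auto
    finally have "(1 - cnj z * a k) * poly S (a k) = (\<Prod>m<N. poly (den m) (a k))" .
    moreover have "(\<Prod>m<N. poly (num m) (a k)) = 0" using k num_k by (intro prod_zero) auto
    ultimately show ?thesis unfolding Q_def by (simp add: poly_prod algebra_simps)
  qed
  have root_z: "poly Q (1 / cnj z) = 0"
  proof -
    have "b * (\<Prod>m<N. poly (num m) (1 / cnj z)) = (\<Prod>m<N. poly (den m) (1 / cnj z))"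
      unfolding b_def cnj_prod prod.distrib[symmetric]
    proof (intro prod.cong refl)
      fix m
      have "cnj (blaschke_factor (a m) z) * (1 - a m * cnj z) = cnj (u m) * (cnj (a m) - cnj z)"
        unfolding blaschke_factor_def u_def using zn[of m] by simp
      moreover have "poly (num m) (1 / cnj z) = - (u m * (1 - a m * cnj z) / cnj z)"
        unfolding num_def using z(2) by (simp add: field_simps)
      ultimately have "cnj (blaschke_factor (a m) z) * poly (num m) (1 / cnj z)
          = - (u m * cnj (u m)) * (cnj (a m) - cnj z) / cnj z"
        by (simp add: mult_ac)
      also have "\<dots> = poly (den m) (1 / cnj z)"
        unfolding uu den_def using z(2) by (simp add: field_simps)
      finally show "cnj (blaschke_factor (a m) z) * poly (num m) (1 / cnj z) = poly (den m) (1 / cnj z)" .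
    qed
    thus ?thesis unfolding Q_def using z(2) by (simp add: poly_prod)
  qed
  have "Q = 0"
  proof (rule ccontr)
    assume Q: "Q \<noteq> 0"
    have "1 / cnj z \<notin> a ` {..<N}"
    proof
      assume "1 / cnj z \<in> a ` {..<N}"
      then obtain m where "1 / cnj z = a m" by auto
      hence "norm (1 / cnj z) < 1" using a1 by simp
      thus False using z by (simp add: norm_divide)
    qed
    hence "card (insert (1 / cnj z) (a ` {..<N})) = Suc N"
      using inj by (simp add: card_image inj_on_subset)
    moreover have "insert (1 / cnj z) (a ` {..<N}) \<subseteq> {x. poly Q x = 0}"
      using root_a root_z by auto
    hence "card (insert (1 / cnj z) (a ` {..<N})) \<le> card {x. poly Q x = 0}"
      by (intro card_mono poly_roots_finite Q)
    moreover have "card {x. poly Q x = 0} \<le> degree Q" by (rule card_poly_roots_bound[OF Q])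
    ultimately show False using deg by simp
  qed
  hence "poly Q w = 0" by simp
  hence *: "(\<Prod>m<N. poly (den m) w) - b * (\<Prod>m<N. poly (num m) w) = (1 - cnj z * w) * poly S w"
    unfolding Q_def by (simp add: poly_prod algebra_simps)
  define DD where "DD = (\<Prod>m<N. poly (den m) w)"
  have DD: "DD \<noteq> 0" unfolding DD_def using den0[OF w] by simp
  have Pw: "(\<Prod>m<N. blaschke_factor (a m) w) = (\<Prod>m<N. poly (num m) w) / DD"
    unfolding bf DD_def by (rule prod_dividef)
  have Sw: "poly S w / DD = (\<Sum>n<N. 1 / (1 - a n * cnj z) * dual_function a N n w)"
  proof -
    have "poly S w / DD = (\<Sum>n<N. c n * (\<Prod>m\<in>{..<N} - {n}. poly (num m) w) / DD)"
      unfolding S_def by (simp add: poly_sum poly_prod sum_divide_distrib)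
    also have "\<dots> = (\<Sum>n<N. 1 / (1 - a n * cnj z) * dual_function a N n w)"
    proof (intro sum.cong refl)
      fix n assume n: "n \<in> {..<N}"
      have "DD = poly (den n) w * (\<Prod>m\<in>{..<N} - {n}. poly (den m) w)"
        unfolding DD_def using n by (intro prod.remove) auto
      moreover have "poly (den n) w = 1 - cnj (a n) * w" unfolding den_def by (simp add: mult_ac)
      ultimately show "c n * (\<Prod>m\<in>{..<N} - {n}. poly (num m) w) / DD
          = 1 / (1 - a n * cnj z) * dual_function a N n w"
        unfolding dual_function_def c_def bf prod_dividef by simp
    qed
    finally show ?thesis .
  qed
  have "(1 - b * (\<Prod>m<N. blaschke_factor (a m) w)) * DD = (1 - cnj z * w) * poly S w"
    using * DD unfolding Pw DD_def[symmetric] by (simp add: algebra_simps)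
  hence "(1 - b * (\<Prod>m<N. blaschke_factor (a m) w)) / (1 - cnj z * w) = poly S w / DD"
    using DD wz by (simp add: field_simps)
  thus ?thesis unfolding Sw b_def .
qed

lemma finite_blaschke_kernel:
  fixes a :: "nat \<Rightarrow> complex"
  assumes a: "\<And>m. a m \<noteq> 0 \<and> norm (a m) < 1" and inj: "inj a"
    and z: "norm z < 1" and w: "norm w < 1"
  shows "(1 - cnj (\<Prod>m<N. blaschke_factor (a m) z) * (\<Prod>m<N. blaschke_factor (a m) w)) / (1 - cnj z * w)
    = (\<Sum>n<N. 1 / (1 - a n * cnj z) * dual_function a N n w)"
proof (cases "z = 0")
  case False thus ?thesis using finite_blaschke_kernel_nonzero[OF a inj z _ w] by simp
next
  case True
  define F where "F = (\<lambda>z. (1 - cnj (\<Prod>m<N. blaschke_factor (a m) z) * (\<Prod>m<N. blaschke_factor (a m) w))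
      / (1 - cnj z * w) - (\<Sum>n<N. 1 / (1 - a n * cnj z) * dual_function a N n w))"
  have "isCont (blaschke_factor (a m)) 0" for m
  proof -
    have "continuous_on unit_disc (blaschke_factor (a m))"
      using a by (intro holomorphic_on_imp_continuous_on blaschke_factor_holomorphic) auto
    thus ?thesis by (rule continuous_on_interior) auto
  qed
  hence "isCont F 0" unfolding F_def by (intro continuous_intros) auto
  hence lim: "(F \<longlongrightarrow> F 0) (at 0)" by (simp add: isCont_def)
  have "F z = 0" if "z \<noteq> 0" "dist z 0 < 1" for z
    using finite_blaschke_kernel_nonzero[OF a inj _ that(1) w] that unfolding F_def by simp
  hence "\<forall>\<^sub>F z in at 0. F z = 0" unfolding eventually_at by (intro exI[of _ 1]) auto
  hence "(F \<longlongrightarrow> 0) (at 0)" by (rule tendsto_eventually)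
  with lim have "F 0 = 0" by (rule LIM_unique)
  thus ?thesis unfolding F_def True by simp
qed

section \<open>The Bessel inequality for the dual system\<close>

lemma eventually_circle_beyond_points:
  assumes "finite I" "\<And>i. i \<in> I \<Longrightarrow> norm (a i) < 1"
  shows "\<forall>\<^sub>F r in at_left (1::real). 0 < r \<and> r < 1 \<and> (\<forall>i\<in>I. norm (a i) < r)"
proof -
  have "\<forall>\<^sub>F r in at_left 1. \<forall>i\<in>I. norm (a i) < r"
  proof (rule eventually_ball_finite[OF assms(1)], rule ballI)
    fix i assume "i \<in> I"
    from eventually_at_left_real[OF assms(2)[OF this]]
    show "\<forall>\<^sub>F r in at_left 1. norm (a i) < r" by eventually_elim auto
  qed
  moreover have "\<forall>\<^sub>F r in at_left (1::real). r \<in> {0<..<1}" by (rule eventually_at_left_real) simp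
  ultimately show ?thesis by eventually_elim auto
qed

text \<open>The squared norm in the Hardy space of the exterior of a sum of Cauchy kernels is the Cauchy form.\<close>

lemma cauchy_sum_mean_limit:
  fixes x a :: "'i \<Rightarrow> complex"
  assumes fin: "finite I" and a: "\<And>i. i \<in> I \<Longrightarrow> norm (a i) < 1"
  shows "((\<lambda>r. hardy2_mean (\<lambda>w. \<Sum>i\<in>I. x i / (w - a i)) r) \<longlongrightarrow>
    sqrt (norm (\<Sum>i\<in>I. \<Sum>j\<in>I. x i * cnj (x j) / (1 - a i * cnj (a j))))) (at_left 1)"
proof -
  define h where "h = (\<lambda>w. \<Sum>i\<in>I. x i / (w - a i))"
  have "\<forall>\<^sub>F r in at_left (1::real). 0 < r \<and> r < 1 \<and> (\<forall>i\<in>I. norm (a i) < r)"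
    by (rule eventually_circle_beyond_points[OF fin a])
  hence ev: "\<forall>\<^sub>F r in at_left 1. sqrt (norm (\<Sum>i\<in>I. \<Sum>j\<in>I. x i * cnj (x j) / (of_real (r\<^sup>2) - a i * cnj (a j))))
      = hardy2_mean h r"
  proof eventually_elim
    case (elim r)
    have c: "continuous_on (sphere 0 r) (\<lambda>w. 1 / (w - a i))" if "i \<in> I" for i
      using elim that by (intro continuous_intros) auto
    have h': "h = (\<lambda>w. \<Sum>i\<in>I. x i * (1 / (w - a i)))" unfolding h_def by simp
    have hc: "continuous_on (sphere 0 r) h" unfolding h'
      by (intro continuous_on_sum continuous_on_mult continuous_on_const c)
    have "of_real ((hardy2_mean h r)\<^sup>2) = circle_inner h h r"
      using elim by (intro circle_inner_self[symmetric] hc) auto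
    also have "\<dots> = (\<Sum>j\<in>I. cnj (x j) * circle_inner h (\<lambda>w. 1 / (w - a j)) r)"
    proof -
      have "circle_inner h (\<lambda>w. \<Sum>i\<in>I. x i * (1 / (w - a i))) r
          = (\<Sum>j\<in>I. cnj (x j) * circle_inner h (\<lambda>w. 1 / (w - a j)) r)"
        using elim by (intro circle_inner_sum_right fin hc c) auto
      thus ?thesis unfolding h'[symmetric] .
    qed
    also have "\<dots> = (\<Sum>j\<in>I. cnj (x j) * (\<Sum>i\<in>I. x i * circle_inner (\<lambda>w. 1 / (w - a i)) (\<lambda>w. 1 / (w - a j)) r))"
    proof (intro sum.cong refl arg_cong2[where f = "(*)"])
      fix j assume j: "j \<in> I"
      show "circle_inner h (\<lambda>w. 1 / (w - a j)) r
          = (\<Sum>i\<in>I. x i * circle_inner (\<lambda>w. 1 / (w - a i)) (\<lambda>w. 1 / (w - a j)) r)"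
        unfolding h' using elim by (intro circle_inner_sum_left fin c j) auto
    qed
    also have "\<dots> = (\<Sum>j\<in>I. \<Sum>i\<in>I. x i * cnj (x j) / (of_real (r\<^sup>2) - a i * cnj (a j)))"
      unfolding sum_distrib_left using elim circle_inner_cauchy
      by (intro sum.cong refl) (simp add: circle_inner_cauchy)
    also have "\<dots> = (\<Sum>i\<in>I. \<Sum>j\<in>I. x i * cnj (x j) / (of_real (r\<^sup>2) - a i * cnj (a j)))"
      by (rule sum.swap)
    finally have "norm (\<Sum>i\<in>I. \<Sum>j\<in>I. x i * cnj (x j) / (of_real (r\<^sup>2) - a i * cnj (a j)))
        = norm (complex_of_real ((hardy2_mean h r)\<^sup>2))" by simp
    thus ?case unfolding norm_of_real by (simp add: hardy2_mean_nonneg)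
  qed
  have "((\<lambda>r. sqrt (norm (\<Sum>i\<in>I. \<Sum>j\<in>I. x i * cnj (x j) / (of_real (r\<^sup>2) - a i * cnj (a j)))))
      \<longlongrightarrow> sqrt (norm (\<Sum>i\<in>I. \<Sum>j\<in>I. x i * cnj (x j) / (of_real (1\<^sup>2) - a i * cnj (a j))))) (at_left 1)"
  proof (intro tendsto_intros)
    fix i j assume ij: "i \<in> I" "j \<in> I"
    show "complex_of_real (1\<^sup>2) - a i * cnj (a j) \<noteq> 0"
      using one_minus_cnj_mult_ne_0[of "a j" "a i"] a[OF ij(1)] a[OF ij(2)]
      by (simp add: mult.commute less_imp_le)
  qed
  from Lim_transform_eventually[OF this ev] show ?thesis unfolding h_def by simp
qed

lemma dual_function_in_hardy2:
  assumes "\<And>m. a m \<noteq> 0 \<and> norm (a m) < 1"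
  shows "dual_function a N n \<in> hardy2"
  using assms by (intro bounded_holomorphic_in_hardy2[OF dual_function_holomorphic dual_function_bound]) auto

lemma le_of_le_sqrt_mult:
  fixes S c :: real
  assumes "0 \<le> S" "0 \<le> c" "S \<le> sqrt (c * S)"
  shows "S \<le> c"
proof (cases "S = 0")
  case False
  have "S\<^sup>2 \<le> (sqrt (c * S))\<^sup>2" using assms by (intro power_mono) auto
  hence "S * S \<le> c * S" using assms by (simp add: power2_eq_square)
  thus ?thesis using False assms by simp
qed (use assms in simp)

text \<open>With \<open>c n = b n / D n\<close> the sum \<open>S\<close> on the left equals \<open>\<langle>f, \<Sum> c n G n\<rangle>\<close>, where \<open>G n\<close> is the dual
  function. Near the boundary \<open>\<Sum> c n G n\<close> is bounded by a sum of Cauchy kernels with coefficients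
  \<open>x n\<close> such that \<open>|x n| \<le> |b n| / \<delta>\<close>, whose squared norm is at most a multiple of \<open>S\<close> by
  \<open>cauchy_form_bound\<close>. Thus \<open>S\<close> is bounded by a multiple of its square root.\<close>

lemma dual_system_bessel:
  assumes f: "f \<in> hardy2" and M: "\<And>r. 0 < r \<Longrightarrow> r < 1 \<Longrightarrow> hardy2_mean f r \<le> M"
    and sep: "finitely_separated a \<delta>" and a: "\<And>m. a m \<noteq> 0 \<and> norm (a m) < 1"
  shows "(\<Sum>n<N. (norm (hardy2_inner f (dual_function a N n)))\<^sup>2 / (1 - (norm (a n))\<^sup>2))
    \<le> M\<^sup>2 * (16 * (1 + 2 * ln (1 / \<delta>)) / \<delta>\<^sup>2)"
proof -
  define A where "A = 1 + 2 * ln (1 / \<delta>)"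
  define D where "D = (\<lambda>n. 1 - (norm (a n))\<^sup>2)"
  define b where "b = (\<lambda>n. hardy2_inner f (dual_function a N n))"
  define c where "c = (\<lambda>n. b n / of_real (D n))"
  define x where "x = (\<lambda>n. - (c n * dual_coeff a N n * of_real (norm (a n)) / cnj (a n)))"
  define S where "S = (\<Sum>n<N. (norm (b n))\<^sup>2 / D n)"
  define h where "h = (\<lambda>w. \<Sum>n<N. x n / (w - a n))"
  define g where "g = (\<lambda>w. \<Sum>n<N. c n * dual_function a N n w)"
  define Y where "Y = (\<Sum>i<N. \<Sum>j<N. x i * cnj (x j) / (1 - a i * cnj (a j)))"
  have \<delta>: "\<delta> > 0" using sep unfolding finitely_separated_def by simp
  \<comment> \<open>The empty product shows \<open>\<delta> \<le> 1\<close>.\<close>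
  have "\<delta> \<le> (\<Prod>m\<in>{..<0} - {0}. pseudohyperbolic (a m) (a 0))"
    using sep unfolding finitely_separated_def by blast
  hence "\<delta> \<le> 1" by simp
  hence "ln \<delta> \<le> 0" using \<delta> by simp
  moreover have "ln (1 / \<delta>) = - ln \<delta>" using \<delta> by (simp add: ln_div)
  ultimately have A0: "A \<ge> 0" unfolding A_def by linarith
  have D: "D n > 0" for n using a[of n] unfolding D_def by (simp add: abs_square_less_1)
  have M0: "M \<ge> 0" using M[of "1/2"] hardy2_mean_nonneg[of f "1/2"] by simp
  have S0: "S \<ge> 0" unfolding S_def using D by (intro sum_nonneg) (auto simp: less_imp_le)
  have fhol: "f holomorphic_on unit_disc" using f by (simp add: hardy2_def)
  note cont = holomorphic_continuous_on_circle
  have Ghol: "dual_function a N n holomorphic_on unit_disc" for n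
    using a by (intro dual_function_holomorphic) auto
  have ghol: "g holomorphic_on unit_disc" unfolding g_def by (intro holomorphic_intros Ghol)
  have "((\<lambda>r. \<Sum>n<N. cnj (c n) * circle_inner f (dual_function a N n) r)
      \<longlongrightarrow> (\<Sum>n<N. cnj (c n) * b n)) (at_left 1)"
    unfolding b_def by (intro tendsto_intros hardy2_inner_limit f dual_function_in_hardy2 a)
  moreover have "\<forall>\<^sub>F r in at_left 1. (\<Sum>n<N. cnj (c n) * circle_inner f (dual_function a N n) r)
      = circle_inner f g r"
    unfolding g_def using fhol Ghol
    by (intro eventually_at_leftI[of 0] circle_inner_sum_right[symmetric] cont) auto
  ultimately have "(circle_inner f g \<longlongrightarrow> (\<Sum>n<N. cnj (c n) * b n)) (at_left 1)"
    by (rule Lim_transform_eventually)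
  moreover have "(\<Sum>n<N. cnj (c n) * b n) = of_real S"
    unfolding S_def c_def of_real_sum of_real_divide complex_norm_square
    by (intro sum.cong refl) (simp add: mult.commute)
  ultimately have "(circle_inner f g \<longlongrightarrow> of_real S) (at_left 1)" by simp
  hence "((\<lambda>r. norm (circle_inner f g r)) \<longlongrightarrow> norm (complex_of_real S)) (at_left 1)"
    by (rule tendsto_norm)
  hence lim1: "((\<lambda>r. norm (circle_inner f g r)) \<longlongrightarrow> S) (at_left 1)" using S0 by simp
  have lim2: "((\<lambda>r. M * hardy2_mean h r) \<longlongrightarrow> M * sqrt (norm Y)) (at_left 1)"
    unfolding h_def Y_def using a by (intro tendsto_intros cauchy_sum_mean_limit) auto
  have "S \<le> M * sqrt (norm Y)"
  proof (rule tendsto_le[OF _ lim2 lim1])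
    have "\<forall>\<^sub>F r in at_left (1::real). 0 < r \<and> r < 1 \<and> (\<forall>i\<in>{..<N}. norm (a i) < r)"
      using a by (intro eventually_circle_beyond_points) auto
    thus "\<forall>\<^sub>F r in at_left 1. norm (circle_inner f g r) \<le> M * hardy2_mean h r"
    proof eventually_elim
      case (elim r)
      have hc: "continuous_on (sphere 0 r) h" unfolding h_def using elim by (intro continuous_intros) auto
      have "norm (circle_inner f g r) \<le> hardy2_mean f r * hardy2_mean g r"
        using elim fhol ghol by (intro circle_inner_Cauchy_Schwarz cont) auto
      also have "hardy2_mean g r \<le> hardy2_mean h r"
      proof (rule hardy2_mean_mono)
        fix w :: complex assume w: "norm w = r"
        have "c n * dual_function a N n w = (\<Prod>m<N. blaschke_factor (a m) w) * (x n / (w - a n))" if "n < N" for n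
        proof -
          have "w \<noteq> a n" "norm w < 1" using elim w that by auto
          from dual_function_eq_cauchy[of a n N w, OF a that this(2,1)] show ?thesis
            unfolding x_def by (simp add: mult_ac)
        qed
        hence "g w = (\<Prod>m<N. blaschke_factor (a m) w) * h w"
          unfolding g_def h_def sum_distrib_left by (intro sum.cong) auto
        moreover have "norm (\<Prod>m<N. blaschke_factor (a m) w) \<le> 1"
          using a w elim by (intro norm_finite_blaschke_le_1) auto
        ultimately show "norm (g w) \<le> norm (h w)" by (simp add: norm_mult mult_left_le_one_le)
      qed (use elim hc ghol cont in auto)
      hence "hardy2_mean f r * hardy2_mean g r \<le> M * hardy2_mean h r"
        using M[of r] elim M0 by (intro mult_mono hardy2_mean_nonneg) auto
      finally show ?case .
    qed
  qed simp
  also have "norm Y \<le> 16 * A / \<delta>\<^sup>2 * S"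
  proof -
    have "norm Y \<le> 16 * A * (\<Sum>n<N. (norm (x n))\<^sup>2 / (1 - (norm (a n))\<^sup>2))"
      unfolding Y_def A_def using a finitely_separated_imp_kernel_test[OF sep]
      by (intro cauchy_form_bound) auto
    also have "\<dots> \<le> 16 * A * (\<Sum>n<N. (norm (b n))\<^sup>2 / D n / \<delta>\<^sup>2)"
    proof (intro mult_left_mono sum_mono)
      fix n
      have "norm (x n) = norm (c n) * norm (dual_coeff a N n)"
        using a[of n] unfolding x_def by (simp add: norm_mult norm_divide)
      also have "\<dots> \<le> norm (c n) * (D n / \<delta>)"
        unfolding D_def using norm_dual_coeff_le[OF sep a] by (intro mult_left_mono) auto
      also have "\<dots> = norm (b n) / \<delta>" unfolding c_def norm_divide using D[of n] by simp
      finally have "(norm (x n))\<^sup>2 \<le> (norm (b n) / \<delta>)\<^sup>2" by (intro power_mono) auto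
      hence "(norm (x n))\<^sup>2 / D n \<le> (norm (b n) / \<delta>)\<^sup>2 / D n" using D[of n] by (intro divide_right_mono) auto
      thus "(norm (x n))\<^sup>2 / (1 - (norm (a n))\<^sup>2) \<le> (norm (b n))\<^sup>2 / D n / \<delta>\<^sup>2"
        by (simp add: power_divide mult.commute D_def)
    qed (use A0 in simp)
    also have "\<dots> = 16 * A / \<delta>\<^sup>2 * S" unfolding S_def sum_divide_distrib[symmetric] by simp
    finally show ?thesis .
  qed
  hence "M * sqrt (norm Y) \<le> M * sqrt (16 * A / \<delta>\<^sup>2 * S)" using M0 by (intro mult_left_mono) auto
  also have "\<dots> = sqrt ((M\<^sup>2 * (16 * A / \<delta>\<^sup>2)) * S)"
  proof -
    have "sqrt (M\<^sup>2 * X) = M * sqrt X" for X using M0 by (simp add: real_sqrt_mult)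
    thus ?thesis by (simp only: mult.assoc)
  qed
  finally have le_sqrt: "S \<le> sqrt ((M\<^sup>2 * (16 * A / \<delta>\<^sup>2)) * S)" .
  have "0 \<le> M\<^sup>2 * (16 * A / \<delta>\<^sup>2)" using A0 by simp
  from le_of_le_sqrt_mult[OF S0 this le_sqrt] have "S \<le> M\<^sup>2 * (16 * A / \<delta>\<^sup>2)" .
  thus ?thesis unfolding S_def b_def D_def A_def .
qed

section \<open>Approximation in the model space\<close>

text \<open>The truncated kernel at \<open>z\<close> is a combination of the dual functions with coefficients
  \<open>1 / (1 - a n * cnj z)\<close>, which become \<open>1 / (1 - cnj (a n) * z)\<close> on leaving the second, conjugate
  linear, argument of the inner product.\<close>

lemma model_space_approximation:
  assumes f: "f \<in> model_space (blaschke_product a)"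
    and M: "\<And>r. 0 < r \<Longrightarrow> r < 1 \<Longrightarrow> hardy2_mean f r \<le> M"
    and a: "blaschke_sequence a" and inj: "inj a" and z: "norm z < 1"
  shows "norm (f z - (\<Sum>n<N. hardy2_inner f (dual_function a N n) / (1 - cnj (a n) * z)))
    \<le> M * sqrt (\<Sum>n. 1 - (norm (a (n + N)))\<^sup>2) / (1 - norm z)"
proof -
  have a': "a m \<noteq> 0 \<and> norm (a m) < 1" for m using a by (auto simp: blaschke_sequence_def)
  have fH: "f \<in> hardy2" using f by (simp add: model_space_def)
  have fhol: "f holomorphic_on unit_disc" using fH by (simp add: hardy2_def)
  have M0: "M \<ge> 0" using M[of "1/2"] hardy2_mean_nonneg[of f "1/2"] by simp
  note cont = holomorphic_continuous_on_circle
  define P where "P = (\<lambda>z. \<Prod>m<N. blaschke_factor (a m) z)"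
  define R where "R = blaschke_product (\<lambda>n. a (n + N))"
  define b where "b = (\<lambda>n. hardy2_inner f (dual_function a N n))"
  have P: "P holomorphic_on unit_disc" "\<And>w. norm w < 1 \<Longrightarrow> norm (P w) \<le> 1"
    unfolding P_def using a'
    by (auto intro!: holomorphic_intros blaschke_factor_holomorphic norm_finite_blaschke_le_1)
  have R: "R holomorphic_on unit_disc" "\<And>w. norm w < 1 \<Longrightarrow> norm (R w) \<le> 1"
    unfolding R_def
    by (auto intro!: blaschke_product_holomorphic norm_blaschke_product_le_1 blaschke_sequence_shift[OF a])
  have Ck: "szego_kernel z \<in> hardy2"
    using z szego_kernel_bound[OF z]
    by (intro bounded_holomorphic_in_hardy2[OF szego_kernel_holomorphic, where M = "1 / (1 - norm z)"]) auto
  have orth: "(circle_inner f (\<lambda>w. P w * R w * szego_kernel z w) \<longlongrightarrow> 0) (at_left 1)"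
  proof -
    define h where "h = (\<lambda>w. blaschke_product a w * szego_kernel z w)"
    have "h \<in> hardy2" unfolding h_def
    proof (rule bounded_holomorphic_in_hardy2)
      show "(\<lambda>w. blaschke_product a w * szego_kernel z w) holomorphic_on unit_disc"
        by (intro holomorphic_intros blaschke_product_holomorphic a szego_kernel_holomorphic z)
      fix w :: complex assume w: "norm w < 1"
      have "norm (blaschke_product a w) * norm (szego_kernel z w) \<le> 1 * (1 / (1 - norm z))"
        using w by (intro mult_mono norm_blaschke_product_le_1 a szego_kernel_bound z) auto
      thus "norm (blaschke_product a w * szego_kernel z w) \<le> 1 / (1 - norm z)"
        by (simp add: norm_mult)
    qed
    hence "(circle_inner f h \<longlongrightarrow> hardy2_inner f h) (at_left 1)" by (rule hardy2_inner_limit[OF fH])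
    also have "hardy2_inner f h = 0" using f Ck unfolding model_space_def h_def by blast
    finally have "(circle_inner f h \<longlongrightarrow> 0) (at_left 1)" .
    moreover have "\<forall>\<^sub>F r in at_left 1. circle_inner f h r
        = circle_inner f (\<lambda>w. P w * R w * szego_kernel z w) r"
    proof (rule eventually_at_leftI[of 0])
      fix r :: real assume r: "r \<in> {0<..<1}"
      show "circle_inner f h r = circle_inner f (\<lambda>w. P w * R w * szego_kernel z w) r"
        using r blaschke_product_split[OF a, of _ N] unfolding h_def P_def R_def
        by (intro circle_inner_cong) auto
    qed simp
    ultimately show ?thesis by (rule Lim_transform_eventually)
  qed
  have lim: "(circle_inner f (\<lambda>w. (1 - cnj (P z) * P w) * szego_kernel z w)
      \<longlongrightarrow> (\<Sum>n<N. b n / (1 - cnj (a n) * z))) (at_left 1)"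
  proof -
    have "((\<lambda>r. \<Sum>n<N. cnj (1 / (1 - a n * cnj z)) * circle_inner f (dual_function a N n) r)
        \<longlongrightarrow> (\<Sum>n<N. cnj (1 / (1 - a n * cnj z)) * b n)) (at_left 1)"
      unfolding b_def by (intro tendsto_intros hardy2_inner_limit fH dual_function_in_hardy2 a')
    moreover have "\<forall>\<^sub>F r in at_left 1. (\<Sum>n<N. cnj (1 / (1 - a n * cnj z)) * circle_inner f (dual_function a N n) r)
        = circle_inner f (\<lambda>w. (1 - cnj (P z) * P w) * szego_kernel z w) r"
    proof (rule eventually_at_leftI[of 0])
      fix r :: real assume r: "r \<in> {0<..<1}"
      have "circle_inner f (\<lambda>w. (1 - cnj (P z) * P w) * szego_kernel z w) r
          = circle_inner f (\<lambda>w. \<Sum>n<N. 1 / (1 - a n * cnj z) * dual_function a N n w) r"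
      proof (rule circle_inner_cong)
        fix w :: complex assume "norm w = r"
        hence "norm w < 1" using r by simp
        from finite_blaschke_kernel[OF a' inj z this, of N]
        show "(1 - cnj (P z) * P w) * szego_kernel z w = (\<Sum>n<N. 1 / (1 - a n * cnj z) * dual_function a N n w)"
          unfolding P_def szego_kernel_def by simp
      qed (use r in auto)
      also have "\<dots> = (\<Sum>n<N. cnj (1 / (1 - a n * cnj z)) * circle_inner f (dual_function a N n) r)"
        using r fhol a' by (intro circle_inner_sum_right cont dual_function_holomorphic) auto
      finally show "(\<Sum>n<N. cnj (1 / (1 - a n * cnj z)) * circle_inner f (dual_function a N n) r)
        = circle_inner f (\<lambda>w. (1 - cnj (P z) * P w) * szego_kernel z w) r" ..
    qed simp
    ultimately have "(circle_inner f (\<lambda>w. (1 - cnj (P z) * P w) * szego_kernel z w)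
        \<longlongrightarrow> (\<Sum>n<N. cnj (1 / (1 - a n * cnj z)) * b n)) (at_left 1)"
      by (rule Lim_transform_eventually)
    thus ?thesis by simp
  qed
  define \<tau> where "\<tau> = (\<Sum>n. 1 - (norm (a (n + N)))\<^sup>2)"
  have d: "1 - norm z > 0" using z by simp
  have "norm (f z - (\<Sum>n<N. b n / (1 - cnj (a n) * z)))
      \<le> M * sqrt ((1 - (norm (R z))\<^sup>2) / (1 - (norm z)\<^sup>2))"
    by (rule truncated_kernel_error[OF fH M P R z orth lim])
  also have "(1 - (norm (R z))\<^sup>2) / (1 - (norm z)\<^sup>2) \<le> \<tau> / (1 - norm z)\<^sup>2"
  proof -
    have "1 - (norm (R z))\<^sup>2 \<le> \<tau> * ((1 + norm z) / (1 - norm z))"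
      unfolding R_def \<tau>_def by (rule one_minus_norm_blaschke_product_sq_le[OF blaschke_sequence_shift[OF a] z])
    hence "(1 - (norm (R z))\<^sup>2) / (1 - (norm z)\<^sup>2) \<le> \<tau> * ((1 + norm z) / (1 - norm z)) / (1 - (norm z)\<^sup>2)"
      using z by (intro divide_right_mono) (auto simp: power_le_one)
    also have "\<tau> * ((1 + norm z) / (1 - norm z)) / (1 - (norm z)\<^sup>2) = \<tau> / (1 - norm z)\<^sup>2"
    proof -
      have factor: "1 - (norm z)\<^sup>2 = (1 + norm z) * (1 - norm z)"
        by (simp add: power2_eq_square algebra_simps)
      have cancel: "t * (s / e) / (s * e) = t / e\<^sup>2" if "s \<noteq> 0" for t s e :: real
        using that by (simp add: power2_eq_square)
      have "1 + norm z \<noteq> 0" using norm_ge_zero[of z] by linarith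
      from cancel[OF this] show ?thesis unfolding factor .
    qed
    finally show ?thesis .
  qed
  hence "M * sqrt ((1 - (norm (R z))\<^sup>2) / (1 - (norm z)\<^sup>2)) \<le> M * sqrt (\<tau> / (1 - norm z)\<^sup>2)"
    using M0 by (intro mult_left_mono) auto
  also have "\<dots> = M * sqrt \<tau> / (1 - norm z)" using d by (simp add: real_sqrt_divide)
  finally show ?thesis unfolding b_def \<tau>_def .
qed

lemma tail_suminf_tendsto_0:
  fixes u :: "nat \<Rightarrow> real"
  assumes "summable u"
  shows "(\<lambda>N. \<Sum>n. u (n + N)) \<longlonglongrightarrow> 0"
proof -
  have "(\<lambda>N. suminf u - (\<Sum>i<N. u i)) \<longlonglongrightarrow> suminf u - suminf u"
    by (intro tendsto_intros summable_LIMSEQ assms)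
  thus ?thesis by (simp add: suminf_minus_initial_segment[OF assms])
qed

lemma model_space_deriv_limit:
  assumes f: "f \<in> model_space (blaschke_product a)"
    and M: "\<And>r. 0 < r \<Longrightarrow> r < 1 \<Longrightarrow> hardy2_mean f r \<le> M"
    and a: "blaschke_sequence a" and inj: "inj a" and z: "norm z < 1"
  shows "(\<lambda>N. \<Sum>n<N. hardy2_inner f (dual_function a N n) * cnj (a n) / (1 - cnj (a n) * z)\<^sup>2)
    \<longlonglongrightarrow> deriv f z"
proof -
  have a1: "norm (a m) < 1" for m using a by (auto simp: blaschke_sequence_def)
  define b where "b = (\<lambda>N n. hardy2_inner f (dual_function a N n))"
  define F where "F = (\<lambda>N z. \<Sum>n<N. b N n / (1 - cnj (a n) * z))"
  define \<tau> where "\<tau> = (\<lambda>N. \<Sum>n. 1 - (norm (a (n + N)))\<^sup>2)"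
  \<comment> \<open>A disc about \<open>0\<close> that contains \<open>z\<close>; on it the error bound is uniform.\<close>
  define s where "s = (1 + norm z) / 2"
  have s: "norm z < s" "s < 1" unfolding s_def using z by auto
  have M0: "M \<ge> 0" using M[of "1/2"] hardy2_mean_nonneg[of f "1/2"] by simp
  have \<tau>: "\<tau> \<longlonglongrightarrow> 0"
    unfolding \<tau>_def using tail_suminf_tendsto_0[OF blaschke_sequence_square_summable[OF a]] .
  have \<tau>0: "\<tau> N \<ge> 0" for N unfolding \<tau>_def
    using blaschke_sequence_square_summable[OF blaschke_sequence_shift[OF a]] a1
    by (intro suminf_nonneg) (auto simp: power_le_one less_imp_le)
  have ne: "1 - cnj (a n) * w \<noteq> 0" if "norm w < 1" for n w
    using one_minus_cnj_mult_ne_0[OF a1, of w n] that by simp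
  have der: "(F N has_field_derivative (\<Sum>n<N. b N n * cnj (a n) / (1 - cnj (a n) * w)\<^sup>2)) (at w)"
    if "norm w < 1" for N w
    unfolding F_def using ne[OF that]
    by (auto intro!: derivative_eq_intros sum.cong simp: power2_eq_square)
  have "uniform_limit (ball 0 s) F f sequentially"
  proof (rule uniform_limitI)
    fix e :: real assume e: "e > 0"
    have "(\<lambda>N. M * sqrt (\<tau> N) / (1 - s)) \<longlonglongrightarrow> M * sqrt 0 / (1 - s)"
      using s by (intro tendsto_intros \<tau>) auto
    hence "\<forall>\<^sub>F N in sequentially. M * sqrt (\<tau> N) / (1 - s) < e"
      using e by (intro order_tendstoD) auto
    thus "\<forall>\<^sub>F N in sequentially. \<forall>w\<in>ball 0 s. dist (F N w) (f w) < e"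
    proof eventually_elim
      case (elim N)
      show ?case
      proof
        fix w :: complex assume w: "w \<in> ball 0 s"
        have "dist (F N w) (f w) \<le> M * sqrt (\<tau> N) / (1 - norm w)"
          using model_space_approximation[OF f M a inj, of w N] w s
          unfolding F_def b_def \<tau>_def by (simp add: dist_norm norm_minus_commute)
        also have "\<dots> \<le> M * sqrt (\<tau> N) / (1 - s)"
          using w s M0 \<tau>0 by (intro divide_left_mono mult_pos_pos mult_nonneg_nonneg) auto
        finally show "dist (F N w) (f w) < e" using elim by simp
      qed
    qed
  qed
  hence "(\<lambda>N. deriv (F N) z) \<longlonglongrightarrow> deriv f z"
  proof (rule deriv_complex_uniform_limit)
    show "\<forall>\<^sub>F N in sequentially. F N holomorphic_on ball 0 s"
      using der s by (intro always_eventually allI) (force simp: holomorphic_on_open)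
  qed (use s in auto)
  moreover have "deriv (F N) z = (\<Sum>n<N. b N n * cnj (a n) / (1 - cnj (a n) * z)\<^sup>2)" for N
    by (rule DERIV_imp_deriv[OF der[OF z]])
  ultimately show ?thesis unfolding b_def by simp
qed

section \<open>Membership of the derivative in the Bergman space\<close>

lemma powr_add_le_add_powr:
  fixes x y p :: real
  assumes "0 \<le> x" "0 \<le> y" "0 < p" "p \<le> 1"
  shows "(x + y) powr p \<le> x powr p + y powr p"
proof (cases "x = 0 \<or> y = 0")
  case False
  hence xy: "x > 0" "y > 0" using assms by auto
  have split: "t powr p = t * t powr (p - 1)" if "t > 0" for t :: real
    using that by (simp add: powr_diff)
  have "(x + y) powr p = x * (x + y) powr (p - 1) + y * (x + y) powr (p - 1)"
    using split[of "x + y"] xy by (simp add: distrib_right)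
  also have "\<dots> \<le> x * x powr (p - 1) + y * y powr (p - 1)"
    using xy assms by (intro add_mono mult_left_mono powr_mono2') auto
  finally show ?thesis using split[of x] split[of y] xy by simp
qed auto

lemma norm_sum_powr_le:
  fixes x :: "'i \<Rightarrow> complex"
  assumes "0 < p" "p \<le> 1"
  shows "norm (\<Sum>i\<in>I. x i) powr p \<le> (\<Sum>i\<in>I. norm (x i) powr p)"
proof (induction I rule: infinite_finite_induct)
  case (insert j I)
  have "norm (\<Sum>i\<in>insert j I. x i) powr p \<le> (norm (x j) + norm (\<Sum>i\<in>I. x i)) powr p"
    using insert assms by (intro powr_mono2) (auto intro: norm_triangle_ineq)
  also have "\<dots> \<le> norm (x j) powr p + norm (\<Sum>i\<in>I. x i) powr p"
    using assms by (intro powr_add_le_add_powr) auto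
  finally show ?case using insert by simp
qed auto

lemma powr_mult_powr_le_add:
  fixes X Y t :: real
  assumes "X \<ge> 0" "Y \<ge> 0" "0 \<le> t" "t \<le> 1"
  shows "X powr t * Y powr (1 - t) \<le> X + Y"
proof -
  have "X powr t * Y powr (1 - t) \<le> max X Y powr t * max X Y powr (1 - t)"
    using assms by (intro mult_mono powr_mono2) auto
  also have "\<dots> = max X Y" using assms by (simp add: powr_add[symmetric])
  also have "\<dots> \<le> X + Y" using assms by auto
  finally show ?thesis .
qed

text \<open>Young's inequality for \<open>b powr p = (b\<^sup>2 / D) powr (p/2) * D powr (p/2)\<close> with the exponents \<open>p/2\<close> and
  \<open>1 - p/2\<close>. It separates the coefficients from the distances of the zeros to the circle.\<close>

lemma powr_le_square_quotient_add:
  fixes b D p :: real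
  assumes "b \<ge> 0" "D > 0" "0 < p" "p < 2"
  shows "b powr p \<le> b\<^sup>2 / D + D powr (p / (2 - p))"
proof (cases "b = 0")
  case False
  hence b: "b > 0" using assms by simp
  have "(b\<^sup>2 / D) powr (p / 2) * (D powr (p / (2 - p))) powr (1 - p / 2)
      = b powr p / D powr (p / 2) * D powr (p / (2 - p) * (1 - p / 2))"
    using b assms by (simp add: powr_divide powr_powr powr_numeral[symmetric] del: powr_numeral)
  also have "p / (2 - p) * (1 - p / 2) = p / 2" using assms by (simp add: field_simps)
  finally have "b powr p = (b\<^sup>2 / D) powr (p / 2) * (D powr (p / (2 - p))) powr (1 - p / 2)"
    using assms by simp
  also have "\<dots> \<le> b\<^sup>2 / D + D powr (p / (2 - p))"
    using assms by (intro powr_mult_powr_le_add) auto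
  finally show ?thesis .
qed (use assms in simp)

theorem theorem8:
  fixes a :: "nat \<Rightarrow> complex" and \<alpha> p :: real
  assumes "blaschke_sequence a"
    and "uniformly_separated a"
    and "-1 < \<alpha>" and "\<alpha> \<le> 0"
    and "1 + \<alpha> \<le> p" and "p < 1 + \<alpha> / 2"
    and "summable (\<lambda>n. (1 - norm (a n)) powr (p / (2 - p)))"
  shows "\<forall>f \<in> model_space (blaschke_product a). deriv f \<in> weighted_bergman p \<alpha>"
proof
  fix f assume f: "f \<in> model_space (blaschke_product a)"
  have a: "a m \<noteq> 0 \<and> norm (a m) < 1" for m using assms(1) by (auto simp: blaschke_sequence_def)
  have p: "0 < p" "p \<le> 1" "2 * p < 2 + \<alpha>" "p < 2" using assms by auto
  obtain \<delta> where \<delta>: "finitely_separated a \<delta>" using uniformly_separated_imp_finitely_separated[OF assms(2)] .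
  have inj: "inj a" by (rule finitely_separated_imp_inj[OF \<delta>])
  have fH: "f \<in> hardy2" using f by (simp add: model_space_def)
  hence fhol: "f holomorphic_on unit_disc" by (simp add: hardy2_def)
  from fH obtain M where "\<forall>r\<in>{0<..<1}. hardy2_mean f r \<le> M"
    unfolding hardy2_def bdd_above_def by auto
  hence M: "\<And>r. 0 < r \<Longrightarrow> r < 1 \<Longrightarrow> hardy2_mean f r \<le> M" by auto
  obtain K where K0: "K \<ge> 0" and K: "\<And>c. norm c < 1 \<Longrightarrow>
      (\<integral>\<^sup>+z\<in>unit_disc. ennreal (norm (1 - cnj c * z) powr (- 2 * p) * (1 - norm z) powr \<alpha>) \<partial>lborel)
        \<le> ennreal K"
    using bergman_kernel_integral_bound[OF assms(3,4) p(1,3)] by blast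
  define b where "b = (\<lambda>N n. hardy2_inner f (dual_function a N n))"
  define D where "D = (\<lambda>n. 1 - (norm (a n))\<^sup>2)"
  have D: "D n > 0" for n using a[of n] unfolding D_def by (simp add: abs_square_less_1)
  define e where "e = p / (2 - p)"
  have e: "e > 0" unfolding e_def using p by simp
  define C where "C = M\<^sup>2 * (16 * (1 + 2 * ln (1 / \<delta>)) / \<delta>\<^sup>2) + 2 powr e * (\<Sum>n. (1 - norm (a n)) powr e)"
  have sum_b: "(\<Sum>n<N. norm (b N n) powr p) \<le> C" for N
  proof -
    have "(\<Sum>n<N. norm (b N n) powr p) \<le> (\<Sum>n<N. (norm (b N n))\<^sup>2 / D n + D n powr e)"
      unfolding e_def using D p by (intro sum_mono powr_le_square_quotient_add) auto
    also have "\<dots> = (\<Sum>n<N. (norm (b N n))\<^sup>2 / D n) + (\<Sum>n<N. D n powr e)" by (rule sum.distrib)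
    also have "(\<Sum>n<N. (norm (b N n))\<^sup>2 / D n) \<le> M\<^sup>2 * (16 * (1 + 2 * ln (1 / \<delta>)) / \<delta>\<^sup>2)"
      unfolding b_def D_def by (rule dual_system_bessel[OF fH M \<delta> a])
    also have "(\<Sum>n<N. D n powr e) \<le> 2 powr e * (\<Sum>n. (1 - norm (a n)) powr e)"
    proof -
      have "D n powr e \<le> 2 powr e * (1 - norm (a n)) powr e" for n
      proof -
        have "D n = (1 + norm (a n)) * (1 - norm (a n))"
          unfolding D_def by (simp add: power2_eq_square algebra_simps)
        also have "\<dots> \<le> 2 * (1 - norm (a n))" using a[of n] by (intro mult_right_mono) auto
        finally have "D n powr e \<le> (2 * (1 - norm (a n))) powr e"
          using e D[of n] by (intro powr_mono2) auto
        also have "\<dots> = 2 powr e * (1 - norm (a n)) powr e"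
          by (rule powr_mult)
        finally show ?thesis .
      qed
      hence "(\<Sum>n<N. D n powr e) \<le> (\<Sum>n<N. 2 powr e * (1 - norm (a n)) powr e)"
        by (intro sum_mono)
      also have "\<dots> = 2 powr e * (\<Sum>n<N. (1 - norm (a n)) powr e)" by (simp add: sum_distrib_left)
      also have "\<dots> \<le> 2 powr e * (\<Sum>n. (1 - norm (a n)) powr e)"
        using assms(7) unfolding e_def by (intro mult_left_mono sum_le_suminf) auto
      finally show ?thesis .
    qed
    finally show ?thesis unfolding C_def by simp
  qed
  define k where "k = (\<lambda>n z. ennreal (norm (1 - cnj (a n) * z) powr (- 2 * p) * (1 - norm z) powr \<alpha>)
                            * indicator unit_disc z)"
  have [measurable]: "(unit_disc :: complex set) \<in> sets borel" by simp
  have [measurable]: "k n \<in> borel_measurable borel" for n unfolding k_def by measurable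
  define G where "G = (\<lambda>N z. \<Sum>n<N. ennreal (norm (b N n) powr p) * k n z)"
  have [measurable]: "G N \<in> borel_measurable borel" for N unfolding G_def by measurable
  have G: "(\<integral>\<^sup>+z. G N z \<partial>lborel) \<le> ennreal (C * K)" for N
  proof -
    have "(\<integral>\<^sup>+z. G N z \<partial>lborel) = (\<Sum>n<N. ennreal (norm (b N n) powr p) * (\<integral>\<^sup>+z. k n z \<partial>lborel))"
      unfolding G_def by (subst nn_integral_sum) (auto simp: nn_integral_cmult)
    also have "\<dots> \<le> (\<Sum>n<N. ennreal (norm (b N n) powr p) * ennreal K)"
      unfolding k_def using a by (intro sum_mono mult_left_mono K) auto
    also have "\<dots> = ennreal ((\<Sum>n<N. norm (b N n) powr p) * K)"
      using K0 by (simp add: sum_distrib_right ennreal_mult sum_ennreal[symmetric])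
    also have "\<dots> \<le> ennreal (C * K)" using K0 sum_b[of N] by (intro ennreal_leI mult_right_mono)
    finally show ?thesis .
  qed
  \<comment> \<open>The integrands \<open>G N\<close> need not converge; only a lower bound for their lower limit is needed.\<close>
  have ptw: "ennreal (norm (deriv f z) powr p * (1 - norm z) powr \<alpha>) * indicator unit_disc z
      \<le> liminf (\<lambda>N. G N z)" for z
  proof (cases "z \<in> unit_disc")
    case False thus ?thesis by simp
  next
    case True
    hence z: "norm z < 1" by simp
    define F where "F = (\<lambda>N. \<Sum>n<N. b N n * cnj (a n) / (1 - cnj (a n) * z)\<^sup>2)"
    have "F \<longlonglongrightarrow> deriv f z" unfolding F_def b_def
      by (rule model_space_deriv_limit[OF f M assms(1) inj z])
    hence "(\<lambda>N. ennreal (norm (F N) powr p * (1 - norm z) powr \<alpha>))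
        \<longlonglongrightarrow> ennreal (norm (deriv f z) powr p * (1 - norm z) powr \<alpha>)"
      using p by (intro tendsto_ennrealI tendsto_mult tendsto_powr' tendsto_norm tendsto_const) auto
    hence "ennreal (norm (deriv f z) powr p * (1 - norm z) powr \<alpha>)
        = liminf (\<lambda>N. ennreal (norm (F N) powr p * (1 - norm z) powr \<alpha>))"
      by (intro lim_imp_Liminf[symmetric]) auto
    also have "\<dots> \<le> liminf (\<lambda>N. G N z)"
    proof (intro Liminf_mono always_eventually allI)
      fix N
      have "norm (F N) powr p \<le> (\<Sum>n<N. norm (b N n * cnj (a n) / (1 - cnj (a n) * z)\<^sup>2) powr p)"
        unfolding F_def by (rule norm_sum_powr_le[OF p(1,2)])
      also have "\<dots> \<le> (\<Sum>n<N. norm (b N n) powr p * norm (1 - cnj (a n) * z) powr (- 2 * p))"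
      proof (intro sum_mono)
        fix n
        define d where "d = norm (1 - cnj (a n) * z)"
        have d: "d > 0" unfolding d_def using one_minus_cnj_mult_ne_0[of "a n" z] a[of n] z by simp
        have "norm (b N n * cnj (a n) / (1 - cnj (a n) * z)\<^sup>2) = norm (b N n) * norm (a n) / d\<^sup>2"
          by (simp add: d_def norm_mult norm_divide norm_power)
        also have "\<dots> \<le> norm (b N n) / d\<^sup>2"
          using a[of n] by (intro divide_right_mono mult_left_le) auto
        finally have "norm (b N n * cnj (a n) / (1 - cnj (a n) * z)\<^sup>2) powr p \<le> (norm (b N n) / d\<^sup>2) powr p"
          using p by (intro powr_mono2) auto
        also have "\<dots> = norm (b N n) powr p * d powr (- 2 * p)"
        proof -
          have "(d\<^sup>2) powr p = d powr (2 * p)" using d by (simp add: powr_powr flip: powr_numeral)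
          thus ?thesis using d by (simp add: powr_divide powr_minus_divide)
        qed
        finally show "norm (b N n * cnj (a n) / (1 - cnj (a n) * z)\<^sup>2) powr p
            \<le> norm (b N n) powr p * norm (1 - cnj (a n) * z) powr (- 2 * p)" unfolding d_def .
      qed
      finally have "norm (F N) powr p * (1 - norm z) powr \<alpha>
          \<le> (\<Sum>n<N. norm (b N n) powr p * norm (1 - cnj (a n) * z) powr (- 2 * p)) * (1 - norm z) powr \<alpha>"
        by (intro mult_right_mono) auto
      hence "ennreal (norm (F N) powr p * (1 - norm z) powr \<alpha>)
          \<le> ennreal (\<Sum>n<N. norm (b N n) powr p * (norm (1 - cnj (a n) * z) powr (- 2 * p) * (1 - norm z) powr \<alpha>))"
        by (intro ennreal_leI) (simp add: sum_distrib_right mult.assoc)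
      also have "\<dots> = G N z" unfolding G_def k_def using True
        by (simp add: sum_ennreal[symmetric] ennreal_mult)
      finally show "ennreal (norm (F N) powr p * (1 - norm z) powr \<alpha>) \<le> G N z" .
    qed
    finally show ?thesis using True by simp
  qed
  have "(\<integral>\<^sup>+z\<in>unit_disc. ennreal (norm (deriv f z) powr p * (1 - norm z) powr \<alpha>) \<partial>lborel)
      \<le> (\<integral>\<^sup>+z. liminf (\<lambda>N. G N z) \<partial>lborel)"
    by (intro nn_integral_mono ptw)
  also have "\<dots> \<le> liminf (\<lambda>N. \<integral>\<^sup>+z. G N z \<partial>lborel)" by (rule nn_integral_liminf) measurable
  also have "\<dots> \<le> liminf (\<lambda>N. ennreal (C * K))" using G by (intro Liminf_mono always_eventually) auto
  also have "\<dots> = ennreal (C * K)" by (simp add: Liminf_const)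
  finally have "ennreal (1 / pi) *
      (\<integral>\<^sup>+z\<in>unit_disc. ennreal (norm (deriv f z) powr p * (1 - norm z) powr \<alpha>) \<partial>lborel)
      \<le> ennreal (1 / pi) * ennreal (C * K)" by (intro mult_left_mono) auto
  also have "\<dots> < \<infinity>" by (simp add: ennreal_mult_less_top)
  finally show "deriv f \<in> weighted_bergman p \<alpha>"
    unfolding weighted_bergman_def using holomorphic_deriv[OF fhol] by simp
qed

end
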